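(* Let $n$ be a positive integer and let $k(t)$ satisfy: (1) its complex extension $k(z)$ is analytic in the interval $[0,a)$; (2) $k(0)\neq0$. Let $\rho_0$ be the distance from the origin of the singularity of $k(z)$ nearest to the origin. Let $\omega$ satisfy $|\omega|<\min(a,\rho_0)$, $-\pi<\mathrm{Arg}(\omega)\le\pi$ and $|\mathrm{Arg}(\omega)|\neq\pi/2$. Then $$\int_0^a\frac{k(t)\ln^n t}{\omega^2+t^2}\,dt=\sum_{s=0}^{\infty}(-1)^s\omega^{2s}\;\mathrm{f.p.}\!\int_0^a\frac{k(t)\ln^n t}{t^{2s+2}}\,dt+\left[\frac{k(i\omega)+k(-i\omega)}{2}\right]\Delta_{n_1}(\omega)-i\left[\frac{k(i\omega)-k(-i\omega)}{2}\right]\Delta_{n_2}(\omega),$$ where $$\Delta_{n_1}(\omega)=\frac{n!}{\omega}\sum_{j=0}^{\lfloor n/2\rfloor}\frac{(-1)^j}{(n-2j)!\,(2j)!}\left(\frac{\pi}{2}\right)^{2j+1}E_{2j}\,(\mathrm{Log}\,\omega)^{n-2j},$$ $$\Delta_{n_2}(\omega)=-\frac{\mathrm{Log}^{n+1}\omega}{\omega\,(n+1)}+\frac{n!}{\omega}\sum_{j=1}^{\lceil n/2\rceil}\frac{(-1)^j(2^{2j}-2)}{(n-2j+1)!\,(2j)!}\left(\frac{\pi}{2}\right)^{2j}B_{2j}\,(\mathrm{Log}\,\omega)^{n-2j+1},$$ and $E_{2j}$, $B_{2j}$ are the Euler and Bernoulli numbers, respectively. The identity still holds for $a=\infty$, if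 the Stieltjes integral exists as $a\to\infty$, for $|\omega|<\infty$ when $k(z)$ has no singularity, or for $|\omega|<\rho_0$ when $k(z)$ has singularities. Lastly, $$\int_0^a\frac{k(t)\ln^n t}{\omega^2+t^2}\,dt\;\sim\;k(0)\,\Delta_{n_1}(\omega),\qquad\omega\to0.$$
   Context: Here $0<a\le\infty$, with $a<\infty$ in the first assertion and $a=\infty$ treated separately. Analytic in $[0,a)$ means that $k(z)$ is analytic in an open neighbourhood of $[0,a)$ in $\mathbb{C}$; $\rho_0=\infty$ if $k$ is entire. $\mathrm{Log}\,\omega=\ln|\omega|+i\,\mathrm{Arg}\,\omega$ with $-\pi<\mathrm{Arg}\,\omega\le\pi$ is the principal logarithm. Euler numbers: $\sec x=\sum_{m\ge0}\frac{(-1)^mE_{2m}}{(2m)!}x^{2m}$ (so $E_0=1$, $E_2=-1$). Bernoulli numbers: $\frac{x}{e^x-1}=\sum_{m\ge0}B_m\frac{x^m}{m!}$. Finite-part integral (written f.p. here; the paper uses a double-slashed integral sign): for $0<\epsilon<a$ write $\int_\epsilon^a k(t)t^{-\lambda}\ln^n t\,dt=C_\epsilon+D_\epsilon$, where $C_\epsilon$ converges and $D_\epsilon$ collects the diverging terms as $\epsilon\to0^+$, i.e. $D_\epsilon$ is a finite linear combination of functions $\epsilon^{-\mu}\ln^m\epsilon$ with $\mathrm{Re}\,\mu\ge0$, $m\in\mathbb{N}_0$, $(\mu,m)\ne(0,0)$. Then $\mathrm{f.p.}\int_0^a k(t)t^{-\lambda}\ln^n t\,dt:=\lim_{\epsi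lon\to0^+}C_\epsilon$.
   Formalization: For |Arg ω| > π/2 the printed identity and asymptotic fail (e.g. k=1, a=1, n=1, ω=−1/2); there k(±iω), Δ_{n1} and Δ_{n2} are evaluated at −ω instead of ω. Existence of the Stieltjes integral is also assumed for finite a. *)

theory Defs
  imports "HOL-Analysis.Analysis" "HOL-Library.Landau_Symbols"
begin

text \<open>Euler numbers: the coefficient of \<open>x^n\<close> in \<open>sec x\<close> is \<open>(-1)^(n div 2) E_n / n!\<close>
  (both are zero for odd \<open>n\<close>).\<close>

definition euler_num :: "nat \<Rightarrow> real" where
  "euler_num n = (-1) ^ (n div 2) * fact n * fps_nth (inverse (fps_cos 1)) n"

text \<open>Bernoulli numbers: \<open>x / (e^x - 1)\<close> is the exponential generating function.\<close>

definition bernoulli_num :: "nat \<Rightarrow> real" where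
  "bernoulli_num n = fact n * fps_nth (fps_X / (fps_exp 1 - 1)) n"

text \<open>The half-open interval from \<open>c\<close> to \<open>a\<close>, where \<open>a\<close> may be \<open>\<infinity>\<close>. Integrals over it are
  Henstock-Kurzweil integrals, so an integral that is only improper (conditionally convergent)
  at \<open>a\<close> is included.\<close>

definition upto_ereal :: "real \<Rightarrow> ereal \<Rightarrow> real set" where
  "upto_ereal c a = {t. c \<le> t \<and> ereal t < a}"

text \<open>Finite linear combinations of the functions \<open>\<epsilon>^(-\<mu>) ln^m \<epsilon>\<close> with \<open>Re \<mu> \<ge> 0\<close> and
  \<open>(\<mu>, m) \<noteq> (0, 0)\<close>.\<close>

definition diverging_terms :: "(real \<Rightarrow> complex) \<Rightarrow> bool" where
  "diverging_terms D \<longleftrightarrow>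
     (\<exists>P c. finite P \<and> (\<forall>(\<mu>, m) \<in> P. Re \<mu> \<ge> 0 \<and> (\<mu>, m) \<noteq> (0, 0)) \<and>
        D = (\<lambda>\<epsilon>. \<Sum>(\<mu>, m) \<in> P.
               c (\<mu>, m) * complex_of_real \<epsilon> powr (- \<mu>) * complex_of_real (ln \<epsilon>) ^ (m::nat)))"

definition has_fp_integral :: "(real \<Rightarrow> complex) \<Rightarrow> ereal \<Rightarrow> complex \<Rightarrow> bool" where
  "has_fp_integral f a I \<longleftrightarrow>
     (\<exists>C D. (\<forall>\<epsilon>. 0 < \<epsilon> \<and> ereal \<epsilon> < a \<longrightarrow> (f has_integral (C \<epsilon> + D \<epsilon>)) (upto_ereal \<epsilon> a)) \<and>
        diverging_terms D \<and> (C \<longlongrightarrow> I) (at_right 0))"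

definition fp_integral :: "(real \<Rightarrow> complex) \<Rightarrow> ereal \<Rightarrow> complex" where
  "fp_integral f a = (THE I. has_fp_integral f a I)"

text \<open>Distance from the origin to the nearest singularity of \<open>k\<close>; the infimum of the empty set is
  \<open>\<infinity>\<close>, the value for entire \<open>k\<close>.\<close>

definition sing_dist :: "(complex \<Rightarrow> complex) \<Rightarrow> ereal" where
  "sing_dist k = (INF z \<in> {z. \<not> k analytic_on {z}}. ereal (norm z))"

text \<open>The library's \<open>Arg\<close> takes its values in \<open>(-\<pi>, \<pi>]\<close>; \<open>\<omega> = 0\<close> has to be excluded explicitly
  because of the convention \<open>Arg 0 = 0\<close>.\<close>

definition admissible :: "(complex \<Rightarrow> complex) \<Rightarrow> ereal \<Rightarrow> complex set" where
  "admissible k a =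
     {\<omega>. \<omega> \<noteq> 0 \<and> \<bar>Arg \<omega>\<bar> \<noteq> pi / 2 \<and> ereal (norm \<omega>) < min a (sing_dist k)}"

definition stieltjes_integrand ::
    "(complex \<Rightarrow> complex) \<Rightarrow> nat \<Rightarrow> complex \<Rightarrow> real \<Rightarrow> complex" where
  "stieltjes_integrand k n \<omega> t =
     k (of_real t) * of_real (ln t) ^ n / (\<omega>\<^sup>2 + (of_real t)\<^sup>2)"

definition stieltjes :: "(complex \<Rightarrow> complex) \<Rightarrow> ereal \<Rightarrow> nat \<Rightarrow> complex \<Rightarrow> complex" where
  "stieltjes k a n \<omega> = integral (upto_ereal 0 a) (stieltjes_integrand k n \<omega>)"

definition moment_integrand ::
    "(complex \<Rightarrow> complex) \<Rightarrow> nat \<Rightarrow> nat \<Rightarrow> real \<Rightarrow> complex" where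
  "moment_integrand k n s t = k (of_real t) * of_real (ln t) ^ n / of_real t ^ (2 * s + 2)"

definition Delta1 :: "nat \<Rightarrow> complex \<Rightarrow> complex" where
  "Delta1 n \<omega> = fact n / \<omega> *
     (\<Sum>j = 0..n div 2. (-1) ^ j / (fact (n - 2 * j) * fact (2 * j)) *
        of_real ((pi / 2) ^ (2 * j + 1)) * of_real (euler_num (2 * j)) * Ln \<omega> ^ (n - 2 * j))"

text \<open>The upper limit \<open>(n + 1) div 2\<close> is \<open>\<lceil>n/2\<rceil>\<close>. The exponent \<open>n - 2j + 1\<close> is written
  \<open>n + 1 - 2j\<close> because subtraction of naturals truncates.\<close>

definition Delta2 :: "nat \<Rightarrow> complex \<Rightarrow> complex" where
  "Delta2 n \<omega> = - (Ln \<omega> ^ (n + 1)) / (\<omega> * of_nat (n + 1)) + fact n / \<omega> *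
     (\<Sum>j = 1..(n + 1) div 2.
        (-1) ^ j * (2 ^ (2 * j) - 2) / (fact (n + 1 - 2 * j) * fact (2 * j)) *
        of_real ((pi / 2) ^ (2 * j)) * of_real (bernoulli_num (2 * j)) * Ln \<omega> ^ (n + 1 - 2 * j))"

text \<open>The Stieltjes integral and the finite-part series depend on \<open>\<omega>\<close> only through \<open>\<omega>\<^sup>2\<close>, whereas
  the terms containing \<open>Delta1\<close> and \<open>Delta2\<close> are not even in \<open>\<omega>\<close>: with the principal logarithm they are
  correct at \<open>\<omega>\<close> itself only for \<open>\<bar>Arg \<omega>\<bar> < \<pi>/2\<close>. (For \<open>n = 1\<close>, \<open>k = 1\<close>, \<open>a = 1\<close>, \<open>\<omega> = -1/2\<close> the
  integral and the series are real, but \<open>Delta1 1 \<omega>\<close> has imaginary part \<open>-\<pi>\<^sup>2\<close>.) Hence these terms are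
  evaluated at the one of \<open>\<omega>\<close>, \<open>-\<omega>\<close> lying in the right half-plane, which is \<open>\<omega>\<close> itself when
  \<open>\<bar>Arg \<omega>\<bar> < \<pi>/2\<close>.\<close>

definition right_rep :: "complex \<Rightarrow> complex" where
  "right_rep \<omega> = (if \<bar>Arg \<omega>\<bar> < pi / 2 then \<omega> else - \<omega>)"

end

theory Submission
  imports Defs "HOL-Complex_Analysis.Complex_Analysis"
begin

text \<open>Replace \<open>\<omega>\<close> by the representative \<open>w\<close> of \<open>\<plusminus>\<omega>\<close> in the right half-plane and split all integrals at
  some \<open>R\<close> between \<open>\<bar>w\<bar>\<close> and \<open>min a \<rho>\<^sub>0\<close>. If moments \<open>a\<^sub>s = b\<^sub>s + w\<^sup>2 b\<^sub>s\<^sub>+\<^sub>1\<close> satisfy \<open>b\<^sub>s = O(R\<^bsup>-2s\<^esup>)\<close>, then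
  \<open>\<Sum>(-1)\<^sup>s w\<^bsup>2s\<^esup> a\<^sub>s\<close> telescopes to \<open>b\<^sub>0\<close>. On \<open>[R, a)\<close> this applies to the whole integrand, by the
  second mean value theorem. On \<open>[0, R]\<close> write \<open>k(t) = A + B t + (w\<^sup>2 + t\<^sup>2) h(t)\<close> with \<open>h\<close> holomorphic; the
  part with \<open>h\<close> telescopes, so that the terms \<open>\<Delta>\<^sub>1\<close> and \<open>\<Delta>\<^sub>2\<close> come from \<open>k = 1\<close> and \<open>k = t\<close> alone. For
  these, the integrals of \<open>ln\<^sup>n t / (w\<^sup>2 + t\<^sup>2)\<close> over the half-line have the generating function
  \<open>\<integral> t\<^sup>x / (w\<^sup>2 + t\<^sup>2) dt = w\<^bsup>x-1\<^esup> (\<pi>/2) / cos (\<pi>x/2)\<close>, whose Taylor coefficients are Euler numbers; the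
  case \<open>k = t\<close> is the same formula shifted by one in \<open>x\<close>, with Bernoulli numbers.\<close>

subsection \<open>Uniqueness and linearity of finite parts\<close>

text \<open>Expanding 1/(w^2 + t^2) in powers of w^2/t^2 under the integral is illegitimate for t <
  |w|; what is lost there comes from the zeros \<plusminus>iw of the denominator, hence the values
  k(\<plusminus>iw). The series is therefore never integrated term by term: t^(-2s-2) = (t^(-2s) +
  w^2 t^(-2s-2)) / (w^2 + t^2) writes every moment as two weighted copies of the Stieltjes
  integrand, and only the size of such weighted integrals matters. As the integral may converge only
  conditionally at a, this size cannot be estimated by absolute values. Cutting at R is possible
  because finite parts are unique and linear. For k = 1 and k = t all pieces are explicit: with F
  the primitive of ln^n t / t^p without constant term, the finite part over [0, R] is F(R), and for
  p \<ge> 2 the integral over [R, \<infinity>) is -F(R). So the finite-part series is minus a tail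
  integral over the half-line; the one exception is p = 1, where F(R) = ln^(n+1) R / (n+1).\<close>

lemma poly_tendsto_imp_const:
  fixes p :: "complex poly"
  assumes "((\<lambda>x::real. poly p (of_real x)) \<longlongrightarrow> L) at_top"
  shows "p = [:L:]"
proof (cases "degree p = 0")
  case True
  then obtain a where p: "p = [:a:]" by (metis degree_eq_zeroE)
  with assms have "((\<lambda>x::real. a) \<longlongrightarrow> L) at_top" by simp
  then have "a = L" by (simp add: tendsto_const_iff)
  with p show ?thesis by simp
next
  case False
  have "filterlim (\<lambda>x::real. complex_of_real x) at_infinity at_top"
    using tendsto_of_real_iff by (simp add: filterlim_at_infinity_conv_norm_at_top filterlim_abs_real)
  then have "filterlim (\<lambda>x::real. poly p (of_real x)) at_infinity at_top"
    using filterlim_compose[OF filterlim_poly_at_infinity, of p] False by auto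
  with assms show ?thesis
    using not_tendsto_and_filterlim_at_infinity trivial_limit_at_top_linorder by blast
qed

lemma exp_mult_neq_1:
  fixes \<mu> :: complex
  assumes "\<mu> \<noteq> 0"
  obtains h :: real where "exp (\<mu> * of_real h) \<noteq> 1"
proof
  \<comment> \<open>With this h the exponent has modulus 1, whereas a nonzero period of
    \<open>exp\<close> has modulus at least 2 pi.\<close>
  show "exp (\<mu> * of_real (1 / norm \<mu>)) \<noteq> 1"
  proof
    assume "exp (\<mu> * of_real (1 / norm \<mu>)) = 1"
    then obtain n :: int where n: "Re (\<mu> * of_real (1 / norm \<mu>)) = 0"
        "Im (\<mu> * of_real (1 / norm \<mu>)) = of_int (2 * n) * pi"
      by (auto simp: exp_eq_1)
    have "norm (\<mu> * of_real (1 / norm \<mu>)) = 1" using assms by (simp add: norm_mult norm_divide)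
    then have "\<bar>of_int (2 * n) * pi\<bar> = 1" by (simp only: cmod_eq_Im[OF n(1)] n(2))
    then have "2 * pi * \<bar>of_int n\<bar> = 1" by (simp add: abs_mult mult_ac)
    moreover have "2 * pi * \<bar>of_int n\<bar> \<ge> 2 * pi" if "n \<noteq> 0"
      using that by simp
    ultimately show False using pi_gt3 by (cases "n = 0") auto
  qed
qed

text \<open>A translation keeps the leading coefficient, so it cancels in the difference. A constant
  has no smaller degree to drop to and gives 0.\<close>

lemma degree_pcompose_shift_diff:
  fixes q :: "complex poly"
  shows "q \<circ>\<^sub>p [:h, 1:] - q = 0 \<or> degree (q \<circ>\<^sub>p [:h, 1:] - q) < degree q"
proof (cases "degree q = 0")
  case True
  then obtain a where "q = [:a:]" by (metis degree_eq_zeroE)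
  then show ?thesis by (simp add: pcompose_pCons)
next
  case False
  let ?r = "q \<circ>\<^sub>p [:h, 1:] - q"
  have d: "degree (q \<circ>\<^sub>p [:h, 1:]) = degree q" by (simp add: degree_pcompose)
  have "lead_coeff (q \<circ>\<^sub>p [:h, 1:]) = lead_coeff q" by (subst lead_coeff_comp) auto
  then have "coeff ?r (degree q) = 0" using d by simp
  moreover have "degree ?r \<le> degree q" by (rule degree_diff_le) (simp_all add: d)
  ultimately have "degree ?r < degree q"
    using False by (metis leading_coeff_0_iff degree_0 le_neq_implies_less not_gr_zero)
  then show ?thesis ..
qed

text \<open>The operator \<open>f \<mapsto> (f(x + h) - c f(x)) / (1 - c)\<close> with \<open>c = exp (\<mu> h)\<close> preserves limits and
  the leading term of \<open>p\<close>, and lowers the degree of the coefficient of \<open>exp (\<mu> x)\<close>.\<close>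

lemma exp_polynomial_tendsto_imp:
  fixes p :: "complex poly" and q :: "complex \<Rightarrow> complex poly"
  assumes "finite M" "0 \<notin> M"
    and "((\<lambda>x::real. poly p (of_real x) + (\<Sum>\<mu>\<in>M. poly (q \<mu>) (of_real x) * exp (\<mu> * of_real x))) \<longlongrightarrow> L) at_top"
  shows "p = [:L:]"
  using assms
proof (induction M arbitrary: p q rule: finite_induct)
  case empty
  then show ?case by (simp add: poly_tendsto_imp_const)
next
  case (insert \<mu> M)
  have M: "finite M" "\<mu> \<notin> M" and M0: "0 \<notin> M" "\<mu> \<noteq> 0" using insert by auto
  define F where "F p q x = poly p (of_real x) + (\<Sum>\<nu>\<in>insert \<mu> M. poly (q \<nu>) (of_real x) * exp (\<nu> * of_real x))"
    for p :: "complex poly" and q :: "complex \<Rightarrow> complex poly" and x :: real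
  obtain h where h: "exp (\<mu> * of_real h) \<noteq> 1" using exp_mult_neq_1[OF M0(2)] .
  define c where "c = exp (\<mu> * of_real h)"
  have c: "1 - c \<noteq> 0" using h by (simp add: c_def)
  \<comment> \<open>Inner induction on a strict bound for the degree of \<open>q \<mu>\<close>. At
    bound 0 the polynomial vanishes, so \<mu> disappears and the outer hypothesis for
    \<open>M\<close> applies.\<close>
  have "\<forall>p q. (q \<mu> = 0 \<or> degree (q \<mu>) < n) \<longrightarrow> (F p q \<longlongrightarrow> L) at_top \<longrightarrow> p = [:L:]" for n
  proof (induction n)
    case 0
    show ?case
    proof (intro allI impI)
      fix p q assume "q \<mu> = 0 \<or> degree (q \<mu>) < 0" and *: "(F p q \<longlongrightarrow> L) at_top"
      then have q0: "q \<mu> = 0" by simp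
      have "F p q = (\<lambda>x. poly p (of_real x) + (\<Sum>\<nu>\<in>M. poly (q \<nu>) (of_real x) * exp (\<nu> * of_real x)))"
        unfolding F_def using M q0 by (auto simp: fun_eq_iff)
      with * show "p = [:L:]" using insert.IH[OF M0(1), of p q] by simp
    qed
  next
    case (Suc n)
    show ?case
    proof (intro allI impI)
      fix p q assume deg: "q \<mu> = 0 \<or> degree (q \<mu>) < Suc n" and lim: "(F p q \<longlongrightarrow> L) at_top"
      define p' where "p' = smult (1 / (1 - c)) (p \<circ>\<^sub>p [:of_real h, 1:] - smult c p)"
      define q' where "q' \<nu> = smult (1 / (1 - c)) (smult (exp (\<nu> * of_real h)) (q \<nu> \<circ>\<^sub>p [:of_real h, 1:]) - smult c (q \<nu>))" for \<nu>
      have F': "F p' q' x = (F p q (x + h) - c * F p q x) / (1 - c)" for x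
      proof -
        have P: "poly p' (of_real x) = (poly p (of_real (x + h)) - c * poly p (of_real x)) / (1 - c)"
          by (simp add: p'_def poly_pcompose add.commute divide_inverse mult.commute)
        have Q: "poly (q' \<nu>) (of_real x) * exp (\<nu> * of_real x) =
            (poly (q \<nu>) (of_real (x + h)) * exp (\<nu> * of_real (x + h)) - c * (poly (q \<nu>) (of_real x) * exp (\<nu> * of_real x))) / (1 - c)" for \<nu>
        proof -
          have 1: "poly (q' \<nu>) (of_real x) = (exp (\<nu> * of_real h) * poly (q \<nu>) (of_real (x + h)) - c * poly (q \<nu>) (of_real x)) / (1 - c)"
            by (simp add: q'_def poly_pcompose add.commute divide_inverse mult.commute)
          have 2: "exp (\<nu> * of_real (x + h)) = exp (\<nu> * of_real h) * exp (\<nu> * of_real x)"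
            by (simp add: distrib_left exp_add mult.commute)
          show ?thesis unfolding 1 2 by (simp add: algebra_simps)
        qed
        show ?thesis
          unfolding F_def P Q sum_divide_distrib[symmetric] sum_subtractf sum_distrib_left[symmetric]
            add_divide_distrib[symmetric] distrib_left
          by (rule arg_cong2[where f = "(/)"]) simp_all
      qed
      have "((\<lambda>x. F p q (x + h)) \<longlongrightarrow> L) at_top"
        by (rule filterlim_compose[OF lim]) real_asymp
      then have "((\<lambda>x. (F p q (x + h) - c * F p q x) / (1 - c)) \<longlongrightarrow> (L - c * L) / (1 - c)) at_top"
        by (intro tendsto_intros lim c)
      moreover have "(L - c * L) / (1 - c) = L" using c by (simp add: field_simps)
      ultimately have lim': "(F p' q' \<longlongrightarrow> L) at_top" by (simp add: F'[abs_def])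
      have "q' \<mu> = smult (c / (1 - c)) (q \<mu> \<circ>\<^sub>p [:of_real h, 1:] - q \<mu>)"
        by (simp add: q'_def c_def smult_diff_right)
      then have "q' \<mu> = 0 \<or> degree (q' \<mu>) < n"
        using degree_pcompose_shift_diff[of "q \<mu>" "of_real h"] deg by auto
      with Suc.IH lim' have p': "p' = [:L:]" by blast
      have d: "degree (p \<circ>\<^sub>p [:of_real h, 1:]) = degree p" by (simp add: degree_pcompose)
      have lc: "lead_coeff (p \<circ>\<^sub>p [:of_real h, 1:]) = lead_coeff p" by (subst lead_coeff_comp) auto
      have "coeff p' (degree p) = (lead_coeff p - c * lead_coeff p) / (1 - c)"
        using lc d by (simp add: p'_def)
      also have "\<dots> = lead_coeff p" using c by (simp add: field_simps)
      finally have eq: "coeff [:L:] (degree p) = lead_coeff p" by (simp add: p')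
      \<comment> \<open>\<open>p'\<close> is the constant \<open>L\<close>, yet its coefficient at
        \<open>degree p\<close> is the leading coefficient of \<open>p\<close>; a positive degree
        would make that coefficient 0.\<close>
      have "degree p = 0"
      proof (rule ccontr)
        assume "degree p \<noteq> 0"
        then have "coeff [:L:] (degree p) = 0" by (simp add: coeff_pCons split: nat.splits)
        with eq have "p = 0" by (metis leading_coeff_0_iff)
        with \<open>degree p \<noteq> 0\<close> show False by simp
      qed
      with eq show "p = [:L:]" by (metis coeff_pCons_0 degree_eq_zeroE)
    qed
  qed
  from this[of "Suc (degree (q \<mu>))"] insert.prems(2) show ?case
    unfolding F_def by blast
qed

lemma powr_neg_exp_neg: "complex_of_real (exp (- x)) powr (- \<mu>) = exp (\<mu> * of_real x)"
  by (simp add: powr_def flip: exp_of_real)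

text \<open>With \<epsilon> = exp(-x) the terms become polynomials times exponentials in x. Growth
  alone does not decide the matter, since an imaginary \<mu> gives bounded oscillations; the
  difference operator above handles these too. The limit is then the constant coefficient belonging
  to \<mu> = 0, which is missing because (0, 0) is excluded.\<close>

lemma diverging_terms_tendsto_imp_zero:
  assumes "diverging_terms D" and lim: "(D \<longlongrightarrow> L) (at_right 0)"
  shows "L = 0"
proof -
  obtain P c where P: "finite P" "\<And>\<mu> m. (\<mu>, m) \<in> P \<Longrightarrow> (\<mu>, m) \<noteq> (0, 0)"
    and D: "D = (\<lambda>\<epsilon>. \<Sum>(\<mu>, m) \<in> P.
               c (\<mu>, m) * complex_of_real \<epsilon> powr (- \<mu>) * complex_of_real (ln \<epsilon>) ^ (m::nat))"
    using assms unfolding diverging_terms_def by blast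
  define q where "q \<mu> = (\<Sum>m\<in>{m. (\<mu>, m) \<in> P}. monom (c (\<mu>, m) * (-1) ^ m) m)" for \<mu>
  have fin: "finite {m. (\<mu>, m) \<in> P}" for \<mu>
    by (rule finite_subset[of _ "snd ` P"]) (use P in \<open>force+\<close>)
  \<comment> \<open>The terms are grouped by \<mu>. Inserting 0 lets the group at 0 be split off
    even when no term has exponent 0.\<close>
  have D': "D (exp (- x)) = (\<Sum>\<mu>\<in>insert 0 (fst ` P). poly (q \<mu>) (of_real x) * exp (\<mu> * of_real x))" for x
  proof -
    have "D (exp (- x)) = (\<Sum>(\<mu>, m)\<in>P. c (\<mu>, m) * exp (\<mu> * of_real x) * (- of_real x) ^ m)"
      unfolding D by (intro sum.cong) (auto simp: powr_neg_exp_neg)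
    also have "P = Sigma (insert 0 (fst ` P)) (\<lambda>\<mu>. {m. (\<mu>, m) \<in> P})" by force
    also have "(\<Sum>(\<mu>, m)\<in>\<dots>. c (\<mu>, m) * exp (\<mu> * of_real x) * (- of_real x) ^ m) =
        (\<Sum>\<mu>\<in>insert 0 (fst ` P). \<Sum>m\<in>{m. (\<mu>, m) \<in> P}. c (\<mu>, m) * exp (\<mu> * of_real x) * (- of_real x) ^ m)"
      by (rule sum.Sigma[symmetric]) (use P fin in auto)
    also have "\<dots> = (\<Sum>\<mu>\<in>insert 0 (fst ` P). poly (q \<mu>) (of_real x) * exp (\<mu> * of_real x))"
      unfolding q_def poly_sum sum_distrib_right poly_monom
      by (intro sum.cong refl) (subst power_minus, simp add: mult_ac)
    finally show ?thesis .
  qed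
  have "((\<lambda>x. D (exp (- x))) \<longlongrightarrow> L) at_top"
  proof (rule filterlim_compose[OF lim])
    show "filterlim (\<lambda>x::real. exp (- x)) (at_right 0) at_top" by real_asymp
  qed
  also have "(\<lambda>x. D (exp (- x))) = (\<lambda>x::real. poly (q 0) (of_real x) +
      (\<Sum>\<mu>\<in>fst ` P - {0}. poly (q \<mu>) (of_real x) * exp (\<mu> * of_real x)))"
    unfolding D' by (subst sum.insert_remove) (use P in auto)
  finally have "q 0 = [:L:]"
    by (intro exp_polynomial_tendsto_imp[of "fst ` P - {0}" "q 0" q]) (use P in auto)
  then have "coeff (q 0) 0 = L" by simp
  moreover have "coeff (q 0) 0 = 0"
    unfolding q_def coeff_sum by (intro sum.neutral) (use P in auto)
  ultimately show ?thesis by simp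
qed

section \<open>The vector space of diverging terms\<close>

lemma diverging_terms_add:
  assumes "diverging_terms D" "diverging_terms E"
  shows "diverging_terms (\<lambda>\<epsilon>. D \<epsilon> + E \<epsilon>)"
proof -
  obtain P c where P: "finite P" "\<forall>(\<mu>, m)\<in>P. Re \<mu> \<ge> 0 \<and> (\<mu>, m) \<noteq> (0, 0)"
    and D: "D = (\<lambda>\<epsilon>. \<Sum>(\<mu>, m) \<in> P.
               c (\<mu>, m) * complex_of_real \<epsilon> powr (- \<mu>) * complex_of_real (ln \<epsilon>) ^ (m::nat))"
    using assms unfolding diverging_terms_def by blast
  obtain Q d where Q: "finite Q" "\<forall>(\<mu>, m)\<in>Q. Re \<mu> \<ge> 0 \<and> (\<mu>, m) \<noteq> (0, 0)"
    and E: "E = (\<lambda>\<epsilon>. \<Sum>(\<mu>, m) \<in> Q.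
               d (\<mu>, m) * complex_of_real \<epsilon> powr (- \<mu>) * complex_of_real (ln \<epsilon>) ^ (m::nat))"
    using assms unfolding diverging_terms_def by blast
  \<comment> \<open>The values of \<open>c\<close> outside \<open>P\<close> and of \<open>d\<close>
    outside \<open>Q\<close> are arbitrary and have to be cut off before adding.\<close>
  define e where "e x = (if x \<in> P then c x else 0) + (if x \<in> Q then d x else 0)" for x
  have "(\<lambda>\<epsilon>. D \<epsilon> + E \<epsilon>) = (\<lambda>\<epsilon>. \<Sum>(\<mu>, m) \<in> P \<union> Q.
               e (\<mu>, m) * complex_of_real \<epsilon> powr (- \<mu>) * complex_of_real (ln \<epsilon>) ^ m)"
  proof
    fix \<epsilon>
    have "D \<epsilon> = (\<Sum>(\<mu>, m) \<in> P \<union> Q.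
               (if (\<mu>, m) \<in> P then c (\<mu>, m) else 0) * complex_of_real \<epsilon> powr (- \<mu>) * complex_of_real (ln \<epsilon>) ^ m)"
      unfolding D by (rule sum.mono_neutral_cong_left) (use P Q in auto)
    moreover have "E \<epsilon> = (\<Sum>(\<mu>, m) \<in> P \<union> Q.
               (if (\<mu>, m) \<in> Q then d (\<mu>, m) else 0) * complex_of_real \<epsilon> powr (- \<mu>) * complex_of_real (ln \<epsilon>) ^ m)"
      unfolding E by (rule sum.mono_neutral_cong_left) (use P Q in auto)
    ultimately show "D \<epsilon> + E \<epsilon> = (\<Sum>(\<mu>, m) \<in> P \<union> Q.
               e (\<mu>, m) * complex_of_real \<epsilon> powr (- \<mu>) * complex_of_real (ln \<epsilon>) ^ m)"
      by (simp add: e_def sum.distrib[symmetric] case_prod_unfold ring_distribs)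
  qed
  with P Q show ?thesis
    unfolding diverging_terms_def by (intro exI[of _ "P \<union> Q"] exI[of _ e]) auto
qed

lemma diverging_terms_cmult:
  assumes "diverging_terms D"
  shows "diverging_terms (\<lambda>\<epsilon>. b * D \<epsilon>)"
proof -
  obtain P c where "finite P" "\<forall>(\<mu>, m)\<in>P. Re \<mu> \<ge> 0 \<and> (\<mu>, m) \<noteq> (0, 0)"
    and D: "D = (\<lambda>\<epsilon>. \<Sum>(\<mu>, m) \<in> P.
               c (\<mu>, m) * complex_of_real \<epsilon> powr (- \<mu>) * complex_of_real (ln \<epsilon>) ^ (m::nat))"
    using assms unfolding diverging_terms_def by blast
  then show ?thesis
    unfolding diverging_terms_def
    by (intro exI[of _ P] exI[of _ "\<lambda>x. b * c x"]) (auto simp: sum_distrib_left case_prod_unfold mult_ac)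
qed

lemma diverging_terms_0: "diverging_terms (\<lambda>_. 0)"
  unfolding diverging_terms_def by (intro exI[of _ "{}"]) auto

lemma diverging_terms_basic:
  assumes "Re \<mu> \<ge> 0" "(\<mu>, m) \<noteq> (0, 0)"
  shows "diverging_terms (\<lambda>\<epsilon>. complex_of_real \<epsilon> powr (- \<mu>) * complex_of_real (ln \<epsilon>) ^ m)"
  unfolding diverging_terms_def using assms
  by (intro exI[of _ "{(\<mu>, m)}"] exI[of _ "\<lambda>_. 1"]) auto

text \<open>Two decompositions of the same integral satisfy C - C' = D' - D. The left side tends to
  I - J and the right side is again a combination of diverging terms, so I - J = 0.\<close>

lemma has_fp_integral_unique:
  assumes "has_fp_integral f a I" "has_fp_integral f a J" "0 < a"
  shows "I = J"
proof -
  obtain C D where 1: "\<And>\<epsilon>. 0 < \<epsilon> \<and> ereal \<epsilon> < a \<Longrightarrow> (f has_integral (C \<epsilon> + D \<epsilon>)) (upto_ereal \<epsilon> a)"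
    "diverging_terms D" "(C \<longlongrightarrow> I) (at_right 0)"
    using assms(1) unfolding has_fp_integral_def by blast
  obtain C' D' where 2: "\<And>\<epsilon>. 0 < \<epsilon> \<and> ereal \<epsilon> < a \<Longrightarrow> (f has_integral (C' \<epsilon> + D' \<epsilon>)) (upto_ereal \<epsilon> a)"
    "diverging_terms D'" "(C' \<longlongrightarrow> J) (at_right 0)"
    using assms(2) unfolding has_fp_integral_def by blast
  obtain b where b: "b > 0" "ereal b < a"
    using ereal_dense2[OF \<open>0 < a\<close>] by (metis zero_ereal_def ereal_less(2))
  have ev: "eventually (\<lambda>\<epsilon>. D' \<epsilon> + (-1) * D \<epsilon> = C \<epsilon> - C' \<epsilon>) (at_right 0)"
    using eventually_at_right_real[OF b(1)]
  proof eventually_elim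
    case (elim \<epsilon>)
    then have "0 < \<epsilon>" "ereal \<epsilon> < ereal b" by auto
    then have "0 < \<epsilon> \<and> ereal \<epsilon> < a" using b(2) less_trans by blast
    from has_integral_unique[OF 1(1)[OF this] 2(1)[OF this]]
    show ?case by (simp add: algebra_simps)
  qed
  have "((\<lambda>\<epsilon>. C \<epsilon> - C' \<epsilon>) \<longlongrightarrow> I - J) (at_right 0)" by (intro tendsto_intros 1 2)
  then have "((\<lambda>\<epsilon>. D' \<epsilon> + (-1) * D \<epsilon>) \<longlongrightarrow> I - J) (at_right 0)"
    using tendsto_cong[OF ev] by simp
  then have "I - J = 0"
    by (rule diverging_terms_tendsto_imp_zero[rotated]) (intro diverging_terms_add diverging_terms_cmult 1 2)
  then show ?thesis by simp
qed

lemma fp_integral_eqI: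
  assumes "has_fp_integral f a I" "0 < a"
  shows "fp_integral f a = I"
  unfolding fp_integral_def using assms has_fp_integral_unique by blast

section \<open>Linearity and locality of finite parts\<close>

lemma has_fp_integral_add:
  assumes "has_fp_integral f a I" "has_fp_integral g a J"
  shows "has_fp_integral (\<lambda>t. f t + g t) a (I + J)"
proof -
  obtain C D where 1: "\<And>\<epsilon>. 0 < \<epsilon> \<and> ereal \<epsilon> < a \<Longrightarrow> (f has_integral (C \<epsilon> + D \<epsilon>)) (upto_ereal \<epsilon> a)"
    "diverging_terms D" "(C \<longlongrightarrow> I) (at_right 0)"
    using assms(1) unfolding has_fp_integral_def by blast
  obtain C' D' where 2: "\<And>\<epsilon>. 0 < \<epsilon> \<and> ereal \<epsilon> < a \<Longrightarrow> (g has_integral (C' \<epsilon> + D' \<epsilon>)) (upto_ereal \<epsilon> a)"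
    "diverging_terms D'" "(C' \<longlongrightarrow> J) (at_right 0)"
    using assms(2) unfolding has_fp_integral_def by blast
  have "((\<lambda>t. f t + g t) has_integral ((C \<epsilon> + C' \<epsilon>) + (D \<epsilon> + D' \<epsilon>))) (upto_ereal \<epsilon> a)"
    if "0 < \<epsilon> \<and> ereal \<epsilon> < a" for \<epsilon>
    using has_integral_add[OF 1(1) 2(1), OF that that] by (simp add: algebra_simps)
  with 1 2 show ?thesis
    unfolding has_fp_integral_def
    by (intro exI[of _ "\<lambda>\<epsilon>. C \<epsilon> + C' \<epsilon>"] exI[of _ "\<lambda>\<epsilon>. D \<epsilon> + D' \<epsilon>"])
      (auto intro: diverging_terms_add tendsto_add)
qed

lemma has_fp_integral_cmult:
  assumes "has_fp_integral f a I"
  shows "has_fp_integral (\<lambda>t. b * f t) a (b * I)"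
proof -
  obtain C D where 1: "\<And>\<epsilon>. 0 < \<epsilon> \<and> ereal \<epsilon> < a \<Longrightarrow> (f has_integral (C \<epsilon> + D \<epsilon>)) (upto_ereal \<epsilon> a)"
    "diverging_terms D" "(C \<longlongrightarrow> I) (at_right 0)"
    using assms(1) unfolding has_fp_integral_def by blast
  have "((\<lambda>t. b * f t) has_integral (b * C \<epsilon> + b * D \<epsilon>)) (upto_ereal \<epsilon> a)"
    if "0 < \<epsilon> \<and> ereal \<epsilon> < a" for \<epsilon>
    using has_integral_mult_right[OF 1(1), OF that, of b] by (simp add: algebra_simps)
  with 1 show ?thesis
    unfolding has_fp_integral_def
    by (intro exI[of _ "\<lambda>\<epsilon>. b * C \<epsilon>"] exI[of _ "\<lambda>\<epsilon>. b * D \<epsilon>"])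
      (auto intro!: diverging_terms_cmult tendsto_mult)
qed

lemma has_fp_integral_cong:
  assumes "\<And>t. 0 < t \<Longrightarrow> ereal t < a \<Longrightarrow> f t = g t"
  shows "has_fp_integral f a I \<longleftrightarrow> has_fp_integral g a I"
proof -
  have "(f has_integral J) (upto_ereal \<epsilon> a) \<longleftrightarrow> (g has_integral J) (upto_ereal \<epsilon> a)" if "\<epsilon> > 0" for \<epsilon> J
    by (rule has_integral_cong) (use assms that in \<open>auto simp: upto_ereal_def\<close>)
  then show ?thesis unfolding has_fp_integral_def by meson
qed

lemma has_fp_integral_zero: "has_fp_integral (\<lambda>_. 0) a 0"
  unfolding has_fp_integral_def
  by (intro exI[of _ "\<lambda>_. 0"]) (auto intro: diverging_terms_0)

lemma has_fp_integral_sum: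
  assumes "finite A" "\<And>i. i \<in> A \<Longrightarrow> has_fp_integral (f i) a (I i)"
  shows "has_fp_integral (\<lambda>t. \<Sum>i\<in>A. f i t) a (\<Sum>i\<in>A. I i)"
  using assms by (induction rule: finite_induct) (auto intro: has_fp_integral_zero has_fp_integral_add)

subsection \<open>Monotone weights in Henstock-Kurzweil integrals\<close>

text \<open>The weighted integral equals g(u) times one integral of f plus g(v) times another, both
  bounded by \<open>B\<close>; this is the factor 2. No bound on the integral of |f| enters.\<close>

lemma second_mean_value_bound:
  fixes f g :: "real \<Rightarrow> real"
  assumes f: "f integrable_on {u..v}" and uv: "u \<le> v"
    and g: "\<And>x y. \<lbrakk>u \<le> x; x \<le> y; y \<le> v\<rbrakk> \<Longrightarrow> g y \<le> g x" and g0: "g v \<ge> 0"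
    and B: "\<And>c d. u \<le> c \<Longrightarrow> c \<le> d \<Longrightarrow> d \<le> v \<Longrightarrow> \<bar>integral {c..d} f\<bar> \<le> B"
  shows "(\<lambda>x. g x * f x) integrable_on {u..v}"
    and "\<bar>integral {u..v} (\<lambda>x. g x * f x)\<bar> \<le> 2 * B * g u"
proof -
  \<comment> \<open>The mean value theorem is stated for increasing weights, so it is applied to
    -g.\<close>
  obtain c where c: "c \<in> {u..v}" and
    I: "((\<lambda>x. - g x * f x) has_integral (- g u * integral {u..c} f + - g v * integral {c..v} f)) {u..v}"
    using second_mean_value_theorem_full[OF f uv, of "\<lambda>x. - g x"] g by auto
  then have I': "((\<lambda>x. g x * f x) has_integral (g u * integral {u..c} f + g v * integral {c..v} f)) {u..v}"
    using has_integral_neg[OF I] by (simp add: add.commute)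
  then show "(\<lambda>x. g x * f x) integrable_on {u..v}" by blast
  have gu: "g v \<le> g u" using g uv by simp
  have B0: "B \<ge> 0" using B[of u u] uv by simp
  have "\<bar>g u * integral {u..c} f + g v * integral {c..v} f\<bar> \<le> g u * B + g v * B"
    using B[of u c] B[of c v] c g0 gu
    by (intro order_trans[OF abs_triangle_ineq] add_mono) (auto simp: abs_mult intro!: mult_mono)
  also have "\<dots> \<le> g u * B + g u * B" using B0 gu by (intro add_mono mult_right_mono) auto
  finally show "\<bar>integral {u..v} (\<lambda>x. g x * f x)\<bar> \<le> 2 * B * g u"
    using integral_unique[OF I'] by simp
qed

text \<open>For large d the integral over [R, d] is within 1 of the full one, by the definition of
  integrability on an unbounded set; on the remaining compact range of d it is continuous. Integrals
  over [c, d] are differences of two such values.\<close>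

lemma bounded_integrals_of_integrable:
  fixes f :: "real \<Rightarrow> real"
  assumes f: "f integrable_on {R..}"
  obtains B where "\<And>c d. R \<le> c \<Longrightarrow> c \<le> d \<Longrightarrow> \<bar>integral {c..d} f\<bar> \<le> B"
proof -
  have int: "f integrable_on {c..d}" if "R \<le> c" for c d
    using integrable_on_subinterval[OF f, of c d] that by auto
  have *: "(\<lambda>x. if x \<in> {R..} then f x else 0) = (\<lambda>x. if R \<le> x then f x else 0)" by auto
  obtain M where M: "M > 0" "\<And>a b. ball 0 M \<subseteq> cbox a b \<Longrightarrow>
      norm (integral (cbox a b) (\<lambda>x. if x \<in> {R..} then f x else 0) - integral {R..} f) < 1"
    using integrable_integral[OF f] unfolding has_integral_alt'[of f]
    by (meson zero_less_one)
  define N where "N = max M \<bar>R\<bar>"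
  have N: "\<bar>integral {R..d} f\<bar> \<le> \<bar>integral {R..} f\<bar> + 1" if "d \<ge> N" for d
  proof -
    have "ball 0 M \<subseteq> cbox (- N) d" using that M(1) by (auto simp: N_def dist_norm)
    from M(2)[OF this] have "\<bar>integral {-N..d} (\<lambda>x. if R \<le> x then f x else 0) - integral {R..} f\<bar> < 1"
      by (simp add: *)
    also have "integral {-N..d} (\<lambda>x. if R \<le> x then f x else 0) = integral {R..d} f"
    proof -
      have "integral {-N..d} (\<lambda>x. if x \<in> {R..} then f x else 0) = integral ({R..} \<inter> {-N..d}) f"
        by (rule integral_restrict_Int)
      also have "{R..} \<inter> {-N..d} = {R..d}" by (auto simp: N_def)
      finally show ?thesis by simp
    qed
    finally show ?thesis by linarith
  qed
  have "continuous_on {R..N} (\<lambda>d. integral {R..d} f)"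
    using indefinite_integral_continuous_1[OF int] by simp
  then have "bounded ((\<lambda>d. integral {R..d} f) ` {R..N})"
    by (intro compact_imp_bounded compact_continuous_image) auto
  then obtain C where C: "\<And>d. d \<in> {R..N} \<Longrightarrow> \<bar>integral {R..d} f\<bar> \<le> C"
    unfolding bounded_iff by (metis imageI real_norm_def)
  define B where "B = max C (\<bar>integral {R..} f\<bar> + 1)"
  have B: "\<bar>integral {R..d} f\<bar> \<le> B" if "d \<ge> R" for d
    using C[of d] N[of d] that unfolding B_def by (cases "d \<le> N") auto
  show thesis
  proof
    fix c d assume "R \<le> c" "c \<le> d"
    then have "integral {R..c} f + integral {c..d} f = integral {R..d} f"
      by (intro Henstock_Kurzweil_Integration.integral_combine int) auto
    with B[of c] B[of d] \<open>R \<le> c\<close> \<open>c \<le> d\<close> show "\<bar>integral {c..d} f\<bar> \<le> 2 * B" by auto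
  qed
qed

text \<open>Dirichlet's test: a piece beginning at b contributes at most 2 B g(b), which tends to 0
  and so gives the Cauchy criterion. The same estimate from R on passes to the limit.\<close>

lemma monotone_weight_at_top:
  fixes f g :: "real \<Rightarrow> real"
  assumes f: "f integrable_on {R..}"
    and B: "\<And>c d. R \<le> c \<Longrightarrow> c \<le> d \<Longrightarrow> \<bar>integral {c..d} f\<bar> \<le> B"
    and g: "\<And>x y. R \<le> x \<Longrightarrow> x \<le> y \<Longrightarrow> g y \<le> g x"
    and lim: "(g \<longlongrightarrow> 0) at_top"
  shows "(\<lambda>x. g x * f x) integrable_on {R..}"
    and "\<bar>integral {R..} (\<lambda>x. g x * f x)\<bar> \<le> 2 * B * g R"
proof -
  have g0: "g x \<ge> 0" if "x \<ge> R" for x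
    by (rule tendsto_upperbound[OF lim]) (use g[OF that] in \<open>auto intro: eventually_at_top_linorderI\<close>)
  have B0: "B \<ge> 0" using B[of R R] by simp
  have intf: "f integrable_on {c..d}" if "R \<le> c" for c d
    using integrable_on_subinterval[OF f, of c d] that by auto
  let ?h = "\<lambda>x. g x * f x"
  let ?H = "\<lambda>x. if x \<in> {R..} then ?h x else 0"
  have int: "?h integrable_on {c..d}" and bd: "\<bar>integral {c..d} ?h\<bar> \<le> 2 * B * g c"
    if "R \<le> c" "c \<le> d" for c d
    using second_mean_value_bound[OF intf, of c d g B] that B g g0 by auto
  have res: "integral (cbox c d) ?H = integral {R..d} ?h" if "c \<le> R" for c d
  proof -
    have "integral {c..d} ?H = integral ({R..} \<inter> {c..d}) ?h" by (rule integral_restrict_Int)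
    also have "{R..} \<inter> {c..d} = {R..d}" using that by auto
    finally show ?thesis by simp
  qed
  have ball: "c \<le> - M / 2 \<and> M / 2 \<le> d" if "ball 0 M \<subseteq> cbox c d" "M > 0" for M c d :: real
  proof -
    have "- M / 2 \<in> ball 0 M" "M / 2 \<in> ball 0 M" using that by (auto simp: dist_norm)
    with that have "- M / 2 \<in> cbox c d" "M / 2 \<in> cbox c d" by blast+
    then show ?thesis by auto
  qed
  have ball': "c \<le> - M \<and> M \<le> d" if "ball 0 (2 * M) \<subseteq> cbox c d" "M > 0" for M c d :: real
    using ball[OF that(1)] that(2) by simp
  show integ: "?h integrable_on {R..}"
    unfolding integrable_alt_subset[of ?h]
  proof (intro conjI allI impI)
    fix c d :: real
    have "?H integrable_on {c..d} \<longleftrightarrow> ?h integrable_on {R..} \<inter> {c..d}"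
      by (rule integrable_restrict_Int)
    moreover have "{R..} \<inter> {c..d} = {max c R..d}" by auto
    moreover have "?h integrable_on {max c R..d}"
      by (cases "max c R \<le> d") (auto intro: int)
    ultimately show "?H integrable_on cbox c d" by (simp only: interval_cbox)
  next
    fix e :: real assume e: "e > 0"
    have "((\<lambda>x. 2 * B * g x) \<longlongrightarrow> 2 * B * 0) at_top" by (intro tendsto_intros lim)
    then have "eventually (\<lambda>x. 2 * B * g x < e) at_top" using e by (auto dest: order_tendstoD)
    then obtain N where N: "\<And>x. x \<ge> N \<Longrightarrow> 2 * B * g x < e" by (auto simp: eventually_at_top_linorder)
    define M where "M = max (max N \<bar>R\<bar>) 1"
    have M: "M > 0" "M \<ge> N" "M \<ge> \<bar>R\<bar>" by (auto simp: M_def)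
    show "\<exists>B>0. \<forall>a b c d. ball 0 B \<subseteq> cbox a b \<and> cbox a b \<subseteq> cbox c d \<longrightarrow>
        norm (integral (cbox a b) ?H - integral (cbox c d) ?H) < e"
    proof (intro exI[of _ "2 * M"] conjI allI impI)
      fix a b c d :: real
      assume *: "ball 0 (2 * M) \<subseteq> cbox a b \<and> cbox a b \<subseteq> cbox c d"
      then have **: "ball 0 (2 * M) \<subseteq> cbox c d" by blast
      have ab: "a \<le> R" "R \<le> b" "N \<le> b" "c \<le> R" "b \<le> d"
        using ball'[of M a b] ball'[OF **] * M by auto
      have "integral {R..b} ?h + integral {b..d} ?h = integral {R..d} ?h"
        using ab by (intro Henstock_Kurzweil_Integration.integral_combine int) auto
      then have "norm (integral (cbox a b) ?H - integral (cbox c d) ?H) = \<bar>integral {b..d} ?h\<bar>"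
        using res ab by simp
      also have "\<dots> \<le> 2 * B * g b" using ab by (intro bd) auto
      also have "\<dots> < e" using N ab by auto
      finally show "norm (integral (cbox a b) ?H - integral (cbox c d) ?H) < e" .
    qed (use M in auto)
  qed
  show "\<bar>integral {R..} ?h\<bar> \<le> 2 * B * g R"
  proof (rule field_le_epsilon)
    fix e :: real assume "e > 0"
    then obtain M where M: "M > 0" "\<And>a b. ball 0 M \<subseteq> cbox a b \<Longrightarrow>
        norm (integral (cbox a b) ?H - integral {R..} ?h) < e"
      using integrable_integral[OF integ] unfolding has_integral_alt'[of ?h] by meson
    define N where "N = max M \<bar>R\<bar>"
    have "ball 0 M \<subseteq> cbox (- N) N" using M(1) by (auto simp: N_def dist_norm)
    from M(2)[OF this] have "\<bar>integral {R..N} ?h - integral {R..} ?h\<bar> < e"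
      using res[of "-N" N] by (auto simp: N_def)
    moreover have "\<bar>integral {R..N} ?h\<bar> \<le> 2 * B * g R" by (rule bd) (auto simp: N_def)
    ultimately show "\<bar>integral {R..} ?h\<bar> \<le> 2 * B * g R + e" by linarith
  qed
qed

lemma upto_ereal_cases:
  assumes "ereal R < a"
  obtains b where "a = ereal b" "R < b" "upto_ereal R a = {R..<b}" | "a = \<infinity>" "upto_ereal R a = {R..}"
  using assms by (cases a) (auto simp: upto_ereal_def set_eq_iff)

text \<open>The constant is chosen before the weight. It thus serves all weights t^(-2s)
  simultaneously, and g(R) supplies the factor R^(-2s). For finite a the right endpoint is a null
  set, so a conditionally convergent integral over [R, a) is already one over a compact
  interval.\<close>

lemma decreasing_weight_real:
  fixes f :: "real \<Rightarrow> real"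
  assumes Ra: "ereal R < a" and f: "f integrable_on upto_ereal R a"
  shows "\<exists>C. \<forall>g. (\<forall>x y. R \<le> x \<longrightarrow> x \<le> y \<longrightarrow> g y \<le> g x) \<and> (g \<longlongrightarrow> 0) at_top \<longrightarrow>
    (\<lambda>x. g x * f x) integrable_on upto_ereal R a \<and>
    \<bar>integral (upto_ereal R a) (\<lambda>x. g x * f x)\<bar> \<le> C * g R"
  using Ra
proof (cases rule: upto_ereal_cases)
  case (1 b)
  have sd1: "negligible {x \<in> {R..b} - {R..<b}. P x}" for P
    by (auto intro: negligible_subset[of "{b}"])
  have sd2: "negligible {x \<in> {R..<b} - {R..b}. P x}" for P
    by (auto intro: negligible_subset[of "{b}"])
  have f': "f integrable_on {R..b}"
    using integrable_spike_set[OF f[unfolded 1(3)] sd2 sd1] .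
  have int: "f integrable_on {c..d}" if "R \<le> c" "d \<le> b" for c d
    using integrable_on_subinterval[OF f', of c d] that by auto
  have "continuous_on {R..b} (\<lambda>d. integral {R..d} f)"
    using indefinite_integral_continuous_1[OF f'] by simp
  then have "bounded ((\<lambda>d. integral {R..d} f) ` {R..b})"
    by (intro compact_imp_bounded compact_continuous_image) auto
  then obtain C where C: "\<And>d. d \<in> {R..b} \<Longrightarrow> \<bar>integral {R..d} f\<bar> \<le> C"
    unfolding bounded_iff by (metis imageI real_norm_def)
  have B: "\<bar>integral {c..d} f\<bar> \<le> 2 * C" if "R \<le> c" "c \<le> d" "d \<le> b" for c d
  proof -
    have "integral {R..c} f + integral {c..d} f = integral {R..d} f"
      using that by (intro Henstock_Kurzweil_Integration.integral_combine int) auto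
    with C[of c] C[of d] that show ?thesis by auto
  qed
  show ?thesis
  proof (intro exI allI impI)
    fix g :: "real \<Rightarrow> real"
    assume "(\<forall>x y. R \<le> x \<longrightarrow> x \<le> y \<longrightarrow> g y \<le> g x) \<and> (g \<longlongrightarrow> 0) at_top"
    then have g: "\<And>x y. R \<le> x \<Longrightarrow> x \<le> y \<Longrightarrow> g y \<le> g x" and lim: "(g \<longlongrightarrow> 0) at_top" by auto
    \<comment> \<open>The weight is decreasing beyond b as well and tends to 0 at infinity.\<close>
    have g0: "g b \<ge> 0"
      by (rule tendsto_upperbound[OF lim]) (use g \<open>R < b\<close> in \<open>auto intro!: eventually_at_top_linorderI[of b]\<close>)
    have "(\<lambda>x. g x * f x) integrable_on {R..b}" "\<bar>integral {R..b} (\<lambda>x. g x * f x)\<bar> \<le> 2 * (2 * C) * g R"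
      using second_mean_value_bound[OF f', of g "2 * C"] g g0 B \<open>R < b\<close> by auto
    moreover have "integral {R..b} (\<lambda>x. g x * f x) = integral {R..<b} (\<lambda>x. g x * f x)"
      by (rule integral_spike_set) (use sd1 sd2 in auto)
    moreover have "(\<lambda>x. g x * f x) integrable_on {R..<b}"
      using integrable_spike_set[OF calculation(1) sd1 sd2] .
    ultimately show "(\<lambda>x. g x * f x) integrable_on upto_ereal R a \<and>
        \<bar>integral (upto_ereal R a) (\<lambda>x. g x * f x)\<bar> \<le> 4 * C * g R"
      using 1(3) by simp
  qed
next
  case 2
  then have f': "f integrable_on {R..}" using f by simp
  obtain B where "\<And>c d. R \<le> c \<Longrightarrow> c \<le> d \<Longrightarrow> \<bar>integral {c..d} f\<bar> \<le> B"
    using bounded_integrals_of_integrable[OF f'] by blast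
  from monotone_weight_at_top[OF f' this] show ?thesis by (intro exI[of _ "2 * B"]) (auto simp: 2(2))
qed

text \<open>The mean value theorem is a real statement, so real and imaginary parts are treated
  separately.\<close>

lemma decreasing_weight:
  fixes f :: "real \<Rightarrow> complex"
  assumes Ra: "ereal R < a" and f: "f integrable_on upto_ereal R a"
  shows "\<exists>C. \<forall>g. (\<forall>x y. R \<le> x \<longrightarrow> x \<le> y \<longrightarrow> g y \<le> g x) \<and> (g \<longlongrightarrow> 0) at_top \<longrightarrow>
    (\<lambda>x. of_real (g x) * f x) integrable_on upto_ereal R a \<and>
    norm (integral (upto_ereal R a) (\<lambda>x. of_real (g x) * f x)) \<le> C * g R"
proof -
  have re: "(\<lambda>x. Re (f x)) integrable_on upto_ereal R a"
    using integrable_linear[OF f bounded_linear_Re] by (simp add: o_def)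
  have im: "(\<lambda>x. Im (f x)) integrable_on upto_ereal R a"
    using integrable_linear[OF f bounded_linear_Im] by (simp add: o_def)
  obtain C where C: "\<And>g. (\<forall>x y. R \<le> x \<longrightarrow> x \<le> y \<longrightarrow> g y \<le> g x) \<and> (g \<longlongrightarrow> 0) at_top \<longrightarrow>
      (\<lambda>x. g x * Re (f x)) integrable_on upto_ereal R a \<and>
      \<bar>integral (upto_ereal R a) (\<lambda>x. g x * Re (f x))\<bar> \<le> C * g R"
    using decreasing_weight_real[OF Ra re] by blast
  obtain D where D: "\<And>g. (\<forall>x y. R \<le> x \<longrightarrow> x \<le> y \<longrightarrow> g y \<le> g x) \<and> (g \<longlongrightarrow> 0) at_top \<longrightarrow>
      (\<lambda>x. g x * Im (f x)) integrable_on upto_ereal R a \<and>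
      \<bar>integral (upto_ereal R a) (\<lambda>x. g x * Im (f x))\<bar> \<le> D * g R"
    using decreasing_weight_real[OF Ra im] by blast
  show ?thesis
  proof (intro exI[of _ "C + D"] allI impI)
    fix g :: "real \<Rightarrow> real"
    assume G: "(\<forall>x y. R \<le> x \<longrightarrow> x \<le> y \<longrightarrow> g y \<le> g x) \<and> (g \<longlongrightarrow> 0) at_top"
    then have g: "\<And>x y. R \<le> x \<Longrightarrow> x \<le> y \<Longrightarrow> g y \<le> g x" and lim: "(g \<longlongrightarrow> 0) at_top" by auto
    let ?S = "upto_ereal R a" and ?r = "\<lambda>x. g x * Re (f x)" and ?i = "\<lambda>x. g x * Im (f x)"
    have r: "(?r has_integral integral ?S ?r) ?S" "\<bar>integral ?S ?r\<bar> \<le> C * g R"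
      and i: "(?i has_integral integral ?S ?i) ?S" "\<bar>integral ?S ?i\<bar> \<le> D * g R"
      using C[of g] D[of g] G by auto
    have eq: "(\<lambda>x. complex_of_real (g x) * f x) = (\<lambda>x. of_real (?r x) + \<i> * of_real (?i x))"
      by (auto simp: complex_eq_iff)
    have h: "((\<lambda>x. complex_of_real (g x) * f x) has_integral
        (of_real (integral ?S ?r) + \<i> * of_real (integral ?S ?i))) ?S"
      unfolding eq using has_integral_linear[OF r(1) bounded_linear_of_real[where 'a=complex]]
        has_integral_linear[OF i(1) bounded_linear_of_real[where 'a=complex]]
      by (intro has_integral_add has_integral_mult_right) (simp_all add: o_def)
    have "norm (of_real (integral ?S ?r) + \<i> * of_real (integral ?S ?i)) \<le> \<bar>integral ?S ?r\<bar> + \<bar>integral ?S ?i\<bar>"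
      by (rule order_trans[OF norm_triangle_ineq]) (simp add: norm_mult)
    with r i have "norm (of_real (integral ?S ?r) + \<i> * of_real (integral ?S ?i)) \<le> (C + D) * g R"
      by (simp add: ring_distribs)
    with h show "(\<lambda>x. of_real (g x) * f x) integrable_on ?S \<and>
        norm (integral ?S (\<lambda>x. of_real (g x) * f x)) \<le> (C + D) * g R"
      by (auto simp: integral_unique)
  qed
qed

subsection \<open>Finite parts of holomorphic functions times powers of the logarithm\<close>

lemma has_integral_upto_ereal_iff:
  fixes f :: "real \<Rightarrow> 'a::banach"
  shows "(f has_integral I) (upto_ereal c (ereal R)) \<longleftrightarrow> (f has_integral I) {c..R}"
  by (rule has_integral_spike_set_eq) (auto simp: upto_ereal_def intro: negligible_subset[of "{R}"])

text \<open>For y = \<delta> |ln t|, a single term y^n / n! of the exponential series is at most exp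
  y, and exp y is one of the two powers of t on the right.\<close>

lemma abs_ln_power_le:
  fixes t \<delta> :: real
  assumes "t > 0" "\<delta> > 0"
  shows "\<bar>ln t\<bar> ^ n \<le> fact n / \<delta> ^ n * (t powr \<delta> + t powr (- \<delta>))"
proof -
  let ?y = "\<delta> * \<bar>ln t\<bar>"
  have "?y ^ n / fact n \<le> exp ?y"
  proof -
    have s: "(\<lambda>m. ?y ^ m /\<^sub>R fact m) sums exp ?y" by (rule exp_converges)
    have "(\<Sum>m\<in>{n}. ?y ^ m /\<^sub>R fact m) \<le> exp ?y"
      using s assms by (intro sum_le_suminf[of "\<lambda>m. ?y ^ m /\<^sub>R fact m" "{n}", THEN order_trans])
        (auto simp: sums_iff)
    then show ?thesis by (simp add: divide_inverse mult.commute)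
  qed
  also have "exp ?y \<le> t powr \<delta> + t powr (- \<delta>)"
    using assms by (cases "ln t \<ge> 0") (auto simp: powr_def)
  finally show ?thesis using assms by (simp add: field_simps power_mult_distrib)
qed

lemma borel_measurable_ln_power:
  "(\<lambda>t::real. complex_of_real (ln t) ^ n) \<in> borel_measurable (lebesgue_on S)"
  by (intro measurable_restrict_space1 measurable_completion) simp

lemma integrable_on_abs_ln_power:
  assumes "R \<ge> 0"
  shows "(\<lambda>t. \<bar>ln t\<bar> ^ n) integrable_on {0..R::real}"
proof (rule measurable_bounded_by_integrable_imp_integrable_real)
  \<comment> \<open>At t = 0 both powers are 0 while a zeroth power of the logarithm is 1; the
    summand 1 covers this.\<close>
  let ?g = "\<lambda>t::real. fact n / (1/2) ^ n * (t powr (1/2) + t powr (- (1/2))) + 1"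
  show "?g integrable_on {0..R}"
    using has_integral_powr_from_0[of "1/2" R] has_integral_powr_from_0[of "-1/2" R] assms
    by (intro integrable_add integrable_on_mult_right) (auto simp: integrable_on_def)
  show "\<bar>\<bar>ln t\<bar> ^ n\<bar> \<le> ?g t" if "t \<in> {0..R}" for t
  proof (cases "t = 0")
    case False
    with abs_ln_power_le[of t "1/2" n] that show ?thesis by simp
  qed (auto simp: power_0_left)
  show "(\<lambda>t. \<bar>ln t\<bar> ^ n) \<in> borel_measurable (lebesgue_on {0..R})"
    by (intro measurable_restrict_space1 measurable_completion) simp
qed auto

lemma integrable_continuous_times_ln_power:
  fixes f :: "real \<Rightarrow> complex"
  assumes "R \<ge> 0" "continuous_on {0..R} f" and M: "\<And>t. t \<in> {0..R} \<Longrightarrow> norm (f t) \<le> M"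
  shows "(\<lambda>t. f t * of_real (ln t) ^ n) integrable_on {0..R}" (is "?f integrable_on _")
    and "norm (integral {0..R} (\<lambda>t. f t * of_real (ln t) ^ n)) \<le> M * integral {0..R} (\<lambda>t. \<bar>ln t\<bar> ^ n)"
proof -
  have b: "norm (?f t) \<le> M * \<bar>ln t\<bar> ^ n" if "t \<in> {0..R}" for t
    using M[OF that] by (auto simp: norm_mult norm_power intro: mult_right_mono)
  have i: "(\<lambda>t. M * \<bar>ln t\<bar> ^ n) integrable_on {0..R}"
    by (intro integrable_on_mult_right integrable_on_abs_ln_power assms(1))
  have "?f \<in> borel_measurable (lebesgue_on {0..R})"
    by (rule borel_measurable_times[OF continuous_imp_measurable_on_sets_lebesgue[OF assms(2)] borel_measurable_ln_power]) auto
  then show *: "?f integrable_on {0..R}"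
    by (rule measurable_bounded_by_integrable_imp_integrable[OF _ i b]) auto
  show "norm (integral {0..R} ?f) \<le> M * integral {0..R} (\<lambda>t. \<bar>ln t\<bar> ^ n)"
    using integral_norm_bound_integral[OF * i b] by simp
qed

section \<open>Explicit primitives of ln^n t / t^p\<close>

lemma has_real_derivative_ln_power_Suc:
  assumes "t > 0"
  shows "((\<lambda>t. ln t ^ Suc n) has_real_derivative real (Suc n) * ln t ^ n / t) (at t)"
  using DERIV_power[OF DERIV_ln_divide[OF assms], of "Suc n"] by (simp add: mult_ac del: of_nat_Suc power_Suc)

text \<open>The primitive of ln^n t / t^(q+2), computed by repeated integration by parts. Shifting
  the exponent by 2 keeps the divisor q + 1 positive.\<close>

primrec log_pow_primitive :: "nat \<Rightarrow> nat \<Rightarrow> real \<Rightarrow> real" where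
  "log_pow_primitive q 0 t = - (1 / (real (Suc q) * t ^ Suc q))"
| "log_pow_primitive q (Suc n) t =
     - (ln t ^ Suc n / (real (Suc q) * t ^ Suc q)) + real (Suc n) / real (Suc q) * log_pow_primitive q n t"

text \<open>For \<open>p \<ge> 1\<close>, the primitive of \<open>ln t ^ n / t ^ p\<close> without constant term: it consists of
  diverging terms only, so the finite part over \<open>[0, R]\<close> is its value at \<open>R\<close>.\<close>

definition fp_primitive :: "nat \<Rightarrow> nat \<Rightarrow> real \<Rightarrow> real" where
  "fp_primitive p n t = (if p \<le> 1 then ln t ^ Suc n / real (Suc n) else log_pow_primitive (p - 2) n t)"

lemma has_real_derivative_log_pow_primitive:
  assumes "t > 0"
  shows "(log_pow_primitive q n has_real_derivative ln t ^ n / t ^ (q + 2)) (at t)"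
proof (induction n)
  case 0
  let ?d = "real (Suc q)"
  have 1: "((\<lambda>t. ?d * t ^ Suc q) has_real_derivative ?d * (?d * t ^ q)) (at t)"
    using DERIV_cmult[OF DERIV_pow[of "Suc q" t], of ?d] by simp
  have nz: "?d * t ^ Suc q \<noteq> 0" using assms by (simp del: of_nat_Suc)
  have 2: "(log_pow_primitive q 0 has_real_derivative
      - ((0 * (?d * t ^ Suc q) - 1 * (?d * (?d * t ^ q))) / (?d * t ^ Suc q * (?d * t ^ Suc q)))) (at t)"
    unfolding log_pow_primitive.simps[abs_def]
    by (intro DERIV_minus DERIV_divide DERIV_const 1 nz)
  show ?case
    by (rule DERIV_cong[OF 2]) (use assms in \<open>simp add: divide_simps del: of_nat_Suc\<close>)
next
  case (Suc n)
  let ?d = "real (Suc q)"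
  have 1: "((\<lambda>t. ?d * t ^ Suc q) has_real_derivative ?d * (?d * t ^ q)) (at t)"
    using DERIV_cmult[OF DERIV_pow[of "Suc q" t], of ?d] by simp
  have nz: "?d * t ^ Suc q \<noteq> 0" using assms by (simp del: of_nat_Suc)
  have 2: "(log_pow_primitive q (Suc n) has_real_derivative
      - ((real (Suc n) * ln t ^ n / t * (?d * t ^ Suc q) - ln t ^ Suc n * (?d * (?d * t ^ q))) / (?d * t ^ Suc q * (?d * t ^ Suc q)))
       + real (Suc n) / ?d * (ln t ^ n / t ^ (q + 2))) (at t)"
    unfolding log_pow_primitive.simps[abs_def]
    by (intro DERIV_add DERIV_minus DERIV_cmult Suc.IH DERIV_divide has_real_derivative_ln_power_Suc assms 1 nz)
  have d: "?d \<noteq> 0" by simp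
  have "- ((N * L / t * (D * (t * T)) - L * l * (D * (D * T))) / (D * (t * T) * (D * (t * T)))) + N / D * (L / (t * (t * T))) =
     l * L / (t * (t * T))" if "D \<noteq> 0" "T \<noteq> 0" for N L l T D :: real
    using assms that by (simp add: field_simps)
  from this[OF d, of "t ^ q" "real (Suc n)" "ln t ^ n" "ln t"] assms
  show ?case by (intro DERIV_cong[OF 2]) (simp add: mult.commute[of "ln t"] del: of_nat_Suc)
qed

lemma has_real_derivative_fp_primitive:
  assumes "t > 0" "p \<ge> 1"
  shows "(fp_primitive p n has_real_derivative ln t ^ n / t ^ p) (at t)"
proof (cases "p = 1")
  case True
  have "((\<lambda>t. ln t ^ Suc n / real (Suc n)) has_real_derivative ln t ^ n / t) (at t)"
    using DERIV_cdivide[OF has_real_derivative_ln_power_Suc[OF assms(1), of n], of "real (Suc n)"]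
    by (simp del: of_nat_Suc power_Suc)
  with True show ?thesis by (simp add: fp_primitive_def[abs_def])
next
  case False
  with assms obtain q where "p = q + 2" by (metis One_nat_def Suc_1 add.commute le_Suc_ex not_less_eq_eq antisym)
  with has_real_derivative_log_pow_primitive[OF assms(1), of q n] show ?thesis
    by (simp add: fp_primitive_def[abs_def])
qed

text \<open>Every summand is a power of ln \<epsilon> over \<epsilon>^(q+1), so no constant occurs.
  The match is claimed for \<epsilon> > 0, where complex \<open>powr\<close> agrees with the natural
  power.\<close>

lemma diverging_terms_log_pow_primitive:
  "\<exists>D. diverging_terms D \<and> (\<forall>\<epsilon>>0. D \<epsilon> = of_real (log_pow_primitive q n \<epsilon>))"
proof (induction n)
  have basic: "\<exists>D. diverging_terms D \<and> (\<forall>\<epsilon>>0. D \<epsilon> = of_real (- (ln \<epsilon> ^ m / (real (Suc q) * \<epsilon> ^ Suc q))))" for m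
  proof (intro exI conjI allI impI)
    show "diverging_terms (\<lambda>\<epsilon>. (- 1 / of_nat (Suc q)) *
        (complex_of_real \<epsilon> powr (- of_nat (Suc q)) * complex_of_real (ln \<epsilon>) ^ m))"
      by (intro diverging_terms_cmult diverging_terms_basic) (auto simp del: of_nat_Suc)
    show "(- 1 / of_nat (Suc q)) * (complex_of_real \<epsilon> powr (- of_nat (Suc q)) * complex_of_real (ln \<epsilon>) ^ m) =
        of_real (- (ln \<epsilon> ^ m / (real (Suc q) * \<epsilon> ^ Suc q)))" if "\<epsilon> > 0" for \<epsilon>
    proof -
      have "complex_of_real \<epsilon> powr (- of_nat (Suc q)) = inverse (complex_of_real \<epsilon> ^ Suc q)"
        using that powr_nat'[of "complex_of_real \<epsilon>" "Suc q"] by (simp only: powr_minus) simp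
      then show ?thesis by (simp add: field_simps)
    qed
  qed
  {
    case 0
    show ?case using basic[of 0] by simp
  next
    case (Suc n)
    then obtain D where D: "diverging_terms D" "\<forall>\<epsilon>>0. D \<epsilon> = of_real (log_pow_primitive q n \<epsilon>)" by blast
    obtain E where E: "diverging_terms E" "\<forall>\<epsilon>>0. E \<epsilon> = of_real (- (ln \<epsilon> ^ Suc n / (real (Suc q) * \<epsilon> ^ Suc q)))"
      using basic by blast
    have "diverging_terms (\<lambda>\<epsilon>. E \<epsilon> + of_real (real (Suc n) / real (Suc q)) * D \<epsilon>)"
      by (intro diverging_terms_add diverging_terms_cmult D E)
    moreover have "\<forall>\<epsilon>>0. E \<epsilon> + of_real (real (Suc n) / real (Suc q)) * D \<epsilon> = of_real (log_pow_primitive q (Suc n) \<epsilon>)"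
      using D E by (simp del: of_nat_Suc)
    ultimately show ?case by blast
  }
qed

lemma diverging_terms_fp_primitive:
  "\<exists>D. diverging_terms D \<and> (\<forall>\<epsilon>>0. D \<epsilon> = of_real (fp_primitive p n \<epsilon>))"
proof (cases "p \<le> 1")
  case True
  have "diverging_terms (\<lambda>\<epsilon>. (1 / of_nat (Suc n)) * (complex_of_real \<epsilon> powr (- 0) * complex_of_real (ln \<epsilon>) ^ Suc n))"
    by (intro diverging_terms_cmult diverging_terms_basic) auto
  then show ?thesis
    by (intro exI conjI) (assumption, use True in \<open>auto simp: fp_primitive_def\<close>)
next
  case False
  then show ?thesis using diverging_terms_log_pow_primitive by (simp add: fp_primitive_def[abs_def])
qed

text \<open>All divisors q + 1 are at least 1, so the recursion in n yields a constant independent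
  of q. This uniformity gives the geometric decay of the moments in p.\<close>

lemma log_pow_primitive_bound:
  assumes "R > 0"
  obtains K where "\<And>q. \<bar>log_pow_primitive q n R\<bar> \<le> K / R ^ Suc q"
proof -
  have "\<exists>K\<ge>0. \<forall>q. \<bar>log_pow_primitive q n R\<bar> \<le> K / R ^ Suc q"
  proof (induction n)
    case 0
    have "\<bar>log_pow_primitive q 0 R\<bar> \<le> 1 / R ^ Suc q" for q
    proof -
      have "1 / (real (Suc q) * R ^ Suc q) \<le> 1 / (1 * R ^ Suc q)"
        using assms by (intro divide_left_mono mult_right_mono) auto
      then show ?thesis using assms by (simp del: of_nat_Suc)
    qed
    then show ?case by (intro exI[of _ 1]) auto
  next
    case (Suc n)
    then obtain K where K: "K \<ge> 0" "\<And>q. \<bar>log_pow_primitive q n R\<bar> \<le> K / R ^ Suc q" by blast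
    have "\<bar>log_pow_primitive q (Suc n) R\<bar> \<le> (\<bar>ln R\<bar> ^ Suc n + real (Suc n) * K) / R ^ Suc q" for q
    proof -
      have "\<bar>log_pow_primitive q (Suc n) R\<bar> \<le>
          \<bar>ln R\<bar> ^ Suc n / (real (Suc q) * R ^ Suc q) + real (Suc n) / real (Suc q) * \<bar>log_pow_primitive q n R\<bar>"
        using assms unfolding log_pow_primitive.simps
        by (intro order_trans[OF abs_triangle_ineq]) (simp add: abs_mult power_abs del: of_nat_Suc power_Suc)
      also have "\<dots> \<le> \<bar>ln R\<bar> ^ Suc n / (1 * R ^ Suc q) + real (Suc n) / 1 * (K / R ^ Suc q)"
        using assms K by (intro add_mono divide_left_mono mult_mono mult_right_mono) auto
      also have "\<dots> = (\<bar>ln R\<bar> ^ Suc n + real (Suc n) * K) / R ^ Suc q"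
        by (simp add: add_divide_distrib del: power_Suc)
      finally show ?thesis .
    qed
    then show ?case using K by (intro exI[of _ "\<bar>ln R\<bar> ^ Suc n + real (Suc n) * K"]) auto
  qed
  then show ?thesis using that by blast
qed

lemma fp_primitive_bound:
  assumes "R > 0"
  obtains K where "K \<ge> 0" "\<And>p. p \<ge> 1 \<Longrightarrow> \<bar>fp_primitive p n R\<bar> \<le> K / R ^ p"
proof -
  obtain K where K: "\<And>q. \<bar>log_pow_primitive q n R\<bar> \<le> K / R ^ Suc q"
    using log_pow_primitive_bound[OF assms, of n] by blast
  \<comment> \<open>The factor R turns R^(-(p-1)) into R^(-p). The second entry covers p = 1, where
    the primitive is a pure power of the logarithm.\<close>
  define L where "L = max (\<bar>K\<bar> * R) (\<bar>ln R\<bar> ^ Suc n * R)"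
  show thesis
  proof
    show "L \<ge> 0" using assms by (simp add: L_def le_max_iff_disj)
    fix p :: nat assume p: "p \<ge> 1"
    show "\<bar>fp_primitive p n R\<bar> \<le> L / R ^ p"
    proof (cases "p = 1")
      case True
      have "\<bar>ln R ^ Suc n / real (Suc n)\<bar> \<le> \<bar>ln R\<bar> ^ Suc n / 1"
        unfolding abs_divide power_abs by (intro divide_left_mono) auto
      also have "\<dots> = (\<bar>ln R\<bar> ^ Suc n * R) / R ^ p" using True assms by simp
      also have "\<dots> \<le> L / R ^ p" using assms by (intro divide_right_mono) (auto simp: L_def)
      finally show ?thesis using True by (simp add: fp_primitive_def)
    next
      case False
      with p obtain q where q: "p = q + 2" by (metis One_nat_def Suc_1 add.commute le_Suc_ex not_less_eq_eq antisym)
      have "\<bar>fp_primitive p n R\<bar> \<le> K / R ^ Suc q" using K q by (simp add: fp_primitive_def)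
      also have "\<dots> \<le> \<bar>K\<bar> / R ^ Suc q" using assms by (intro divide_right_mono) auto
      also have "\<dots> = (\<bar>K\<bar> * R) / R ^ p" using q assms by simp
      also have "\<dots> \<le> L / R ^ p" using assms by (intro divide_right_mono) (auto simp: L_def)
      finally show ?thesis .
    qed
  qed
qed

lemma has_fp_integral_ln_power_over_power:
  assumes "p \<ge> 1" "R > 0"
  shows "has_fp_integral (\<lambda>t. of_real (ln t) ^ n / of_real t ^ p) (ereal R) (of_real (fp_primitive p n R))"
proof -
  obtain D where D: "diverging_terms D" "\<And>\<epsilon>. \<epsilon> > 0 \<Longrightarrow> D \<epsilon> = of_real (fp_primitive p n \<epsilon>)"
    using diverging_terms_fp_primitive by blast
  have "((\<lambda>t. complex_of_real (ln t) ^ n / of_real t ^ p) has_integral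
      (of_real (fp_primitive p n R) + - D \<epsilon>)) (upto_ereal \<epsilon> (ereal R))" if "0 < \<epsilon>" "\<epsilon> < R" for \<epsilon>
  proof -
    have "((\<lambda>t. ln t ^ n / t ^ p) has_integral (fp_primitive p n R - fp_primitive p n \<epsilon>)) {\<epsilon>..R}"
      using that assms
      by (intro fundamental_theorem_of_calculus)
        (auto simp flip: has_real_derivative_iff_has_vector_derivative
          intro!: DERIV_subset[OF has_real_derivative_fp_primitive])
    from has_integral_linear[OF this bounded_linear_of_real[where 'a=complex]] show ?thesis
      unfolding has_integral_upto_ereal_iff using D(2) that by (simp add: o_def)
  qed
  then show ?thesis unfolding has_fp_integral_def
    by (intro exI[of _ "\<lambda>_. of_real (fp_primitive p n R)"] exI[of _ "\<lambda>\<epsilon>. - D \<epsilon>"])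
      (auto intro: diverging_terms_cmult[OF D(1), of "- 1", simplified])
qed

lemma has_fp_integral_integrable:
  assumes f: "f integrable_on {0..R}" and R: "R > 0"
  shows "has_fp_integral f (ereal R) (integral {0..R} f)"
proof -
  have "(f has_integral (integral {\<epsilon>..R} f + 0)) (upto_ereal \<epsilon> (ereal R))" if "0 < \<epsilon>" for \<epsilon>
    unfolding has_integral_upto_ereal_iff
    using integrable_on_subinterval[OF f, of \<epsilon> R] that by auto
  moreover have "((\<lambda>\<epsilon>. integral {\<epsilon>..R} f) \<longlongrightarrow> integral {0..R} f) (at_right 0)"
  proof -
    have "continuous_on {0..R} (\<lambda>x. integral {x..R} f)"
      by (rule indefinite_integral_continuous_1'[OF f])
    then have "((\<lambda>\<epsilon>. integral {\<epsilon>..R} f) \<longlongrightarrow> integral {0..R} f) (at 0 within {0..R})"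
      using R by (auto simp: continuous_on_def)
    then show ?thesis using R at_within_Icc_at_right[of 0 R] by simp
  qed
  ultimately show ?thesis
    unfolding has_fp_integral_def
    by (intro exI[of _ "\<lambda>\<epsilon>. integral {\<epsilon>..R} f"] exI[of _ "\<lambda>_. 0"]) (auto intro: diverging_terms_0)
qed

section \<open>Splitting integrals and finite parts at R\<close>

lemma upto_ereal_split:
  assumes "c \<le> R" "ereal R < a"
  shows "upto_ereal c a = upto_ereal c (ereal R) \<union> upto_ereal R a"
    "upto_ereal c (ereal R) \<inter> upto_ereal R a = {}"
  using assms by (auto simp: upto_ereal_def) (metis ereal_less_eq(3) le_less_trans less_imp_le linorder_not_less)

lemma integrable_on_upto_ereal_tail:
  fixes f :: "real \<Rightarrow> complex"
  assumes f: "f integrable_on upto_ereal c a" and "c \<le> R" "ereal R < a"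
  shows "f integrable_on upto_ereal R a"
    and "f integrable_on {c..R}"
    and "integral (upto_ereal c a) f = integral {c..R} f + integral (upto_ereal R a) f"
proof -
  have sub: "{c..R} \<subseteq> upto_ereal c a"
    using assms by (auto simp: upto_ereal_def) (metis ereal_less_eq(3) le_less_trans)
  show 1: "f integrable_on {c..R}"
    using integrable_on_subinterval[OF f sub] .
  have "(f has_integral integral {c..R} f) (upto_ereal c (ereal R))"
    unfolding has_integral_upto_ereal_iff using 1 by auto
  \<comment> \<open>Henstock-Kurzweil integrability does not pass to arbitrary subsets. The tail is
    obtained as the difference of two functions extended by 0 to the whole line.\<close>
  from has_integral_diff[OF has_integral_restrict_UNIV[THEN iffD2, OF integrable_integral[OF f]]
      has_integral_restrict_UNIV[THEN iffD2, OF this]]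
  have "((\<lambda>x. (if x \<in> upto_ereal c a then f x else 0) - (if x \<in> upto_ereal c (ereal R) then f x else 0))
      has_integral (integral (upto_ereal c a) f - integral {c..R} f)) UNIV" .
  also have "(\<lambda>x. (if x \<in> upto_ereal c a then f x else 0) - (if x \<in> upto_ereal c (ereal R) then f x else 0)) =
      (\<lambda>x. if x \<in> upto_ereal R a then f x else 0)"
    using upto_ereal_split[OF assms(2,3)] by (auto simp: fun_eq_iff)
  finally have "(f has_integral (integral (upto_ereal c a) f - integral {c..R} f)) (upto_ereal R a)"
    by (simp add: has_integral_restrict_UNIV)
  then show "f integrable_on upto_ereal R a"
    "integral (upto_ereal c a) f = integral {c..R} f + integral (upto_ereal R a) f"
    by (auto simp: integral_unique)
qed

lemma has_fp_integral_extend: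
  assumes fp: "has_fp_integral f (ereal R) I" and f: "f integrable_on upto_ereal R a"
    and R: "0 < R" "ereal R < a"
  shows "has_fp_integral f a (I + integral (upto_ereal R a) f)"
proof -
  obtain C D where 1: "\<And>\<epsilon>. 0 < \<epsilon> \<and> ereal \<epsilon> < ereal R \<Longrightarrow> (f has_integral (C \<epsilon> + D \<epsilon>)) (upto_ereal \<epsilon> (ereal R))"
    "diverging_terms D" "(C \<longlongrightarrow> I) (at_right 0)"
    using fp unfolding has_fp_integral_def by blast
  let ?T = "integral (upto_ereal R a) f"
  have *: "(f has_integral (C \<epsilon> + ?T + D \<epsilon>)) (upto_ereal \<epsilon> a)" if "0 < \<epsilon>" "\<epsilon> < R" for \<epsilon>
    using has_integral_Un[OF 1(1)[of \<epsilon>] integrable_integral[OF f]] that upto_ereal_split[of \<epsilon> R a] R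
    by (simp add: algebra_simps)
  \<comment> \<open>Only small \<epsilon> affect the limit. For \<epsilon> \<ge> R the convergent
    part is set to whatever makes the decomposition true.\<close>
  define C' where "C' \<epsilon> = (if \<epsilon> < R then C \<epsilon> + ?T else integral (upto_ereal \<epsilon> a) f - D \<epsilon>)" for \<epsilon>
  have "(f has_integral (C' \<epsilon> + D \<epsilon>)) (upto_ereal \<epsilon> a)" if "0 < \<epsilon>" "ereal \<epsilon> < a" for \<epsilon>
  proof (cases "\<epsilon> < R")
    case True
    then show ?thesis using * that by (simp add: C'_def)
  next
    case False
    then have "f integrable_on upto_ereal \<epsilon> a"
      using integrable_on_upto_ereal_tail(1)[OF f] that by simp
    then show ?thesis using False by (simp add: C'_def integrable_integral)
  qed
  moreover have "(C' \<longlongrightarrow> I + ?T) (at_right 0)"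
  proof (rule Lim_transform_eventually)
    show "((\<lambda>\<epsilon>. C \<epsilon> + ?T) \<longlongrightarrow> I + ?T) (at_right 0)" by (intro tendsto_intros 1)
    show "eventually (\<lambda>\<epsilon>. C \<epsilon> + ?T = C' \<epsilon>) (at_right 0)"
      using eventually_at_right_real[OF R(1)] by eventually_elim (auto simp: C'_def)
  qed
  ultimately show ?thesis unfolding has_fp_integral_def using 1(2)
    by (intro exI[of _ C'] exI[of _ D]) auto
qed

text \<open>Divide the Taylor expansion at order p. The terms of degree j < p become explicit
  primitives of exponent p - j; the remainder is t^p times a continuous function, so its part is an
  ordinary integral. Since the Taylor coefficients are absolutely summable against R^j, both parts
  are O(R^(-p)), the decay required for telescoping.\<close>

lemma has_fp_integral_holomorphic_times_ln_power:
  assumes H: "H holomorphic_on ball 0 \<rho>" and R: "0 < R" "R < \<rho>"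
  obtains J C where
    "\<And>p. has_fp_integral (\<lambda>t. H (of_real t) * of_real (ln t) ^ n / of_real t ^ p) (ereal R) (J p)"
    "\<And>p. norm (J p) \<le> C / R ^ p"
proof -
  define c where "c j = (deriv ^^ j) H 0 / fact j" for j
  have sums: "(\<lambda>j. c j * z ^ j) sums H z" if "norm z < \<rho>" for z
    using holomorphic_power_series[OF H, of z] that by (simp add: c_def)
  \<comment> \<open>A radius strictly between R and \<rho>: convergence of the power series at
    \<open>K\<close> gives absolute convergence at R and continuity of the remainders on
    [0, R].\<close>
  define K where "K = (R + \<rho>) / 2"
  have K: "R < K" "K < \<rho>" "K > 0" using R by (auto simp: K_def)
  have sK: "summable (\<lambda>j. c j * of_real K ^ j)" using sums[of "of_real K"] K by (auto simp: sums_iff)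
  have sR: "summable (\<lambda>j. norm (c j) * R ^ j)"
    using powser_insidea[OF sK, of "of_real R"] K R by (simp add: norm_mult norm_power)
  define M where "M = (\<Sum>j. norm (c j) * R ^ j)"
  define r where "r p z = (\<Sum>j. c (j + p) * z ^ j)" for p z
  have shiftK: "summable (\<lambda>j. c (j + p) * of_real K ^ j)" for p
  proof -
    have "summable (\<lambda>j. c (j + p) * of_real K ^ (j + p) / of_real K ^ p)"
      using summable_ignore_initial_segment[OF sK, of p] by (rule summable_divide)
    then show ?thesis using K by (simp add: power_add)
  qed
  have cont: "continuous_on {0..R} (\<lambda>t. r p (of_real t))" for p
  proof -
    have "isCont (r p) (of_real t)" if "t \<in> {0..R}" for t
      unfolding r_def[abs_def] by (rule isCont_powser[OF shiftK]) (use that K in auto)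
    then show ?thesis
      by (intro continuous_at_imp_continuous_on ballI isCont_o2[where g = "r p" and f = of_real]) auto
  qed
  have rb: "norm (r p (of_real t)) \<le> M / R ^ p" if t: "t \<in> {0..R}" for p t
  proof -
    have s: "summable (\<lambda>j. norm (c (j + p)) * R ^ j)"
    proof -
      have "summable (\<lambda>j. norm (c (j + p)) * R ^ (j + p) / R ^ p)"
        using summable_ignore_initial_segment[OF sR, of p] by (rule summable_divide)
      then show ?thesis using R by (simp add: power_add)
    qed
    have le: "norm (c (j + p) * of_real t ^ j) \<le> norm (c (j + p)) * R ^ j" for j
      using t by (auto simp: norm_mult norm_power intro!: mult_left_mono power_mono)
    have "norm (r p (of_real t)) \<le> (\<Sum>j. norm (c (j + p)) * R ^ j)"
      unfolding r_def by (rule norm_suminf_le[OF le s])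
    also have "\<dots> = (\<Sum>j. norm (c (j + p)) * R ^ (j + p)) / R ^ p"
      using suminf_divide[OF summable_ignore_initial_segment[OF sR, of p], of "R ^ p"] R
      by (simp add: power_add)
    also have "(\<Sum>j. norm (c (j + p)) * R ^ (j + p)) \<le> M"
      using suminf_split_initial_segment[OF sR, of p] R unfolding M_def
      by (simp add: sum_nonneg)
    finally show ?thesis using R by (simp add: divide_right_mono)
  qed
  have split: "H (of_real t) = (\<Sum>j<p. c j * of_real t ^ j) + of_real t ^ p * r p (of_real t)"
    if t: "t \<in> {0..R}" for t p
  proof -
    have st: "summable (\<lambda>j. c j * of_real t ^ j)" and H: "H (of_real t) = (\<Sum>j. c j * of_real t ^ j)"
      using sums[of "of_real t"] t R by (auto simp: sums_iff)
    have "summable (\<lambda>j. c (j + p) * of_real t ^ j)"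
      using powser_inside[OF shiftK, of "of_real t"] t K by auto
    from suminf_mult[OF this, of "of_real t ^ p"]
    have "of_real t ^ p * r p (of_real t) = (\<Sum>j. c (j + p) * of_real t ^ (j + p))"
      by (simp add: r_def power_add mult_ac)
    with suminf_split_initial_segment[OF st, of p] show ?thesis by (simp add: H)
  qed
  obtain Q where Q: "Q \<ge> 0" "\<And>p. p \<ge> 1 \<Longrightarrow> \<bar>fp_primitive p n R\<bar> \<le> Q / R ^ p"
    using fp_primitive_bound[OF R(1), of n] by blast
  define L where "L = integral {0..R} (\<lambda>t. \<bar>ln t\<bar> ^ n)"
  \<comment> \<open>For p = 0 the sum is empty and this is the ordinary integral of H(t) ln^n
    t.\<close>
  define J where "J p = (\<Sum>j<p. c j * of_real (fp_primitive (p - j) n R))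
      + integral {0..R} (\<lambda>t. r p (of_real t) * of_real (ln t) ^ n)" for p
  show thesis
  proof (rule that)
    fix p
    have "has_fp_integral (\<lambda>t. (\<Sum>j<p. c j * (of_real (ln t) ^ n / of_real t ^ (p - j)))
        + r p (of_real t) * of_real (ln t) ^ n) (ereal R) (J p)"
      unfolding J_def using R
      by (intro has_fp_integral_add has_fp_integral_sum has_fp_integral_cmult has_fp_integral_ln_power_over_power
          has_fp_integral_integrable integrable_continuous_times_ln_power(1)[OF _ cont rb]) auto
    also have "has_fp_integral (\<lambda>t. (\<Sum>j<p. c j * (of_real (ln t) ^ n / of_real t ^ (p - j)))
        + r p (of_real t) * of_real (ln t) ^ n) (ereal R) (J p) \<longleftrightarrow>
      has_fp_integral (\<lambda>t. H (of_real t) * of_real (ln t) ^ n / of_real t ^ p) (ereal R) (J p)"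
    proof (rule has_fp_integral_cong)
      fix t assume t: "0 < t" "ereal t < ereal R"
      have "c j * (of_real (ln t) ^ n / of_real t ^ (p - j)) = c j * of_real t ^ j * of_real (ln t) ^ n / of_real t ^ p"
        if "j < p" for j
      proof -
        have "of_real t ^ p = of_real t ^ (p - j) * complex_of_real t ^ j"
          using that by (simp flip: power_add)
        then show ?thesis using t by (simp add: field_simps)
      qed
      then have "(\<Sum>j<p. c j * (of_real (ln t) ^ n / of_real t ^ (p - j))) =
          (\<Sum>j<p. c j * of_real t ^ j) * of_real (ln t) ^ n / of_real t ^ p"
        by (simp add: sum_distrib_right sum_divide_distrib)
      then show "(\<Sum>j<p. c j * (of_real (ln t) ^ n / of_real t ^ (p - j))) + r p (of_real t) * of_real (ln t) ^ n =
          H (of_real t) * of_real (ln t) ^ n / of_real t ^ p"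
        using split[of t p] t by (simp add: field_simps)
    qed
    finally show "has_fp_integral (\<lambda>t. H (of_real t) * of_real (ln t) ^ n / of_real t ^ p) (ereal R) (J p)" .
  next
    fix p
    have "norm (\<Sum>j<p. c j * of_real (fp_primitive (p - j) n R)) \<le> (\<Sum>j<p. norm (c j) * R ^ j * (Q / R ^ p))"
    proof (rule order_trans[OF norm_sum sum_mono])
      fix j assume "j \<in> {..<p}"
      then have "norm (c j * of_real (fp_primitive (p - j) n R)) \<le> norm (c j) * (Q / R ^ (p - j))"
        using mult_left_mono[OF Q(2)[of "p - j"] norm_ge_zero[of "c j"]] by (simp add: norm_mult)
      also have "R ^ p = R ^ (p - j) * R ^ j" using \<open>j \<in> _\<close> by (simp flip: power_add)
      then have "norm (c j) * (Q / R ^ (p - j)) = norm (c j) * R ^ j * (Q / R ^ p)"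
        using R by (simp add: field_simps)
      finally show "norm (c j * of_real (fp_primitive (p - j) n R)) \<le> norm (c j) * R ^ j * (Q / R ^ p)" .
    qed
    also have "\<dots> \<le> M * (Q / R ^ p)"
      unfolding sum_distrib_right[symmetric] M_def using R Q(1)
      by (intro mult_right_mono sum_le_suminf[OF sR]) auto
    finally have 1: "norm (\<Sum>j<p. c j * of_real (fp_primitive (p - j) n R)) \<le> M * (Q / R ^ p)" .
    have 2: "norm (integral {0..R} (\<lambda>t. r p (of_real t) * of_real (ln t) ^ n)) \<le> M / R ^ p * L"
      unfolding L_def using R by (intro integrable_continuous_times_ln_power(2)[OF _ cont rb]) auto
    have "norm (J p) \<le> M * (Q / R ^ p) + M / R ^ p * L"
      unfolding J_def by (rule norm_triangle_le) (use 1 2 in simp)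
    also have "\<dots> = (M * Q + M * L) / R ^ p" by (simp add: add_divide_distrib)
    finally show "norm (J p) \<le> (M * Q + M * L) / R ^ p" .
  qed
qed

subsection \<open>The integral of a power over a quadratic\<close>

text \<open>The constant has to be uniform in w because w will move along a segment. For t \<ge> N
  one has |w| \<le> t/2 and t \<ge> 1, so the modulus is at least (3/4) t^2 \<ge> (3/8)(1 + t^2).
  For t < N, factor into (w + it)(w - it): both moduli are at least Re w \<ge> m.\<close>

lemma norm_sq_plus_sq_lower_bound:
  fixes m M :: real
  assumes m: "m > 0"
  obtains c where "c > 0"
    "\<And>w t. m \<le> Re w \<Longrightarrow> norm w \<le> M \<Longrightarrow> t \<ge> 0 \<Longrightarrow> c * (1 + t\<^sup>2) \<le> norm (w\<^sup>2 + (of_real t)\<^sup>2)"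
proof
  define N where "N = max (2 * M) 1"
  have N: "N \<ge> 2 * M" "N \<ge> 1" by (auto simp: N_def)
  define c where "c = min (3/8) (m\<^sup>2 / (1 + N\<^sup>2))"
  show "c > 0" using m by (auto simp: c_def intro!: divide_pos_pos add_pos_nonneg)
  fix w :: complex and t :: real
  assume w: "m \<le> Re w" "norm w \<le> M" "t \<ge> 0"
  show "c * (1 + t\<^sup>2) \<le> norm (w\<^sup>2 + (of_real t)\<^sup>2)"
  proof (cases "t \<ge> N")
    case True
    have "norm w \<le> t / 2" using True N w by simp
    then have "(norm w)\<^sup>2 \<le> (t / 2)\<^sup>2" by (intro power_mono) auto
    moreover have "1 \<le> t\<^sup>2" using True N by (simp add: one_le_power)
    moreover have "norm (complex_of_real t ^ 2) - norm (w\<^sup>2) \<le> norm (complex_of_real t ^ 2 + w\<^sup>2)"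
      by (rule norm_diff_ineq)
    ultimately have "3/8 * (1 + t\<^sup>2) \<le> norm (w\<^sup>2 + (of_real t)\<^sup>2)"
      by (simp add: norm_power power_divide add.commute)
    moreover have "c * (1 + t\<^sup>2) \<le> 3/8 * (1 + t\<^sup>2)" 
      by (intro mult_right_mono) (simp_all only: c_def min.cobounded1, simp)
    ultimately show ?thesis by linarith
  next
    case False
    have "m \<le> norm (w + \<i> * of_real t)" "m \<le> norm (w - \<i> * of_real t)"
      using abs_Re_le_cmod[of "w + \<i> * of_real t"] abs_Re_le_cmod[of "w - \<i> * of_real t"] w by auto
    then have "m * m \<le> norm (w + \<i> * of_real t) * norm (w - \<i> * of_real t)"
      using m by (intro mult_mono) auto
    also have "\<dots> = norm (w\<^sup>2 + (of_real t)\<^sup>2)"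
      unfolding norm_mult[symmetric] by (rule arg_cong[of _ _ norm]) (simp add: power2_eq_square algebra_simps)
    finally have 1: "m\<^sup>2 \<le> norm (w\<^sup>2 + (of_real t)\<^sup>2)" by (simp add: power2_eq_square)
    have "c * (1 + t\<^sup>2) \<le> (m\<^sup>2 / (1 + N\<^sup>2)) * (1 + N\<^sup>2)"
      using False w m by (intro mult_mono add_left_mono power_mono) (auto simp: c_def)
    also have "\<dots> = m\<^sup>2" using zero_le_power2[of N] by (simp add: add_nonneg_eq_0_iff)
    finally show ?thesis using 1 by simp
  qed
qed

lemma norm_sq_plus_sq_lower_bound_single:
  assumes "Re w > 0"
  obtains c where "c > 0" "\<And>t. t \<ge> 0 \<Longrightarrow> c * (1 + t\<^sup>2) \<le> norm (w\<^sup>2 + (complex_of_real t)\<^sup>2)"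
  using norm_sq_plus_sq_lower_bound[OF assms, of "norm w"] by (metis order_refl)

lemma sq_plus_sq_nonzero:
  assumes "Re w > 0" "t \<ge> 0"
  shows "w\<^sup>2 + (complex_of_real t)\<^sup>2 \<noteq> 0"
proof -
  obtain c where "c > 0" "c * (1 + t\<^sup>2) \<le> norm (w\<^sup>2 + (complex_of_real t)\<^sup>2)"
    using norm_sq_plus_sq_lower_bound_single[OF assms(1)] assms(2) by metis
  moreover have "c * (1 + t\<^sup>2) > 0" using \<open>c > 0\<close> by (intro mult_pos_pos add_pos_nonneg) auto
  ultimately show ?thesis by auto
qed

lemma Beta_reflection_real:
  fixes a :: real
  assumes "0 < a" "a < 1"
  shows "Beta a (1 - a) = pi / sin (pi * a)"
proof -
  have "complex_of_real (Gamma a * Gamma (1 - a)) = Gamma (complex_of_real a) * Gamma (1 - complex_of_real a)"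
    by (simp add: Gamma_complex_of_real[symmetric])
  also have "\<dots> = of_real pi / sin (of_real pi * of_real a)" by (rule Gamma_reflection_complex)
  also have "\<dots> = complex_of_real (pi / sin (pi * a))" by (simp flip: sin_of_real of_real_mult)
  finally have "Gamma a * Gamma (1 - a) = pi / sin (pi * a)" by (simp only: of_real_eq_iff)
  then show ?thesis by (simp add: Beta_def)
qed

text \<open>The substitution u = t^2 / (1 + t^2) maps the half-line onto (0, 1) and turns twice the
  integral into Beta(a, 1 - a) with a = (1 + x)/2. The reflection formula gives pi / sin(pi a), and
  sin(pi a) = cos(pi x / 2).\<close>

lemma integral_powr_over_one_plus_sq:
  fixes x :: real
  assumes x: "-1 < x" "x < 1"
  shows "(\<lambda>t. t powr x / (1 + t\<^sup>2)) absolutely_integrable_on {0<..}"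
    and "integral {0<..} (\<lambda>t. t powr x / (1 + t\<^sup>2)) = (pi / 2) / cos (pi / 2 * x)"
proof -
  define a where "a = (1 + x) / 2"
  have a: "0 < a" "a < 1" "1 - a > 0" using x by (auto simp: a_def)
  define f where "f u = u powr (a - 1) * (1 - u) powr ((1 - a) - 1)" for u :: real
  define g where "g t = t\<^sup>2 / (1 + t\<^sup>2)" for t :: real
  define g' where "g' t = 2 * t / (1 + t\<^sup>2)\<^sup>2" for t :: real
  have pos: "1 + t\<^sup>2 > 0" for t :: real by (intro add_pos_nonneg) auto
  have B: "(f has_integral Beta a (1 - a)) {0<..<1}"
    using has_integral_Beta_real[OF a(1) a(3)] unfolding f_def by (simp add: has_integral_Icc_iff_Ioo)
  then have f: "f absolutely_integrable_on {0<..<1}" "integral {0<..<1} f = Beta a (1 - a)"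
    by (auto intro!: nonnegative_absolutely_integrable_1 simp: f_def integral_unique)
  have der: "(g has_field_derivative g' t) (at t within {0<..})" for t
  proof -
    have "(g has_field_derivative (2 * t * (1 + t\<^sup>2) - t\<^sup>2 * (2 * t)) / ((1 + t\<^sup>2) * (1 + t\<^sup>2))) (at t)"
      unfolding g_def[abs_def] using pos[of t] by (auto intro!: derivative_eq_intros)
    moreover have "(2 * t * (1 + t\<^sup>2) - t\<^sup>2 * (2 * t)) / ((1 + t\<^sup>2) * (1 + t\<^sup>2)) = g' t"
      by (simp add: g'_def power2_eq_square algebra_simps)
    ultimately show ?thesis using DERIV_subset by force
  qed
  have inj: "inj_on g {0<..}"
  proof (rule inj_onI)
    fix s t :: real assume *: "s \<in> {0<..}" "t \<in> {0<..}" "g s = g t"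
    then have "s\<^sup>2 * (1 + t\<^sup>2) = t\<^sup>2 * (1 + s\<^sup>2)"
      using pos[of s] pos[of t] by (simp add: g_def frac_eq_eq)
    then have "s\<^sup>2 = t\<^sup>2" by (simp add: algebra_simps)
    with * show "s = t" by (simp add: power2_eq_iff_nonneg)
  qed
  have img: "g ` {0<..} = {0<..<1}"
  proof (intro equalityI subsetI)
    fix u assume "u \<in> g ` {0<..}"
    then show "u \<in> {0<..<1}" using pos by (auto simp: g_def)
  next
    fix u :: real assume u: "u \<in> {0<..<1}"
    have "u = g (sqrt (u / (1 - u)))" using u by (simp add: g_def field_simps)
    moreover have "sqrt (u / (1 - u)) \<in> {0<..}" using u by simp
    ultimately show "u \<in> g ` {0<..}" by blast
  qed
  have eq: "\<bar>g' t\<bar> * f (g t) = 2 * (t powr x / (1 + t\<^sup>2))" if "t \<in> {0<..}" for t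
  proof -
    have t: "t > 0" using that by simp
    have "1 - g t = 1 / (1 + t\<^sup>2)" using pos[of t] by (simp add: g_def field_simps)
    then have "f (g t) = (t\<^sup>2 / (1 + t\<^sup>2)) powr (a - 1) * (1 / (1 + t\<^sup>2)) powr (- a)"
      by (simp add: f_def g_def)
    also have "\<dots> = (t\<^sup>2) powr (a - 1) * ((1 + t\<^sup>2) powr (- (a - 1)) * (1 + t\<^sup>2) powr a)"
    proof -
      have "(1 / (1 + t\<^sup>2)) powr (- a) = (1 + t\<^sup>2) powr a"
        using pos[of t] by (simp add: powr_divide powr_minus)
      moreover have "(t\<^sup>2 / (1 + t\<^sup>2)) powr (a - 1) = (t\<^sup>2) powr (a - 1) * (1 + t\<^sup>2) powr (- (a - 1))"
      proof -
        have "(t\<^sup>2 / (1 + t\<^sup>2)) powr (a - 1) = (t\<^sup>2) powr (a - 1) / (1 + t\<^sup>2) powr (a - 1)"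
          by (rule powr_divide)
        then show ?thesis by (simp only: powr_minus divide_inverse)
      qed
      ultimately show ?thesis by simp
    qed
    also have "(1 + t\<^sup>2) powr (- (a - 1)) * (1 + t\<^sup>2) powr a = 1 + t\<^sup>2"
      using pos[of t] by (simp add: powr_add[symmetric])
    also have "(t\<^sup>2) powr (a - 1) = t powr (x - 1)"
      using t by (simp add: powr_power[symmetric] powr_powr a_def flip: powr_numeral) (simp add: diff_divide_distrib)
    also have "t powr (x - 1) = t powr x / t" using t by (simp add: powr_diff)
    finally have "f (g t) = t powr x / t * (1 + t\<^sup>2)" .
    moreover have "2 * t / P\<^sup>2 * (X / t * P) = 2 * (X / P)" if "P \<noteq> 0" for P X :: real
      using t that by (simp add: field_simps power2_eq_square)
    moreover have "\<bar>g' t\<bar> = 2 * t / (1 + t\<^sup>2)\<^sup>2" using t by (simp add: g'_def)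
    ultimately show ?thesis using pos[of t] by simp
  qed
  have "(\<lambda>t. \<bar>g' t\<bar> * f (g t)) absolutely_integrable_on {0<..} \<and>
      integral {0<..} (\<lambda>t. \<bar>g' t\<bar> * f (g t)) = Beta a (1 - a)"
    using has_absolute_integral_change_of_variables_1'[of "{0<..}" g g' f "Beta a (1 - a)"] der inj img f by auto
  then have 2: "(\<lambda>t. 2 * (t powr x / (1 + t\<^sup>2))) absolutely_integrable_on {0<..}"
      "integral {0<..} (\<lambda>t. 2 * (t powr x / (1 + t\<^sup>2))) = Beta a (1 - a)"
    using absolutely_integrable_spike_eq[of "{}" "{0<..}" "\<lambda>t. \<bar>g' t\<bar> * f (g t)" "\<lambda>t. 2 * (t powr x / (1 + t\<^sup>2))"]
      integral_cong[of "{0<..}" "\<lambda>t. \<bar>g' t\<bar> * f (g t)" "\<lambda>t. 2 * (t powr x / (1 + t\<^sup>2))"] eq by auto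
  from absolutely_integrable_scaleR_left[OF 2(1), of "1/2"]
  show 3: "(\<lambda>t. t powr x / (1 + t\<^sup>2)) absolutely_integrable_on {0<..}" by simp
  have "sin (pi * a) = cos (pi / 2 * x)"
    unfolding a_def by (simp add: cos_sin_eq[of "pi / 2 * x"] sin_cos_eq add_divide_distrib ring_distribs)
  then show "integral {0<..} (\<lambda>t. t powr x / (1 + t\<^sup>2)) = (pi / 2) / cos (pi / 2 * x)"
    using 2(2) Beta_reflection_real[OF a(1,2)] by (simp only: integral_mult_right)
qed

lemma borel_measurable_inverse_sq_plus_sq:
  "(\<lambda>t::real. 1 / (w\<^sup>2 + (complex_of_real t)\<^sup>2)) \<in> borel_measurable (lebesgue_on S)"
  by (intro measurable_restrict_space1 measurable_completion) simp

lemma integrable_powr_over_sq_plus_sq: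
  assumes x: "-1 < x" "x < 1" and w: "Re w > 0"
  shows "(\<lambda>t. of_real (t powr x) / (w\<^sup>2 + (complex_of_real t)\<^sup>2)) integrable_on {0<..}"
    and "(\<lambda>t. t powr x / norm (w\<^sup>2 + (complex_of_real t)\<^sup>2)) integrable_on {0<..}"
proof -
  obtain c where c: "c > 0" "\<And>t. t \<ge> 0 \<Longrightarrow> c * (1 + t\<^sup>2) \<le> norm (w\<^sup>2 + (complex_of_real t)\<^sup>2)"
    using norm_sq_plus_sq_lower_bound_single[OF w] by blast
  have i: "(\<lambda>t. 1 / c * (t powr x / (1 + t\<^sup>2))) integrable_on {0<..}"
    using integral_powr_over_one_plus_sq(1)[OF x] by (intro integrable_on_mult_right) (simp add: absolutely_integrable_on_def)
  have pos: "1 + t\<^sup>2 > 0" for t :: real by (intro add_pos_nonneg) auto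
  have b: "t powr x / norm (w\<^sup>2 + (complex_of_real t)\<^sup>2) \<le> 1 / c * (t powr x / (1 + t\<^sup>2))" if "t \<in> {0<..}" for t
  proof -
    have "0 < c * (1 + t\<^sup>2)" using c(1) pos[of t] by simp
    moreover have "c * (1 + t\<^sup>2) \<le> norm (w\<^sup>2 + (complex_of_real t)\<^sup>2)" using c(2) that by simp
    moreover from calculation have "0 < norm (w\<^sup>2 + (complex_of_real t)\<^sup>2)" by (rule less_le_trans)
    ultimately have "t powr x / norm (w\<^sup>2 + (complex_of_real t)\<^sup>2) \<le> t powr x / (c * (1 + t\<^sup>2))"
      by (intro divide_left_mono mult_pos_pos[of "norm _"] powr_ge_zero)
    then show ?thesis by simp
  qed
  have m: "(\<lambda>t. of_real (t powr x) / (w\<^sup>2 + (complex_of_real t)\<^sup>2)) \<in> borel_measurable (lebesgue_on {0<..})"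
    by (intro measurable_restrict_space1 measurable_completion) simp
  show "(\<lambda>t. of_real (t powr x) / (w\<^sup>2 + (complex_of_real t)\<^sup>2)) integrable_on {0<..}"
    by (rule measurable_bounded_by_integrable_imp_integrable[OF m i]) (use b in \<open>auto simp: norm_divide\<close>)
  have m': "(\<lambda>t. t powr x / norm (w\<^sup>2 + (complex_of_real t)\<^sup>2)) \<in> borel_measurable (lebesgue_on {0<..})"
    by (intro measurable_restrict_space1 measurable_completion) simp
  show "(\<lambda>t. t powr x / norm (w\<^sup>2 + (complex_of_real t)\<^sup>2)) integrable_on {0<..}"
    by (rule measurable_bounded_by_integrable_imp_integrable_real[OF m' i]) (use b in auto)
qed

text \<open>The integrand \<open>g w t = w powr (1 - x) * t powr x / (w\<^sup>2 + t\<^sup>2)\<close> is homogeneous of degree \<open>-1\<close>,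
  so \<open>w \<partial>\<^sub>w g = - \<partial>\<^sub>t (t g)\<close>: the \<open>w\<close>-derivative of a truncated integral is a boundary term.\<close>

lemma truncated_powr_integral_deriv:
  fixes x :: real and U :: "complex set"
  assumes U: "convex U" "\<And>w. w \<in> U \<Longrightarrow> Re w > 0" and w: "w \<in> U" and \<epsilon>: "0 < \<epsilon>" "\<epsilon> \<le> T"
  defines "g \<equiv> \<lambda>w t. w powr of_real (1 - x) * (of_real (t powr x) / (w\<^sup>2 + (complex_of_real t)\<^sup>2))"
  shows "((\<lambda>w. integral {\<epsilon>..T} (g w)) has_field_derivative
      - (1 / w) * (of_real T * g w T - of_real \<epsilon> * g w \<epsilon>)) (at w within U)"
proof -
  \<comment> \<open>Closed form of the w-derivative of \<open>g\<close>; the same expression appears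
    below as the t-derivative of -(t g)/w.\<close>
  define g' where "g' w t = w powr of_real (- x) * of_real (t powr x) *
      (of_real (1 - x) * (of_real t)\<^sup>2 - of_real (1 + x) * w\<^sup>2) / (w\<^sup>2 + (complex_of_real t)\<^sup>2)\<^sup>2"
    for w :: complex and t :: real
  have nz: "w\<^sup>2 + (complex_of_real t)\<^sup>2 \<noteq> 0" if "w \<in> U" "t \<in> {\<epsilon>..T}" for w t
    using sq_plus_sq_nonzero[OF U(2)[OF that(1)], of t] that \<epsilon> by auto
  have nr: "w \<notin> \<real>\<^sub>\<le>\<^sub>0" "w \<noteq> 0" if "w \<in> U" for w
    using U(2)[OF that] by (auto simp: complex_nonpos_Reals_iff)
  have pw: "w powr of_real (1 - x) = w * w powr of_real (- x)" if "w \<in> U" for w :: complex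
    using powr_add[of w 1 "of_real (- x)"] nr[OF that] by simp
  have der_w: "((\<lambda>w. g w t) has_field_derivative g' w t) (at w within U)" if "w \<in> U" "t \<in> {\<epsilon>..T}" for w t
  proof -
    have 1: "((\<lambda>w. w powr of_real (1 - x)) has_field_derivative of_real (1 - x) * w powr of_real (- x)) (at w)"
      using has_field_derivative_powr[OF nr(1)[OF that(1)], of "of_real (1 - x)"] by simp
    have 2: "((\<lambda>w. of_real (t powr x) / (w\<^sup>2 + (complex_of_real t)\<^sup>2)) has_field_derivative
        - (of_real (t powr x) * (2 * w)) / (w\<^sup>2 + (complex_of_real t)\<^sup>2)\<^sup>2) (at w)"
      using nz[OF that] by (auto intro!: derivative_eq_intros simp: power2_eq_square)
    have "((\<lambda>w. g w t) has_field_derivative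
       of_real (1 - x) * w powr of_real (- x) * (of_real (t powr x) / (w\<^sup>2 + (complex_of_real t)\<^sup>2)) +
       (- (of_real (t powr x) * (2 * w)) / (w\<^sup>2 + (complex_of_real t)\<^sup>2)\<^sup>2) * w powr of_real (1 - x)) (at w)"
      unfolding g_def by (rule DERIV_mult[OF 1 2])
    moreover have "of_real (1 - x) * w powr of_real (- x) * (of_real (t powr x) / (w\<^sup>2 + (complex_of_real t)\<^sup>2)) +
       (- (of_real (t powr x) * (2 * w)) / (w\<^sup>2 + (complex_of_real t)\<^sup>2)\<^sup>2) * w powr of_real (1 - x) = g' w t"
    proof -
      have "X * P * (Q / D) + (- (Q * (2 * w)) / D\<^sup>2) * (w * P) = P * Q * (X * D - 2 * w\<^sup>2) / D\<^sup>2"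
        if "D \<noteq> 0" for X P Q D :: complex
        using that by (simp add: field_simps power2_eq_square)
      moreover have "of_real (1 - x) * (w\<^sup>2 + (complex_of_real t)\<^sup>2) - 2 * w\<^sup>2 =
          of_real (1 - x) * (of_real t)\<^sup>2 - of_real (1 + x) * w\<^sup>2"
        by (simp add: algebra_simps)
      ultimately show ?thesis
        unfolding g'_def pw[OF that(1)] using nz[OF that] by simp
    qed
    ultimately show ?thesis by (simp add: has_field_derivative_at_within)
  qed
  have cont_g: "continuous_on {\<epsilon>..T} (g w)" if "w \<in> U" for w
    unfolding g_def using nz[OF that] \<epsilon> by (intro continuous_intros) auto
  have cont_g': "continuous_on (U \<times> cbox \<epsilon> T) (\<lambda>(w, t). g' w t)"
    unfolding g'_def case_prod_unfold using nz nr \<epsilon>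
    by (intro continuous_intros) (auto simp: complex_nonpos_Reals_iff dest: U(2))
  have leib: "((\<lambda>w. integral (cbox \<epsilon> T) (g w)) has_field_derivative integral (cbox \<epsilon> T) (g' w)) (at w within U)"
    by (rule leibniz_rule_field_derivative[OF _ _ cont_g' w U(1)])
      (use der_w cont_g in \<open>auto intro: integrable_continuous_interval\<close>)
  have "((\<lambda>t. - (1 / w) * (of_real t * g w t)) has_vector_derivative g' w t) (at t within {\<epsilon>..T})" if t: "t \<in> {\<epsilon>..T}" for t
  proof -
    have t0: "t > 0" using t \<epsilon> by auto
    have p: "((\<lambda>t. t powr (x + 1)) has_real_derivative (x + 1) * t powr x) (at t)"
      using has_real_derivative_powr[OF t0, of "x + 1"] by simp
    have p': "((\<lambda>t. complex_of_real (t powr (x + 1))) has_vector_derivative of_real ((x + 1) * t powr x)) (at t)"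
      using has_vector_derivative_of_real[OF p] by simp
    have q: "((\<lambda>t. w\<^sup>2 + (complex_of_real t)\<^sup>2) has_vector_derivative 2 * of_real t) (at t)"
    proof -
      have "((\<lambda>t. t\<^sup>2) has_real_derivative 2 * t) (at t)" by (auto intro!: derivative_eq_intros)
      from has_vector_derivative_of_real[OF this]
      show ?thesis by (auto intro!: derivative_eq_intros)
    qed
    have r: "((\<lambda>t. inverse (w\<^sup>2 + (complex_of_real t)\<^sup>2)) has_vector_derivative
        2 * of_real t * (- inverse ((w\<^sup>2 + (complex_of_real t)\<^sup>2)\<^sup>2))) (at t)"
    proof -
      have "(inverse has_field_derivative - inverse ((w\<^sup>2 + (complex_of_real t)\<^sup>2)\<^sup>2)) (at (w\<^sup>2 + (complex_of_real t)\<^sup>2))"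
        using DERIV_inverse[OF nz[OF w t]] by (simp add: power2_eq_square numeral_2_eq_2)
      from field_vector_diff_chain_at[OF q this] show ?thesis by (simp add: o_def)
    qed
    have "((\<lambda>t. - (1 / w) * (w powr of_real (1 - x) * (of_real (t powr (x + 1)) * inverse (w\<^sup>2 + (complex_of_real t)\<^sup>2))))
        has_vector_derivative - (1 / w) * (w powr of_real (1 - x) *
         (of_real (t powr (x + 1)) * (2 * of_real t * (- inverse ((w\<^sup>2 + (complex_of_real t)\<^sup>2)\<^sup>2)))
          + of_real ((x + 1) * t powr x) * inverse (w\<^sup>2 + (complex_of_real t)\<^sup>2)))) (at t)"
      by (intro has_vector_derivative_mult_right has_vector_derivative_mult p' r)
    moreover have "- (1 / w) * (w powr of_real (1 - x) *
         (of_real (t powr (x + 1)) * (2 * of_real t * (- inverse ((w\<^sup>2 + (complex_of_real t)\<^sup>2)\<^sup>2)))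
          + of_real ((x + 1) * t powr x) * inverse (w\<^sup>2 + (complex_of_real t)\<^sup>2))) = g' w t"
    proof -
      have tp: "t powr (x + 1) = t * t powr x" using t0 by (simp add: powr_add)
      have key: "- (1 / w) * (w * P * (s * Q * (2 * s * (- inverse (D\<^sup>2))) + X * Q * inverse D)) =
          P * Q * (2 * s\<^sup>2 - X * D) / D\<^sup>2" if "D \<noteq> 0" for X P Q D s :: complex
        using that nr(2)[OF w] by (simp add: field_simps power2_eq_square)
      have eq: "2 * (of_real t)\<^sup>2 - of_real (x + 1) * (w\<^sup>2 + (complex_of_real t)\<^sup>2) =
          of_real (1 - x) * (of_real t)\<^sup>2 - of_real (1 + x) * w\<^sup>2"
        by (simp add: algebra_simps)
      show ?thesis
        unfolding g'_def pw[OF w] tp of_real_mult key[OF nz[OF w t]] eq ..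
    qed
    ultimately have "((\<lambda>t. - (1 / w) * (w powr of_real (1 - x) * (of_real (t powr (x + 1)) * inverse (w\<^sup>2 + (complex_of_real t)\<^sup>2))))
        has_vector_derivative g' w t) (at t within {\<epsilon>..T})"
      by (simp add: has_vector_derivative_at_within)
    then show ?thesis
    proof (rule has_vector_derivative_transform[OF t, rotated])
      fix s assume "s \<in> {\<epsilon>..T}"
      then have "s powr (x + 1) = s * s powr x" using \<epsilon> by (simp add: powr_add)
      then show "- (1 / w) * (of_real s * g w s) = - (1 / w) * (w powr of_real (1 - x) * (of_real (s powr (x + 1)) * inverse (w\<^sup>2 + (complex_of_real s)\<^sup>2)))"
        by (simp add: g_def divide_inverse mult_ac)
    qed
  qed
  from fundamental_theorem_of_calculus[OF \<epsilon>(2) this]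
  have "integral {\<epsilon>..T} (g' w) = - (1 / w) * (of_real T * g w T) - - (1 / w) * (of_real \<epsilon> * g w \<epsilon>)"
    by (simp add: integral_unique)
  with leib show ?thesis by (simp add: algebra_simps)
qed

lemma truncated_integrals_tendsto:
  fixes f :: "real \<Rightarrow> complex"
  assumes f: "f integrable_on {0<..}" and n: "(\<lambda>t. norm (f t)) integrable_on {0<..}"
  shows "(\<lambda>N. integral {1 / real (Suc N)..real (Suc N)} f) \<longlonglongrightarrow> integral {0<..} f"
proof -
  let ?F = "\<lambda>N t. if t \<in> {1 / real (Suc N)..real (Suc N)} then f t else 0"
  have sub: "{1 / real (Suc N)..real (Suc N)} \<inter> {0<..} = {1 / real (Suc N)..real (Suc N)}" for N
    by (auto simp del: of_nat_Suc intro: less_le_trans[of 0 "1 / real (Suc N)"])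
  have "(\<lambda>N. integral {0<..} (?F N)) \<longlonglongrightarrow> integral {0<..} f"
  proof (rule dominated_convergence(2)[OF _ n])
    show "?F N integrable_on {0<..}" for N
      unfolding integrable_restrict_Int sub
      by (rule integrable_on_subinterval[OF f]) (auto simp del: of_nat_Suc intro: less_le_trans[of 0 "1 / real (Suc N)"])
    show "norm (?F N t) \<le> norm (f t)" for N t by simp
    fix t :: real assume t: "t \<in> {0<..}"
    obtain M :: nat where M: "real M \<ge> max t (1 / t)" using real_arch_simple by blast
    have "?F N t = f t" if "N \<ge> M" for N
    proof -
      have "real (Suc N) \<ge> t" "real (Suc N) \<ge> 1 / t" using M that by auto
      then show ?thesis using t by (simp add: field_simps del: of_nat_Suc)
    qed
    then show "(\<lambda>N. ?F N t) \<longlonglongrightarrow> f t"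
      by (intro tendsto_eventually eventually_sequentiallyI)
  qed
  then show ?thesis unfolding integral_restrict_Int sub .
qed

text \<open>In place of a rotation of the contour, w moves from 1 to \<open>w0\<close> along a
  segment in the right half-plane. The derivative of the truncated, rescaled integral is a boundary
  term that vanishes uniformly as the truncation is removed. Hence w^(1-x) times the integral has
  the same value at \<open>w0\<close> as at 1, where it is known.\<close>

lemma integral_powr_over_sq_plus_sq:
  assumes x: "-1 < x" "x < 1" and w0: "Re w0 > 0"
  shows "integral {0<..} (\<lambda>t. of_real (t powr x) / (w0\<^sup>2 + (complex_of_real t)\<^sup>2)) =
    w0 powr of_real (x - 1) * of_real ((pi / 2) / cos (pi / 2 * x))"
proof -
  define U where "U = closed_segment 1 w0"
  define m where "m = min 1 (Re w0)"
  define M where "M = max 1 (norm w0)"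
  have m: "m > 0" using w0 by (simp add: m_def)
  have Um: "Re w \<ge> m" "norm w \<le> M" if wU: "w \<in> U" for w
  proof -
    have "U \<subseteq> {w. m \<le> Re w} \<inter> cball 0 M" unfolding U_def
      by (intro closed_segment_subset convex_Int convex_halfspace_Re_ge convex_cball) (auto simp: m_def M_def)
    with wU show "Re w \<ge> m" "norm w \<le> M" by auto
  qed
  have U: "convex U" "\<And>w. w \<in> U \<Longrightarrow> Re w > 0" using Um m by (force simp: U_def)+
  have U01: "1 \<in> U" "w0 \<in> U" by (auto simp: U_def)
  obtain c where c: "c > 0" "\<And>w t. w \<in> U \<Longrightarrow> t \<ge> 0 \<Longrightarrow> c * (1 + t\<^sup>2) \<le> norm (w\<^sup>2 + (complex_of_real t)\<^sup>2)"
    using norm_sq_plus_sq_lower_bound[OF m, of M] Um by metis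
  define f where "f w t = of_real (t powr x) / (w\<^sup>2 + (complex_of_real t)\<^sup>2)" for w t
  define g where "g w t = w powr of_real (1 - x) * f w t" for w t
  have pos: "1 + t\<^sup>2 > 0" for t :: real by (intro add_pos_nonneg) auto
  have "continuous_on U (\<lambda>w. 1 / w * w powr of_real (1 - x))"
    by (intro continuous_intros) (auto simp: complex_nonpos_Reals_iff dest: U(2))
  then have "bounded ((\<lambda>w. 1 / w * w powr of_real (1 - x)) ` U)"
    by (intro compact_imp_bounded compact_continuous_image) (auto simp: U_def)
  then obtain K where K: "\<And>w. w \<in> U \<Longrightarrow> norm (1 / w * w powr of_real (1 - x)) \<le> K"
    unfolding bounded_iff by blast
  have K0: "K \<ge> 0" using K[OF U01(1)] norm_ge_zero order_trans by blast
  have fb: "norm (of_real t * f w t) \<le> t powr (x + 1) / (c * (1 + t\<^sup>2))" if "w \<in> U" "t > 0" for w t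
  proof -
    have "0 < c * (1 + t\<^sup>2)" using c(1) pos[of t] by simp
    have "norm (of_real t * f w t) = t powr (x + 1) / norm (w\<^sup>2 + (complex_of_real t)\<^sup>2)"
      using that by (simp add: f_def norm_mult norm_divide powr_add)
    also have "\<dots> \<le> t powr (x + 1) / (c * (1 + t\<^sup>2))"
      using c(2)[OF that(1), of t] that \<open>0 < c * (1 + t\<^sup>2)\<close>
      by (intro divide_left_mono mult_pos_pos[OF _ \<open>0 < c * (1 + t\<^sup>2)\<close>]) (linarith | simp)+
    finally show ?thesis .
  qed
  \<comment> \<open>A bound for the derivative times the length of the segment. The term from the
    upper endpoint tends to 0 because x < 1, the one from the lower endpoint because x > -1.\<close>
  define E where "E N = (K / c * ((real (Suc N)) powr (x + 1) / (1 + (real (Suc N))\<^sup>2) +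
      (1 / real (Suc N)) powr (x + 1) / (1 + (1 / real (Suc N))\<^sup>2))) * norm (w0 - 1)" for N
  have bd: "norm (integral {1 / real (Suc N)..real (Suc N)} (g w0) - integral {1 / real (Suc N)..real (Suc N)} (g 1)) \<le> E N" for N
  proof -
    let ?T = "real (Suc N)" and ?e = "1 / real (Suc N)"
    have e: "0 < ?e" "?e \<le> ?T" "?T > 0" by (auto simp: field_simps)
    show ?thesis unfolding E_def
    proof (rule field_differentiable_bound[OF U(1) _ _ U01(2,1)])
      fix w assume w: "w \<in> U"
      show "((\<lambda>w. integral {?e..?T} (g w)) has_field_derivative
          - (1 / w) * (of_real ?T * g w ?T - of_real ?e * g w ?e)) (at w within U)"
        using truncated_powr_integral_deriv[OF U w e(1,2), of x] unfolding g_def f_def .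
      have "- (1 / w) * (of_real ?T * g w ?T - of_real ?e * g w ?e) =
          - ((1 / w * w powr of_real (1 - x)) * (of_real ?T * f w ?T - of_real ?e * f w ?e))"
        by (simp add: g_def algebra_simps del: of_nat_Suc)
      also have "norm \<dots> \<le> K * (?T powr (x + 1) / (c * (1 + ?T\<^sup>2)) + ?e powr (x + 1) / (c * (1 + ?e\<^sup>2)))"
        unfolding norm_minus_cancel norm_mult[of "1 / w * w powr of_real (1 - x)"]
        by (intro mult_mono K w order_trans[OF norm_triangle_ineq4] add_mono fb e K0 norm_ge_zero)
      also have "\<dots> = K / c * (?T powr (x + 1) / (1 + ?T\<^sup>2) + ?e powr (x + 1) / (1 + ?e\<^sup>2))"
        using c(1) by (simp add: ring_distribs del: of_nat_Suc)
      finally show "norm (- (1 / w) * (of_real ?T * g w ?T - of_real ?e * g w ?e)) \<le> \<dots>" .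
    qed
  qed
  have N: "filterlim (\<lambda>N. real (Suc N)) at_top sequentially"
    by (intro filterlim_compose[OF filterlim_real_sequentially] filterlim_Suc)
  have "((\<lambda>y. y powr (x + 1) / (1 + y\<^sup>2)) \<longlongrightarrow> 0) at_top" using x by real_asymp
  from filterlim_compose[OF this N]
  have N1: "(\<lambda>N. (real (Suc N)) powr (x + 1) / (1 + (real (Suc N))\<^sup>2)) \<longlonglongrightarrow> 0" .
  have "((\<lambda>y. (1 / y) powr (x + 1) / (1 + (1 / y)\<^sup>2)) \<longlongrightarrow> 0) at_top" using x by real_asymp
  from filterlim_compose[OF this N]
  have N2: "(\<lambda>N. (1 / real (Suc N)) powr (x + 1) / (1 + (1 / real (Suc N))\<^sup>2)) \<longlonglongrightarrow> 0" .
  have "E \<longlonglongrightarrow> (K / c * (0 + 0)) * norm (w0 - 1)"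
    unfolding E_def by (intro tendsto_intros N1 N2)
  then have E: "E \<longlonglongrightarrow> 0" by simp
  have lim: "(\<lambda>N. integral {1 / real (Suc N)..real (Suc N)} (g w)) \<longlonglongrightarrow> w powr of_real (1 - x) * integral {0<..} (f w)"
    if w: "Re w > 0" for w
  proof -
    have "(\<lambda>N. integral {1 / real (Suc N)..real (Suc N)} (f w)) \<longlonglongrightarrow> integral {0<..} (f w)"
    proof (rule truncated_integrals_tendsto)
      show "f w integrable_on {0<..}" using integrable_powr_over_sq_plus_sq(1)[OF x w] by (simp add: f_def[abs_def])
      show "(\<lambda>t. norm (f w t)) integrable_on {0<..}"
        using integrable_powr_over_sq_plus_sq(2)[OF x w] by (simp add: f_def[abs_def] norm_divide)
    qed
    then have "(\<lambda>N. w powr of_real (1 - x) * integral {1 / real (Suc N)..real (Suc N)} (f w)) \<longlonglongrightarrow> w powr of_real (1 - x) * integral {0<..} (f w)"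
      by (intro tendsto_intros)
    then show ?thesis by (simp add: g_def[abs_def])
  qed
  have "(\<lambda>N. integral {1 / real (Suc N)..real (Suc N)} (g w0) - integral {1 / real (Suc N)..real (Suc N)} (g 1)) \<longlonglongrightarrow> 0"
    by (rule Lim_null_comparison[OF _ E]) (use bd in auto)
  moreover have "(\<lambda>N. integral {1 / real (Suc N)..real (Suc N)} (g w0) - integral {1 / real (Suc N)..real (Suc N)} (g 1)) \<longlonglongrightarrow>
      w0 powr of_real (1 - x) * integral {0<..} (f w0) - 1 powr of_real (1 - x) * integral {0<..} (f 1)"
    by (intro tendsto_diff lim w0) simp
  ultimately have eq: "w0 powr of_real (1 - x) * integral {0<..} (f w0) = integral {0<..} (f 1)"
    using LIMSEQ_unique by fastforce
  have "integral {0<..} (f 1) = of_real ((pi / 2) / cos (pi / 2 * x))"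
  proof -
    have "((\<lambda>t. t powr x / (1 + t\<^sup>2)) has_integral (pi / 2) / cos (pi / 2 * x)) {0<..}"
      using integral_powr_over_one_plus_sq[OF x] by (simp add: absolutely_integrable_on_def has_integral_iff)
    from has_integral_linear[OF this bounded_linear_of_real[where 'a=complex]]
    show ?thesis by (simp add: f_def[abs_def] o_def integral_unique)
  qed
  moreover have "w0 powr of_real (x - 1) * w0 powr of_real (1 - x) = 1"
    using w0 by (subst powr_add[symmetric]) auto
  ultimately show ?thesis
    using eq unfolding f_def[abs_def] by (metis (no_types, lifting) mult.assoc mult_1)
qed

subsection \<open>Generating functions\<close>

text \<open>Expand t^x = exp(x ln t). The partial sums are dominated by exp(\<delta> |ln t|) \<le>
  t^\<delta> + t^(-\<delta>), so summation and integration may be exchanged.\<close>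

lemma ln_power_generating_function:
  fixes \<phi> :: "real \<Rightarrow> complex"
  assumes S: "S \<in> sets lebesgue" "S \<subseteq> {0<..}" and meas: "\<phi> \<in> borel_measurable (lebesgue_on S)"
    and \<delta>: "\<delta> > 0" and int: "(\<lambda>t. (t powr \<delta> + t powr (- \<delta>)) * norm (\<phi> t)) integrable_on S"
  shows "\<And>m. (\<lambda>t. of_real (ln t) ^ m * \<phi> t) integrable_on S"
    and "\<And>x. \<bar>x\<bar> \<le> \<delta> \<Longrightarrow> (\<lambda>m. integral S (\<lambda>t. of_real (ln t) ^ m * \<phi> t) / fact m * of_real x ^ m)
      sums integral S (\<lambda>t. of_real (t powr x) * \<phi> t)"
proof -
  show ln_int: "(\<lambda>t. of_real (ln t) ^ m * \<phi> t) integrable_on S" for m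
  proof (rule measurable_bounded_by_integrable_imp_integrable[OF _ integrable_on_mult_right[OF int] _ S(1)])
    show "(\<lambda>t. of_real (ln t) ^ m * \<phi> t) \<in> borel_measurable (lebesgue_on S)"
      by (intro borel_measurable_times borel_measurable_ln_power meas)
    show "norm (of_real (ln t) ^ m * \<phi> t) \<le> fact m / \<delta> ^ m * ((t powr \<delta> + t powr (- \<delta>)) * norm (\<phi> t))"
      if "t \<in> S" for t
      using mult_right_mono[OF abs_ln_power_le[OF _ \<delta>, of t m] norm_ge_zero[of "\<phi> t"]] that S(2)
      by (auto simp: norm_mult norm_power mult.assoc)
  qed
  fix x :: real assume x: "\<bar>x\<bar> \<le> \<delta>"
  define f where "f k t = (\<Sum>m<k. of_real ((x * ln t) ^ m / fact m)) * \<phi> t" for k t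
  have feq: "f k = (\<lambda>t. \<Sum>m<k. (of_real x ^ m / fact m) * (of_real (ln t) ^ m * \<phi> t))" for k
    unfolding f_def sum_distrib_right by (intro ext sum.cong refl) (simp add: power_mult_distrib mult_ac)
  have fint: "f k integrable_on S" for k
    unfolding feq by (intro integrable_sum integrable_on_mult_right ln_int) auto
  have "(\<lambda>k. integral S (f k)) \<longlonglongrightarrow> integral S (\<lambda>t. of_real (t powr x) * \<phi> t)"
  proof (rule dominated_convergence(2)[OF fint int])
    fix k t assume t: "t \<in> S"
    then have t0: "t > 0" using S by auto
    have "norm (\<Sum>m<k. complex_of_real ((x * ln t) ^ m / fact m)) \<le> (\<Sum>m<k. \<bar>x * ln t\<bar> ^ m / fact m)"
      by (rule order_trans[OF norm_sum]) (simp add: norm_divide norm_power norm_mult abs_mult)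
    also have "\<dots> \<le> exp \<bar>x * ln t\<bar>"
    proof -
      have "(\<lambda>m. \<bar>x * ln t\<bar> ^ m / fact m) sums exp \<bar>x * ln t\<bar>"
        using exp_converges[of "\<bar>x * ln t\<bar>"] by (simp add: divide_inverse mult.commute)
      then show ?thesis
        using sum_le_suminf[of "\<lambda>m. \<bar>x * ln t\<bar> ^ m / fact m" "{..<k}"] by (simp add: sums_iff)
    qed
    also have "\<dots> \<le> exp (\<delta> * \<bar>ln t\<bar>)" using x by (simp add: abs_mult mult_right_mono)
    also have "\<dots> \<le> t powr \<delta> + t powr (- \<delta>)"
      using t0 by (cases "ln t \<ge> 0") (auto simp: powr_def)
    finally show "norm (f k t) \<le> (t powr \<delta> + t powr (- \<delta>)) * norm (\<phi> t)"
      unfolding f_def norm_mult by (intro mult_right_mono) auto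
  next
    fix t assume t: "t \<in> S"
    then have t0: "t > 0" using S by auto
    have "(\<lambda>m. (x * ln t) ^ m / fact m) sums exp (x * ln t)"
      using exp_converges[of "x * ln t"] by (simp add: divide_inverse mult.commute)
    then have "(\<lambda>m. complex_of_real ((x * ln t) ^ m / fact m)) sums of_real (t powr x)"
      using t0 by (subst sums_of_real_iff) (simp add: powr_def)
    then show "(\<lambda>k. f k t) \<longlonglongrightarrow> of_real (t powr x) * \<phi> t"
      unfolding f_def sums_def by (intro tendsto_intros)
  qed
  moreover have "integral S (f k) = (\<Sum>m<k. integral S (\<lambda>t. of_real (ln t) ^ m * \<phi> t) / fact m * of_real x ^ m)" for k
    unfolding feq by (subst integral_sum) (auto intro!: integrable_on_mult_right ln_int sum.cong)
  ultimately show "(\<lambda>m. integral S (\<lambda>t. of_real (ln t) ^ m * \<phi> t) / fact m * of_real x ^ m)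
      sums integral S (\<lambda>t. of_real (t powr x) * \<phi> t)"
    by (simp add: sums_def)
qed

text \<open>The sums are known only at small positive reals, where the integrals converge. This
  suffices: a nonzero difference of power series has no zeros in a punctured neighbourhood of
  0.\<close>

lemma has_fps_expansion_coeff_unique:
  fixes f :: "complex \<Rightarrow> complex"
  assumes f: "f has_fps_expansion F" and \<delta>: "\<delta> > 0"
    and a: "\<And>x. 0 < x \<Longrightarrow> x < \<delta> \<Longrightarrow> (\<lambda>n. a n * of_real x ^ n) sums f (of_real x)"
  shows "a n = fps_nth F n"
proof -
  define G where "G = Abs_fps a"
  have "summable (\<lambda>n. a n * of_real (\<delta> / 2) ^ n)" using a[of "\<delta> / 2"] \<delta> by (auto simp: sums_iff)
  from conv_radius_geI[OF this] have r: "fps_conv_radius G \<ge> ereal (\<delta> / 2)"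
    using \<delta> by (simp add: fps_conv_radius_def G_def)
  then have r0: "fps_conv_radius G > 0" using \<delta> by (intro less_le_trans[OF _ r]) auto
  have G: "eval_fps G has_fps_expansion G" using r0 by (auto simp: has_fps_expansion_def)
  have "(\<lambda>z. eval_fps G z - f z) has_fps_expansion (G - F)" by (intro fps_expansion_intros G f)
  then have L: "(\<lambda>z. eval_fps G z - f z) has_laurent_expansion fps_to_fls (G - F)"
    by (simp add: has_fps_expansion_to_laurent)
  have "G - F = 0"
  proof (rule ccontr)
    assume "G - F \<noteq> 0"
    then have "eventually (\<lambda>z. eval_fps G z - f z \<noteq> 0) (at 0)"
      using has_laurent_expansion_nonzero_imp_eventually_nonzero[OF L] by simp
    then obtain e where e: "e > 0" "\<And>z. z \<noteq> 0 \<Longrightarrow> norm z < e \<Longrightarrow> eval_fps G z \<noteq> f z"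
      unfolding eventually_at by (auto simp: dist_norm)
    define x where "x = min (e / 2) (\<delta> / 4)"
    have x: "0 < x" "x < e" "x < \<delta> / 2" using e \<delta> by (auto simp: x_def)
    have "ereal (norm (complex_of_real x)) < fps_conv_radius G"
      using x by (intro less_le_trans[OF _ r]) auto
    from sums_eval_fps[OF this] a[of x] x have "eval_fps G (of_real x) = f (of_real x)"
      by (auto simp: G_def dest: sums_unique2)
    with e(2)[of "of_real x"] x show False by auto
  qed
  then show ?thesis by (auto simp: G_def)
qed

subsection \<open>Euler and Bernoulli numbers\<close>

text \<open>Transports identities between real power series to the complex series obtained by
  substituting c z for z.\<close>

lemma fps_rescale_mult:
  fixes c :: "'a::real_field"
  shows "Abs_fps (\<lambda>n. c ^ n * of_real (r n)) * Abs_fps (\<lambda>n. c ^ n * of_real (s n)) =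
    Abs_fps (\<lambda>n. c ^ n * (of_real (\<Sum>i=0..n. r i * s (n - i)) :: 'a))"
proof (rule fps_ext)
  fix n
  have "(\<Sum>i=0..n. c ^ i * of_real (r i) * (c ^ (n - i) * of_real (s (n - i)))) =
      (\<Sum>i=0..n. c ^ n * (of_real (r i * s (n - i)) :: 'a))"
    by (intro sum.cong refl) (auto simp: mult_ac power_add[symmetric] mult.left_commute)
  then show "fps_nth (Abs_fps (\<lambda>n. c ^ n * of_real (r n)) * Abs_fps (\<lambda>n. c ^ n * of_real (s n))) n =
      fps_nth (Abs_fps (\<lambda>n. c ^ n * (of_real (\<Sum>i=0..n. r i * s (n - i)) :: 'a))) n"
    by (simp add: fps_mult_nth sum_distrib_left)
qed

definition sec_coeff :: "nat \<Rightarrow> real" where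
  "sec_coeff n = fps_nth (inverse (fps_cos 1)) n"

lemma inverse_fps_cos:
  "inverse (fps_cos (c::'a::real_field)) = Abs_fps (\<lambda>n. c ^ n * of_real (sec_coeff n))"
proof -
  have "inverse (fps_cos 1) * fps_cos (1::real) = 1" by (rule inverse_mult_eq_1) simp
  then have one: "(\<Sum>i=0..n. sec_coeff i * fps_nth (fps_cos 1) (n - i)) = (if n = 0 then 1 else 0)" for n
  proof -
    have "fps_nth (inverse (fps_cos 1) * fps_cos (1::real)) n = (if n = 0 then 1 else 0)"
      using \<open>_ = 1\<close> by simp
    then show ?thesis by (simp only: fps_mult_nth sec_coeff_def)
  qed
  have eq: "fps_cos c = Abs_fps (\<lambda>n. c ^ n * of_real (fps_nth (fps_cos 1) n))"
    by (rule fps_ext) (simp add: fps_cos_def)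
  have "Abs_fps (\<lambda>n. c ^ n * of_real (sec_coeff n)) * fps_cos c =
      Abs_fps (\<lambda>n. c ^ n * (of_real (\<Sum>i=0..n. sec_coeff i * fps_nth (fps_cos 1) (n - i)) :: 'a))"
    by (subst eq) (rule fps_rescale_mult)
  also have "\<dots> = 1" unfolding one by (rule fps_ext) auto
  finally show ?thesis by (metis fps_inverse_unique mult.commute)
qed

lemma sec_coeff_odd: "odd n \<Longrightarrow> sec_coeff n = 0"
proof -
  assume n: "odd n"
  have "inverse (fps_cos (-1::real)) = inverse (fps_cos 1)" by (simp add: fps_cos_odd)
  then have "fps_nth (inverse (fps_cos (-1::real))) n = sec_coeff n" by (simp add: sec_coeff_def)
  then show "sec_coeff n = 0" using n by (simp add: inverse_fps_cos)
qed

lemma euler_num_even: "euler_num (2 * j) = (-1) ^ j * fact (2 * j) * sec_coeff (2 * j)"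
  by (simp add: euler_num_def sec_coeff_def)

definition bernoulli_coeff :: "nat \<Rightarrow> real" where
  "bernoulli_coeff n = fps_nth (fps_X / (fps_exp 1 - 1)) n"

text \<open>Stated as a product because exp(y z) - 1 has constant coefficient 0 and no inverse power
  series.\<close>

lemma rescaled_bernoulli_fps:
  "Abs_fps (\<lambda>n. y ^ n * (of_real (bernoulli_coeff n)::complex)) * (fps_exp y - 1) = fps_const y * fps_X"
proof -
  let ?E = "fps_exp (1::real) - 1"
  have nz: "?E \<noteq> 0"
  proof
    assume "?E = 0"
    then have "fps_nth ?E 1 = 0" by simp
    then show False by simp
  qed
  have "subdegree ?E \<le> 1" by (rule subdegree_leI) simp
  then have "fps_X / ?E * ?E = fps_X"
    using nz by (intro dvd_div_mult_self) (simp add: fps_dvd_iff)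
  then have one: "(\<Sum>i=0..n. bernoulli_coeff i * fps_nth ?E (n - i)) = (if n = 1 then 1 else 0)" for n
  proof -
    have "fps_nth (fps_X / ?E * ?E) n = (if n = 1 then 1 else 0)"
      unfolding \<open>fps_X / ?E * ?E = fps_X\<close> by simp
    then show ?thesis by (simp only: fps_mult_nth bernoulli_coeff_def)
  qed
  have eq: "fps_exp y - 1 = Abs_fps (\<lambda>n. y ^ n * of_real (fps_nth ?E n))"
    by (rule fps_ext) (simp add: field_simps)
  have "Abs_fps (\<lambda>n. y ^ n * of_real (bernoulli_coeff n)) * (fps_exp y - 1) =
      Abs_fps (\<lambda>n. y ^ n * (of_real (\<Sum>i=0..n. bernoulli_coeff i * fps_nth ?E (n - i)) :: complex))"
    by (subst eq) (rule fps_rescale_mult)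
  also have "\<dots> = fps_const y * fps_X" unfolding one by (rule fps_ext) (auto simp: fps_X_def)
  finally show ?thesis .
qed

text \<open>The expansion of c z / sin(c z). The factor 2 - 2^n results from combining the Bernoulli
  series at argument z and at 2z; it is 1 for n = 0 and removes the coefficient with n = 1.\<close>

definition inv_sinc_fps :: "complex \<Rightarrow> complex fps" where
  "inv_sinc_fps c = Abs_fps (\<lambda>n. (2 - 2 ^ n) * (\<i> * c) ^ n * of_real (bernoulli_coeff n))"

text \<open>\<open>z / sinh z = 2 b(z) - b(2 z)\<close> for \<open>b(z) = z / (exp z - 1)\<close>, taken at \<open>\<i> c z\<close>.\<close>

lemma inv_sinc_fps_mult_sin:
  "inv_sinc_fps c * fps_sin c = fps_const c * fps_X"
proof -
  let ?P = "\<lambda>y. Abs_fps (\<lambda>n. y ^ n * (of_real (bernoulli_coeff n)::complex))"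
  let ?e = "fps_exp (\<i> * c)"
  have T: "inv_sinc_fps c = fps_const 2 * ?P (\<i> * c) - ?P (2 * (\<i> * c))"
    by (rule fps_ext) (simp add: inv_sinc_fps_def power_mult_distrib algebra_simps)
  have e2: "fps_exp (2 * (\<i> * c)) = ?e * ?e"
    by (simp only: mult_2 fps_exp_add_mult)
  have p1: "?P (\<i> * c) * (?e - 1) = fps_const (\<i> * c) * fps_X" by (rule rescaled_bernoulli_fps)
  have p2: "?P (2 * (\<i> * c)) * (?e * ?e - 1) = fps_const (2 * (\<i> * c)) * fps_X"
    using rescaled_bernoulli_fps[of "2 * (\<i> * c)"] by (simp add: e2)
  \<comment> \<open>Splitting E^2 - 1 into (E - 1)(E + 1) for the first series only lets the product
    formula for Bernoulli numbers be applied at both arguments.\<close>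
  have alg: "(A * 2 - B) * (E * E - 1) = 2 * (A * (E - 1)) * (E + 1) - B * (E * E - 1)" for A B E :: "complex fps"
    by (simp add: algebra_simps)
  have "inv_sinc_fps c * (?e * ?e - 1) =
      2 * (?P (\<i> * c) * (?e - 1)) * (?e + 1) - ?P (2 * (\<i> * c)) * (?e * ?e - 1)"
    unfolding T alg[symmetric] by (simp add: numeral_fps_const mult.commute)
  also have "\<dots> = 2 * (fps_const (\<i> * c) * fps_X) * (?e + 1) - 2 * (fps_const (\<i> * c) * fps_X)"
    unfolding p1 p2 by (simp add: numeral_fps_const mult.assoc)
  also have "\<dots> = 2 * (fps_const (\<i> * c) * fps_X) * ?e" by (simp only: distrib_left) simp
  also have "\<dots> = fps_const (2 * \<i>) * ?e * (fps_const c * fps_X)"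
    by (simp add: numeral_fps_const mult_ac flip: fps_const_mult)
  finally have 1: "inv_sinc_fps c * (?e * ?e - 1) = fps_const (2 * \<i>) * ?e * (fps_const c * fps_X)" .
  have s: "?e = fps_cos c + fps_const \<i> * fps_sin c" by (rule fps_exp_ii_sin_cos)
  have "fps_exp (- (\<i> * c)) = fps_cos c - fps_const \<i> * fps_sin c"
    using fps_exp_ii_sin_cos[of "- c"] by (simp add: fps_sin_even fps_cos_odd)
  moreover have "?e * fps_exp (- (\<i> * c)) = 1"
    by (simp add: fps_exp_add_mult[symmetric])
  ultimately have "?e * (fps_cos c - fps_const \<i> * fps_sin c) = 1" by simp
  \<comment> \<open>The power series form of e^(2iu) - 1 = e^(iu) * 2i sin u.\<close>
  then have "?e * ?e - 1 = ?e * (?e - (fps_cos c - fps_const \<i> * fps_sin c))"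
    by (simp only: right_diff_distrib)
  also have "\<dots> = fps_const (2 * \<i>) * ?e * fps_sin c"
  proof -
    have "?e - (fps_cos c - fps_const \<i> * fps_sin c) = fps_const (2 * \<i>) * fps_sin c"
      unfolding s by (simp flip: fps_const_mult add: numeral_fps_const[symmetric])
    then show ?thesis by (simp add: mult_ac)
  qed
  finally have "(fps_const (2 * \<i>) * ?e) * (inv_sinc_fps c * fps_sin c) = (fps_const (2 * \<i>) * ?e) * (fps_const c * fps_X)"
    using 1 by (simp add: mult_ac)
  moreover have "fps_const (2 * \<i>) * ?e \<noteq> 0"
  proof
    assume "fps_const (2 * \<i>) * ?e = 0"
    then have "fps_nth (fps_const (2 * \<i>) * ?e) 0 = 0" by simp
    then show False by simp
  qed
  ultimately show ?thesis by simp
qed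

lemma fps_sin_nonzero: "c \<noteq> 0 \<Longrightarrow> fps_sin (c::complex) \<noteq> 0"
proof
  assume c: "c \<noteq> 0" and "fps_sin c = 0"
  then have "fps_nth (fps_sin c) 1 = 0" by simp
  with c show False by (simp add: fps_sin_def)
qed

lemma inv_sinc_fps_nth_0:
  assumes "c \<noteq> 0"
  shows "fps_nth (inv_sinc_fps c) 0 = 1"
proof -
  have "fps_nth (inv_sinc_fps c * fps_sin c) 1 = c" by (simp add: inv_sinc_fps_mult_sin)
  then have "fps_nth (inv_sinc_fps c) 0 * c = c" by (simp add: fps_mult_nth fps_sin_def)
  with assms show ?thesis by simp
qed

text \<open>Both sides of the product formula change sign under c \<mapsto> -c through the sine and
  the factor c, so cancelling the sine shows that the series is even in c. By its definition,
  however, coefficient n picks up (-1)^n.\<close>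

lemma inv_sinc_fps_nth_odd:
  assumes "odd n"
  shows "fps_nth (inv_sinc_fps c) n = 0"
proof (cases "c = 0")
  case True
  with assms show ?thesis by (auto simp: inv_sinc_fps_def power_0_left elim: oddE)
next
  case False
  have "inv_sinc_fps (- c) * fps_sin (- c) = fps_const (- c) * fps_X" by (rule inv_sinc_fps_mult_sin)
  then have "inv_sinc_fps (- c) * fps_sin c = fps_const c * fps_X"
    by (simp add: fps_sin_even flip: fps_const_neg)
  then have "inv_sinc_fps (- c) = inv_sinc_fps c"
    using inv_sinc_fps_mult_sin[of c] fps_sin_nonzero[OF False] by (metis mult_right_cancel)
  moreover have "fps_nth (inv_sinc_fps (- c)) n = - fps_nth (inv_sinc_fps c) n"
    using assms by (simp add: inv_sinc_fps_def)
  ultimately show ?thesis by simp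
qed

lemma inv_sinc_fps_nth_even:
  "fps_nth (inv_sinc_fps c) (2 * j) = - ((-1) ^ j * (2 ^ (2 * j) - 2) * c ^ (2 * j) * of_real (bernoulli_num (2 * j)) / fact (2 * j))"
proof -
  have 1: "(\<i> * c) ^ (2 * j) = (-1) ^ j * c ^ (2 * j)"
    by (simp only: power_mult_distrib power_mult[of \<i>]) simp
  have 2: "complex_of_real (bernoulli_num (2 * j)) = fact (2 * j) * of_real (bernoulli_coeff (2 * j))"
    by (simp add: bernoulli_num_def bernoulli_coeff_def)
  have "(2 - A) * (S * D) * B = - (S * (A - 2) * D * (F * B) / F)" if "F \<noteq> 0" for A B D F S :: complex
    using that by (simp add: field_simps)
  from this[of "fact (2 * j)"] show ?thesis
    unfolding inv_sinc_fps_def fps_nth_Abs_fps 1 2 by simp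
qed

lemma has_fps_expansion_inv_sinc:
  assumes "c \<noteq> 0"
  shows "(\<lambda>z. if z = 0 then 1 else c * z / sin (c * z)) has_fps_expansion inv_sinc_fps c"
proof -
  have nz: "fps_sin c \<noteq> 0" using fps_sin_nonzero[OF assms] .
  have sd: "subdegree (fps_sin c) = 1"
    by (rule subdegreeI) (use assms in \<open>auto simp: fps_sin_def\<close>)
  have eq: "inv_sinc_fps c = (fps_const c * fps_X) / fps_sin c"
    using inv_sinc_fps_mult_sin[of c] nz by (metis nonzero_mult_div_cancel_right)
  show ?thesis unfolding eq
  proof (rule has_fps_expansion_divide)
    show "(\<lambda>z. c * z) has_fps_expansion fps_const c * fps_X" by (intro fps_expansion_intros)
    show "(\<lambda>z. sin (c * z)) has_fps_expansion fps_sin c" by (intro fps_expansion_intros)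
    show "subdegree (fps_sin c) \<le> subdegree (fps_const c * fps_X)" using assms sd by simp
    show "1 = fps_nth (fps_const c * fps_X) (subdegree (fps_sin c)) / fps_nth (fps_sin c) (subdegree (fps_sin c))"
      unfolding sd using assms by (simp add: fps_sin_def)
  qed fact
qed

section \<open>The Delta terms as Taylor coefficients\<close>

lemma sum_even_indices:
  fixes f :: "nat \<Rightarrow> 'a::comm_monoid_add"
  assumes "\<And>i. odd i \<Longrightarrow> f i = 0"
  shows "(\<Sum>i=0..n. f i) = (\<Sum>j=0..n div 2. f (2 * j))"
proof -
  have "(\<Sum>j=0..n div 2. f (2 * j)) = (\<Sum>i\<in>(\<lambda>j. 2 * j) ` {0..n div 2}. f i)"
    by (subst sum.reindex) (auto simp: inj_on_def)
  also have "\<dots> = (\<Sum>i=0..n. f i)"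
  proof (rule sum.mono_neutral_left)
    show "\<forall>i\<in>{0..n} - (\<lambda>j. 2 * j) ` {0..n div 2}. f i = 0"
    proof
      fix i assume i: "i \<in> {0..n} - (\<lambda>j. 2 * j) ` {0..n div 2}"
      have "odd i"
      proof
        assume "even i"
        then obtain j where "i = 2 * j" by blast
        with i show False by auto
      qed
      then show "f i = 0" by (rule assms)
    qed
  qed auto
  finally show ?thesis by simp
qed

text \<open>The series is that of w^(x-1) (pi/2) / cos(pi x / 2), the value of the power integral.
  The sign (-1)^j in \<open>Delta1\<close> cancels the one in the Euler numbers.\<close>

lemma Delta1_eq_coeff:
  "Delta1 n w = fact n * fps_nth (fps_const (of_real (pi / 2) / w) * (inverse (fps_cos (of_real (pi / 2))) * fps_exp (Ln w))) n"
proof -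
  define F where "F i = of_real (pi / 2) ^ i * of_real (sec_coeff i) * (Ln w ^ (n - i) / fact (n - i))" for i
  have "fps_nth (inverse (fps_cos (of_real (pi / 2))) * fps_exp (Ln w)) n = (\<Sum>i=0..n. F i)"
    by (simp add: fps_mult_nth inverse_fps_cos F_def)
  also have "\<dots> = (\<Sum>j=0..n div 2. F (2 * j))"
    by (rule sum_even_indices) (simp add: F_def sec_coeff_odd)
  finally have 1: "fps_nth (inverse (fps_cos (of_real (pi / 2))) * fps_exp (Ln w)) n = (\<Sum>j=0..n div 2. F (2 * j))" .
  have 2: "(-1) ^ j / (fact (n - 2 * j) * fact (2 * j)) * of_real ((pi / 2) ^ (2 * j + 1)) * of_real (euler_num (2 * j)) * Ln w ^ (n - 2 * j)
      = of_real (pi / 2) * F (2 * j)" for j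
  proof -
    have "(-1::complex) ^ j * (-1) ^ j = 1" by (simp flip: power_mult_distrib)
    then show ?thesis
      unfolding F_def euler_num_even by (simp add: field_simps)
  qed
  show ?thesis
    unfolding Delta1_def 2 fps_mult_left_const_nth 1 by (simp add: sum_distrib_left[symmetric] del: of_real_divide)
qed

text \<open>For k = t the generating function has a simple pole at x = 0; after multiplication by x
  the coefficient of index n + 1 is the relevant one. Index 0 of the sine quotient yields the
  isolated power of the logarithm, the positive even indices yield the Bernoulli sum.\<close>

lemma Delta2_eq_coeff:
  "w * Delta2 n w = - (fact n * fps_nth (inv_sinc_fps (of_real (pi / 2)) * fps_exp (Ln w)) (Suc n))" if "w \<noteq> 0"
proof -
  define F where "F i = fps_nth (inv_sinc_fps (of_real (pi / 2))) i * (Ln w ^ (Suc n - i) / fact (Suc n - i))" for i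
  have "fps_nth (inv_sinc_fps (of_real (pi / 2)) * fps_exp (Ln w)) (Suc n) = (\<Sum>i=0..Suc n. F i)"
    by (simp only: fps_mult_nth fps_exp_nth F_def of_nat_fact)
  also have "\<dots> = (\<Sum>j=0..Suc n div 2. F (2 * j))"
    by (rule sum_even_indices) (simp add: F_def inv_sinc_fps_nth_odd)
  also have "\<dots> = F 0 + (\<Sum>j=1..Suc n div 2. F (2 * j))"
    by (subst sum.atLeast_Suc_atMost) auto
  finally have 1: "fps_nth (inv_sinc_fps (of_real (pi / 2)) * fps_exp (Ln w)) (Suc n) = F 0 + (\<Sum>j=1..Suc n div 2. F (2 * j))" .
  have F0: "fact n * F 0 = Ln w ^ (n + 1) / of_nat (n + 1)"
    using inv_sinc_fps_nth_0[of "of_real (pi / 2)"]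
    by (simp add: F_def divide_simps del: of_nat_Suc power_Suc)
  have 2: "(-1) ^ j * (2 ^ (2 * j) - 2) / (fact (n + 1 - 2 * j) * fact (2 * j)) * of_real ((pi / 2) ^ (2 * j)) *
      of_real (bernoulli_num (2 * j)) * Ln w ^ (n + 1 - 2 * j) = - F (2 * j)" for j
    unfolding F_def inv_sinc_fps_nth_even by (simp add: field_simps)
  show ?thesis
    unfolding Delta2_def 2 1 distrib_left F0 sum_negf using that by (simp add: field_simps del: of_nat_Suc power_Suc)
qed

subsection \<open>Logarithmic moments\<close>

lemma alternating_telescoping_sums:
  fixes b :: "nat \<Rightarrow> complex"
  assumes b: "\<And>s. norm (b s) \<le> C / R ^ (2 * s)" and w: "norm w < R"
  shows "(\<lambda>s. (-1) ^ s * w ^ (2 * s) * (b s + w\<^sup>2 * b (Suc s))) sums b 0"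
proof -
  have R: "R > 0" using w norm_ge_zero[of w] by linarith
  define f where "f s = (-1) ^ s * w ^ (2 * s) * b s" for s
  have "f \<longlonglongrightarrow> 0"
  proof (rule Lim_null_comparison)
    show "eventually (\<lambda>s. norm (f s) \<le> C * ((norm w / R)\<^sup>2) ^ s) sequentially"
    proof (intro always_eventually allI)
      fix s
      have "norm (f s) \<le> norm w ^ (2 * s) * (C / R ^ (2 * s))"
        using mult_left_mono[OF b[of s], of "norm w ^ (2 * s)"] by (simp add: f_def norm_mult norm_power)
      also have "\<dots> = C * ((norm w / R)\<^sup>2) ^ s"
        unfolding power_mult[symmetric] power_divide by simp
      finally show "norm (f s) \<le> C * ((norm w / R)\<^sup>2) ^ s" .
    qed
    have "norm w / R < 1" "0 \<le> norm w / R" using w R by auto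
    then have "(norm w / R)\<^sup>2 < 1" by (simp add: power_less_one_iff)
    then have "(\<lambda>s. ((norm w / R)\<^sup>2) ^ s) \<longlonglongrightarrow> 0" by (intro LIMSEQ_power_zero) simp
    from tendsto_mult[OF tendsto_const[of C] this] show "(\<lambda>s. C * ((norm w / R)\<^sup>2) ^ s) \<longlonglongrightarrow> 0" by simp
  qed
  from telescope_sums'[OF this] have "(\<lambda>s. f s - f (Suc s)) sums f 0" by simp
  moreover have "f s - f (Suc s) = (-1) ^ s * w ^ (2 * s) * (b s + w\<^sup>2 * b (Suc s))" for s
    by (simp add: f_def power2_eq_square algebra_simps)
  moreover have "f 0 = b 0" by (simp add: f_def)
  ultimately show ?thesis by simp
qed

text \<open>Moments are weighted integrals of the quotient \<phi> with the decreasing weights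
  t^(-2s), so their existence follows from that of the Stieltjes integral even when the latter
  converges only conditionally at a.\<close>

lemma tail_moments:
  fixes f :: "real \<Rightarrow> complex"
  assumes R: "ereal R < a" "norm w < R"
    and int: "(\<lambda>t. f t / (w\<^sup>2 + (of_real t)\<^sup>2)) integrable_on upto_ereal R a"
  shows "\<And>s. (\<lambda>t. f t / of_real t ^ (2 * s + 2)) integrable_on upto_ereal R a"
    and "(\<lambda>s. (-1) ^ s * w ^ (2 * s) * integral (upto_ereal R a) (\<lambda>t. f t / of_real t ^ (2 * s + 2)))
      sums integral (upto_ereal R a) (\<lambda>t. f t / (w\<^sup>2 + (of_real t)\<^sup>2))"
proof -
  let ?S = "upto_ereal R a"
  have R0: "R > 0" using R(2) norm_ge_zero[of w] by linarith
  define \<phi> where "\<phi> t = f t / (w\<^sup>2 + (of_real t)\<^sup>2)" for t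
  define b where "b s = integral ?S (\<lambda>t. of_real (1 / t ^ (2 * s)) * \<phi> t)" for s
  obtain C where C: "\<And>g. (\<forall>x y. R \<le> x \<longrightarrow> x \<le> y \<longrightarrow> g y \<le> g x) \<and> (g \<longlongrightarrow> 0) at_top \<longrightarrow>
    (\<lambda>x. of_real (g x) * \<phi> x) integrable_on ?S \<and> norm (integral ?S (\<lambda>x. of_real (g x) * \<phi> x)) \<le> C * g R"
    using decreasing_weight[OF R(1), of \<phi>] int unfolding \<phi>_def by blast
  have w: "(\<lambda>t. of_real (1 / t ^ (2 * s)) * \<phi> t) integrable_on ?S \<and> norm (b s) \<le> max C (norm (b 0)) / R ^ (2 * s)" for s
  \<comment> \<open>For s = 0 the weight is 1 and does not tend to 0. This case is bounded by
    \<open>norm (b 0)\<close> itself, hence the maximum.\<close>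
  proof (cases "s = 0")
    case True
    then show ?thesis using int by (simp add: \<phi>_def[abs_def])
  next
    case False
    have "(\<forall>x y. R \<le> x \<longrightarrow> x \<le> y \<longrightarrow> 1 / y ^ (2 * s) \<le> 1 / x ^ (2 * s)) \<and> ((\<lambda>t. 1 / t ^ (2 * s)) \<longlongrightarrow> (0::real)) at_top"
    proof (intro conjI allI impI)
      show "1 / y ^ (2 * s) \<le> 1 / x ^ (2 * s)" if "R \<le> x" "x \<le> y" for x y
        using that R0 by (intro divide_left_mono power_mono) auto
      show "((\<lambda>t::real. 1 / t ^ (2 * s)) \<longlongrightarrow> 0) at_top"
        using False by (intro tendsto_divide_0[OF tendsto_const] filterlim_at_top_imp_at_infinity filterlim_pow_at_top filterlim_ident) auto
    qed
    with C[of "\<lambda>t. 1 / t ^ (2 * s)"]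
    have "(\<lambda>t. of_real (1 / t ^ (2 * s)) * \<phi> t) integrable_on ?S" "norm (b s) \<le> C * (1 / R ^ (2 * s))"
      unfolding b_def by auto
    moreover have "C * (1 / R ^ (2 * s)) \<le> max C (norm (b 0)) * (1 / R ^ (2 * s))"
      using R0 by (intro mult_right_mono) auto
    ultimately show ?thesis by simp
  qed
  have split: "f t / of_real t ^ (2 * s + 2) = of_real (1 / t ^ (2 * s)) * \<phi> t + w\<^sup>2 * (of_real (1 / t ^ (2 * Suc s)) * \<phi> t)"
    if t: "t \<in> ?S" for t s
  proof -
    have tR: "t \<ge> R" "t > 0" using t R0 by (auto simp: upto_ereal_def)
    have "norm w < norm (complex_of_real t)" using tR R by simp
    then have "norm (w\<^sup>2) < norm ((complex_of_real t)\<^sup>2)"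
      unfolding norm_power by (intro power_strict_mono) auto
    then have nz: "w\<^sup>2 + (of_real t)\<^sup>2 \<noteq> 0"
      by (metis add_eq_0_iff norm_minus_cancel less_irrefl)
    then have "f t = (w\<^sup>2 + (of_real t)\<^sup>2) * \<phi> t" by (simp add: \<phi>_def)
    then show ?thesis using tR by (simp add: field_simps power2_eq_square power_add)
  qed
  have has: "((\<lambda>t. f t / of_real t ^ (2 * s + 2)) has_integral (b s + w\<^sup>2 * b (Suc s))) ?S" for s
  proof (rule has_integral_eq)
    show "((\<lambda>t. of_real (1 / t ^ (2 * s)) * \<phi> t + w\<^sup>2 * (of_real (1 / t ^ (2 * Suc s)) * \<phi> t)) has_integral (b s + w\<^sup>2 * b (Suc s))) ?S"
      unfolding b_def using w by (intro has_integral_add has_integral_mult_right integrable_integral) blast+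
  qed (use split in simp)
  show "(\<lambda>t. f t / of_real t ^ (2 * s + 2)) integrable_on ?S" for s using has by blast
  have "(\<lambda>s. (-1) ^ s * w ^ (2 * s) * (b s + w\<^sup>2 * b (Suc s))) sums b 0"
    using alternating_telescoping_sums[of b _ R w] w R by blast
  moreover have "integral ?S (\<lambda>t. f t / of_real t ^ (2 * s + 2)) = b s + w\<^sup>2 * b (Suc s)" for s
    using has integral_unique by blast
  ultimately show "(\<lambda>s. (-1) ^ s * w ^ (2 * s) * integral ?S (\<lambda>t. f t / of_real t ^ (2 * s + 2)))
      sums integral ?S (\<lambda>t. f t / (w\<^sup>2 + (of_real t)\<^sup>2))"
    by (simp add: b_def \<phi>_def)
qed

section \<open>Convergent tails of ln^n t / t^p\<close>

lemma ln_power_over_power_tendsto_0: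
  "((\<lambda>t::real. ln t ^ m / t ^ Suc q) \<longlongrightarrow> 0) at_top"
proof (rule Lim_null_comparison)
  show "eventually (\<lambda>t. norm (ln t ^ m / t ^ Suc q) \<le> fact m / (1/2) ^ m * ((t powr (1/2) + t powr (- (1/2))) / t)) at_top"
    using eventually_ge_at_top[of 1]
  proof eventually_elim
    case (elim t)
    have "norm (ln t ^ m / t ^ Suc q) \<le> \<bar>ln t\<bar> ^ m / t"
      using elim mult_left_mono[OF one_le_power[of t q], of t]
      by (auto simp: abs_mult power_abs intro!: divide_left_mono)
    also have "\<dots> \<le> (fact m / (1/2) ^ m * (t powr (1/2) + t powr (- (1/2)))) / t"
      using elim by (intro divide_right_mono abs_ln_power_le) auto
    finally show ?case by simp
  qed
  have "((\<lambda>t::real. (t powr (1/2) + t powr (- (1/2))) / t) \<longlongrightarrow> 0) at_top" by real_asymp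
  from tendsto_mult[OF tendsto_const[of "fact m / (1/2) ^ m"] this]
  show "((\<lambda>t::real. fact m / (1/2) ^ m * ((t powr (1/2) + t powr (- (1/2))) / t)) \<longlongrightarrow> 0) at_top" by simp
qed

lemma log_pow_primitive_tendsto_0: "(log_pow_primitive q n \<longlongrightarrow> 0) at_top"
proof (induction n)
  have *: "((\<lambda>t. - (ln t ^ m / (real (Suc q) * t ^ Suc q))) \<longlongrightarrow> 0) at_top" for m
    using tendsto_mult[OF tendsto_const[of "- 1 / real (Suc q)"] ln_power_over_power_tendsto_0[of m q]]
    by (simp add: mult.commute del: of_nat_Suc power_Suc)
  {
    case 0
    show ?case using *[of 0] by simp
  next
    case (Suc n)
    from tendsto_add[OF *[of "Suc n"] tendsto_mult[OF tendsto_const[of "real (Suc n) / real (Suc q)"] Suc.IH]]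
    show ?case by (simp del: of_nat_Suc power_Suc)
  }
qed

text \<open>The primitive vanishes at infinity. So the finite part over [0, R] and the tail over [R,
  \<infinity>) cancel, which turns series of finite parts into tail integrals.\<close>

lemma integral_ln_power_over_power_at_top:
  assumes R: "R > 0" and p: "p \<ge> 2"
  shows "(\<lambda>t. complex_of_real (ln t) ^ n / of_real t ^ p) integrable_on {R..}"
    and "integral {R..} (\<lambda>t. complex_of_real (ln t) ^ n / of_real t ^ p) = - of_real (fp_primitive p n R)"
proof -
  let ?f = "\<lambda>t. complex_of_real (ln t) ^ n / of_real t ^ p"
  let ?h = "\<lambda>t. fact n / (1/2) ^ n * (t powr (1/2 - real p) + t powr (- (1/2) - real p))"
  have h: "?h integrable_on {R..}"
    using has_integral_powr_to_inf[of "1/2 - real p" R] has_integral_powr_to_inf[of "- (1/2) - real p" R] R p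
    by (intro integrable_on_mult_right integrable_add) (auto simp: integrable_on_def)
  have b: "norm (?f t) \<le> ?h t" if "t \<in> {R..}" for t
  proof -
    have t: "t > 0" using that R by simp
    have "norm (?f t) = \<bar>ln t\<bar> ^ n / t ^ p" using t by (simp add: norm_divide norm_power)
    also have "\<dots> \<le> fact n / (1/2) ^ n * (t powr (1/2) + t powr (- (1/2))) / t ^ p"
      using t by (intro divide_right_mono abs_ln_power_le) auto
    also have "\<dots> = ?h t" using t by (simp add: powr_diff powr_realpow add_divide_distrib[symmetric])
    finally show ?thesis .
  qed
  have "?f \<in> borel_measurable (lebesgue_on {R..})"
    by (intro measurable_restrict_space1 measurable_completion) simp
  then show int: "?f integrable_on {R..}"
    by (rule measurable_bounded_by_integrable_imp_integrable[OF _ h b]) auto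
  let ?F = "\<lambda>N t. if t \<in> {R..R + real N} then ?f t else 0"
  have sub: "{R..R + real N} \<inter> {R..} = {R..R + real N}" for N by auto
  have "(\<lambda>N. integral {R..} (?F N)) \<longlonglongrightarrow> integral {R..} ?f"
  proof (rule dominated_convergence(2)[OF _ h])
    show "?F N integrable_on {R..}" for N
      unfolding integrable_restrict_Int sub by (rule integrable_on_subinterval[OF int]) auto
    show "norm (?F N t) \<le> ?h t" if "t \<in> {R..}" for N t
      using b[OF that] by (auto intro: order_trans[OF norm_ge_zero])
    fix t :: real assume "t \<in> {R..}"
    obtain M :: nat where M: "real M \<ge> t - R" using real_arch_simple by blast
    have "?F N t = ?f t" if "N \<ge> M" for N
    proof -
      have "real N \<ge> real M" using that by simp
      then have "t \<le> R + real N" using M by linarith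
      then show ?thesis using \<open>t \<in> {R..}\<close> by simp
    qed
    then show "(\<lambda>N. ?F N t) \<longlonglongrightarrow> ?f t" by (intro tendsto_eventually eventually_sequentiallyI)
  qed
  then have 1: "(\<lambda>N. integral {R..R + real N} ?f) \<longlonglongrightarrow> integral {R..} ?f"
    unfolding integral_restrict_Int sub .
  have 2: "integral {R..R + real N} ?f = of_real (fp_primitive p n (R + real N) - fp_primitive p n R)" for N
  proof -
    have "((\<lambda>t. ln t ^ n / t ^ p) has_integral (fp_primitive p n (R + real N) - fp_primitive p n R)) {R..R + real N}"
      using R p
      by (intro fundamental_theorem_of_calculus)
        (auto simp flip: has_real_derivative_iff_has_vector_derivative
          intro!: DERIV_subset[OF has_real_derivative_fp_primitive])
    from has_integral_linear[OF this bounded_linear_of_real[where 'a=complex]] show ?thesis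
      by (simp add: o_def integral_unique)
  qed
  have "(fp_primitive p n \<longlongrightarrow> 0) at_top"
    using log_pow_primitive_tendsto_0[of "p - 2" n] p by (simp add: fp_primitive_def[abs_def])
  moreover have "filterlim (\<lambda>N. R + real N) at_top sequentially"
    by (rule filterlim_tendsto_add_at_top[OF tendsto_const filterlim_real_sequentially])
  ultimately have "(\<lambda>N. fp_primitive p n (R + real N)) \<longlonglongrightarrow> 0" by (rule filterlim_compose)
  then have "(\<lambda>N. complex_of_real (fp_primitive p n (R + real N) - fp_primitive p n R)) \<longlonglongrightarrow> of_real (0 - fp_primitive p n R)"
    by (intro tendsto_intros)
  with 1 2 show "integral {R..} ?f = - of_real (fp_primitive p n R)"
    using LIMSEQ_unique by fastforce
qed

text \<open>The choice \<delta> = 1/2 keeps both exponents \<plusminus>\<delta> inside (-1, 1),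
  where t^x / |w^2 + t^2| is integrable on the half-line.\<close>

lemma ln_power_generating_function_quadratic:
  fixes \<phi> :: "real \<Rightarrow> complex"
  assumes w: "Re w > 0" and S: "S \<in> sets lebesgue" "S \<subseteq> {0<..}" and meas: "\<phi> \<in> borel_measurable (lebesgue_on S)"
    and b: "\<And>t. t \<in> S \<Longrightarrow> norm (\<phi> t) \<le> K / norm (w\<^sup>2 + (complex_of_real t)\<^sup>2)"
  shows "\<And>m. (\<lambda>t. of_real (ln t) ^ m * \<phi> t) integrable_on S"
    and "\<And>x. \<bar>x\<bar> \<le> 1/2 \<Longrightarrow> (\<lambda>m. integral S (\<lambda>t. of_real (ln t) ^ m * \<phi> t) / fact m * of_real x ^ m)
      sums integral S (\<lambda>t. of_real (t powr x) * \<phi> t)"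
proof -
  let ?g = "\<lambda>t. t powr (1/2) / norm (w\<^sup>2 + (complex_of_real t)\<^sup>2) + t powr (- (1/2)) / norm (w\<^sup>2 + (complex_of_real t)\<^sup>2)"
  have "?g integrable_on {0<..}"
    using integrable_powr_over_sq_plus_sq(2)[OF _ _ w, of "1/2"] integrable_powr_over_sq_plus_sq(2)[OF _ _ w, of "-1/2"]
    by (intro integrable_add) auto
  then have "?g absolutely_integrable_on {0<..}" by (intro nonnegative_absolutely_integrable_1) auto
  then have "?g absolutely_integrable_on S" by (rule set_integrable_subset) (use S in auto)
  then have g: "(\<lambda>t. K * ?g t) integrable_on S"
    by (intro integrable_on_mult_right) (simp add: absolutely_integrable_on_def)
  have int: "(\<lambda>t. (t powr (1/2) + t powr (- (1/2))) * norm (\<phi> t)) integrable_on S"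
  proof (rule measurable_bounded_by_integrable_imp_integrable_real[OF _ g _ S(1)])
    have "(\<lambda>t::real. t powr (1/2) + t powr (- (1/2))) \<in> borel_measurable (lebesgue_on S)"
      by (intro measurable_restrict_space1 measurable_completion) simp
    then show "(\<lambda>t. (t powr (1/2) + t powr (- (1/2))) * norm (\<phi> t)) \<in> borel_measurable (lebesgue_on S)"
      by (intro borel_measurable_times measurable_compose[OF meas borel_measurable_norm])
    show "\<bar>(t powr (1/2) + t powr (- (1/2))) * norm (\<phi> t)\<bar> \<le> K * ?g t" if "t \<in> S" for t
      using mult_left_mono[OF b[OF that], of "t powr (1/2) + t powr (- (1/2))"]
      by (simp add: abs_mult add_divide_distrib mult_ac distrib_left)
  qed
  show "(\<lambda>t. of_real (ln t) ^ m * \<phi> t) integrable_on S" for m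
    by (rule ln_power_generating_function(1)[OF S meas _ int]) simp
  show "(\<lambda>m. integral S (\<lambda>t. of_real (ln t) ^ m * \<phi> t) / fact m * of_real x ^ m)
      sums integral S (\<lambda>t. of_real (t powr x) * \<phi> t)" if "\<bar>x\<bar> \<le> 1/2" for x
    by (rule ln_power_generating_function(2)[OF S meas _ int that]) simp
qed

text \<open>Two expansions of the same function of x are compared: the logarithmic integrals divided
  by m! on one side, the closed form w^(x-1) (pi/2) / cos(pi x / 2) on the other.\<close>

lemma integral_ln_power_Delta1:
  assumes w: "Re w > 0"
  shows "(\<lambda>t. of_real (ln t) ^ n / (w\<^sup>2 + (complex_of_real t)\<^sup>2)) integrable_on {0<..}"
    and "integral {0<..} (\<lambda>t. of_real (ln t) ^ n / (w\<^sup>2 + (complex_of_real t)\<^sup>2)) = Delta1 n w"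
proof -
  let ?\<phi> = "\<lambda>t. 1 / (w\<^sup>2 + (complex_of_real t)\<^sup>2)"
  have w0: "w \<noteq> 0" using w by auto
  have S: "{0::real<..} \<in> sets lebesgue" by simp
  have b: "norm (?\<phi> t) \<le> 1 / norm (w\<^sup>2 + (complex_of_real t)\<^sup>2)" if "t \<in> {0<..}" for t
    by (simp add: norm_divide)
  note gf = ln_power_generating_function_quadratic[OF w S order_refl borel_measurable_inverse_sq_plus_sq b]
  show "(\<lambda>t. of_real (ln t) ^ n / (w\<^sup>2 + (complex_of_real t)\<^sup>2)) integrable_on {0<..}"
    using gf(1)[of n] by simp
  define I where "I m = integral {0<..} (\<lambda>t. of_real (ln t) ^ m * ?\<phi> t)" for m
  let ?c = "complex_of_real (pi / 2)"
  let ?f = "\<lambda>z. (?c / w) * (inverse (cos (?c * z)) * exp (Ln w * z))"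
  have s: "(\<lambda>m. I m / fact m * of_real x ^ m) sums ?f (of_real x)" if x: "0 < x" "x < 1/2" for x
  proof -
    have "(\<lambda>m. I m / fact m * of_real x ^ m) sums integral {0<..} (\<lambda>t. of_real (t powr x) * ?\<phi> t)"
      unfolding I_def using gf(2)[of x] x by simp
    also have "integral {0<..} (\<lambda>t. of_real (t powr x) * ?\<phi> t) = w powr of_real (x - 1) * of_real ((pi / 2) / cos (pi / 2 * x))"
      using integral_powr_over_sq_plus_sq[OF _ _ w, of x] x by simp
    also have "w powr of_real (x - 1) = exp (Ln w * of_real x) / w"
      using w0 by (simp add: powr_def algebra_simps exp_diff exp_Ln)
    also have "of_real ((pi / 2) / cos (pi / 2 * x)) = ?c / cos (?c * of_real x)"
      by (simp only: of_real_mult[symmetric] cos_of_real of_real_divide[symmetric])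
    finally show ?thesis by (simp only: divide_inverse mult_ac)
  qed
  have "?f has_fps_expansion fps_const (?c / w) * (inverse (fps_cos ?c) * fps_exp (Ln w))"
    by (intro fps_expansion_intros) simp
  from has_fps_expansion_coeff_unique[where \<delta> = "1/2" and n = n, OF this _ s]
  have "I n / fact n = fps_nth (fps_const (?c / w) * (inverse (fps_cos ?c) * fps_exp (Ln w))) n" by simp
  then have "I n = Delta1 n w" by (simp add: Delta1_eq_coeff field_simps)
  then show "integral {0<..} (\<lambda>t. of_real (ln t) ^ n / (w\<^sup>2 + (complex_of_real t)\<^sup>2)) = Delta1 n w"
    by (simp add: I_def)
qed

text \<open>For k = t the half-line integral diverges. So t/(w^2 + t^2) is kept on (0, R], and on
  [R, \<infinity>) 1/t is subtracted from it, which leaves -w^2 / (t (w^2 + t^2)). The R-dependent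
  term on the right compensates for the subtraction.\<close>

lemma integral_ln_power_Delta2:
  assumes w: "Re w > 0" and R: "R > 0"
  shows "(\<lambda>t. of_real (ln t) ^ n * (of_real t / (w\<^sup>2 + (complex_of_real t)\<^sup>2))) integrable_on {0<..R}"
    and "(\<lambda>t. of_real (ln t) ^ n * (1 / (of_real t * (w\<^sup>2 + (complex_of_real t)\<^sup>2)))) integrable_on {R..}"
    and "integral {0<..R} (\<lambda>t. of_real (ln t) ^ n * (of_real t / (w\<^sup>2 + (complex_of_real t)\<^sup>2))) -
      w\<^sup>2 * integral {R..} (\<lambda>t. of_real (ln t) ^ n * (1 / (of_real t * (w\<^sup>2 + (complex_of_real t)\<^sup>2)))) =
      of_real (ln R ^ Suc n / real (Suc n)) + w * Delta2 n w"
proof -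
  let ?D = "\<lambda>t. w\<^sup>2 + (complex_of_real t)\<^sup>2"
  have w0: "w \<noteq> 0" using w by auto
  have nz: "?D t \<noteq> 0" if "t > 0" for t using sq_plus_sq_nonzero[OF w, of t] that by simp
  have m1: "(\<lambda>t. of_real t / ?D t) \<in> borel_measurable (lebesgue_on {0<..R})"
    by (intro measurable_restrict_space1 measurable_completion) simp
  have m2: "(\<lambda>t. 1 / (of_real t * ?D t)) \<in> borel_measurable (lebesgue_on {R..})"
    by (intro measurable_restrict_space1 measurable_completion) simp
  have b1: "norm (of_real t / ?D t) \<le> R / norm (?D t)" if "t \<in> {0<..R}" for t
    using that by (auto simp: norm_divide intro: divide_right_mono)
  have b2: "norm (1 / (of_real t * ?D t)) \<le> (1 / R) / norm (?D t)" if "t \<in> {R..}" for t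
  proof -
    have "norm (1 / (of_real t * ?D t)) = (1 / t) / norm (?D t)"
      using that R by (simp add: norm_divide norm_mult)
    also have "\<dots> \<le> (1 / R) / norm (?D t)" using that R by (intro divide_right_mono) (auto simp: field_simps)
    finally show ?thesis .
  qed
  have S1: "{0<..R} \<in> sets lebesgue" "{0<..R} \<subseteq> {0<..}" by auto
  have S2: "{R..} \<in> sets lebesgue" "{R..} \<subseteq> {0<..}" using R by auto
  note gf1 = ln_power_generating_function_quadratic[OF w S1 m1 b1]
  note gf2 = ln_power_generating_function_quadratic[OF w S2 m2 b2]
  show "(\<lambda>t. of_real (ln t) ^ n * (of_real t / ?D t)) integrable_on {0<..R}" using gf1(1) .
  show "(\<lambda>t. of_real (ln t) ^ n * (1 / (of_real t * ?D t))) integrable_on {R..}" using gf2(1) .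
  define A where "A m = integral {0<..R} (\<lambda>t. of_real (ln t) ^ m * (of_real t / ?D t))" for m
  define B where "B m = integral {R..} (\<lambda>t. of_real (ln t) ^ m * (1 / (of_real t * ?D t)))" for m
  \<comment> \<open>Coefficients after multiplication by x, hence shifted by one. Coefficient 0
    vanishes since R^x and w^x (pi x/2) / sin(pi x/2) agree at x = 0.\<close>
  define a where "a m = (case m of 0 \<Rightarrow> 0 | Suc m \<Rightarrow> (A m - w\<^sup>2 * B m) / fact m)" for m
  let ?c = "complex_of_real (pi / 2)"
  let ?f = "\<lambda>z. exp (of_real (ln R) * z) - (if z = 0 then 1 else ?c * z / sin (?c * z)) * exp (Ln w * z)"
  have s: "(\<lambda>m. a m * of_real x ^ m) sums ?f (of_real x)" if x: "0 < x" "x < 1/2" for x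
  proof -
    \<comment> \<open>For x > 0 both pieces reduce to this integrand through t^2/(w^2 + t^2) = 1 -
      w^2/(w^2 + t^2). Its exponent x - 1 lies in the range where the half-line integral is known;
      the leftover power integrates to R^x / x.\<close>
    let ?h = "\<lambda>t. complex_of_real (t powr (x - 1)) / ?D t"
    have h: "?h integrable_on {0<..}" using integrable_powr_over_sq_plus_sq(1)[OF _ _ w, of "x - 1"] x by simp
    have hn: "(\<lambda>t. norm (?h t)) integrable_on {0<..}"
      using integrable_powr_over_sq_plus_sq(2)[OF _ _ w, of "x - 1"] x by (simp add: norm_divide)
    have ha: "?h absolutely_integrable_on {0<..}" using h hn by (simp add: absolutely_integrable_on_def)
    have h1: "?h integrable_on {0<..R}"
    proof -
      have "?h absolutely_integrable_on {0<..R}" by (rule set_integrable_subset[OF ha]) auto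
      then show ?thesis by (simp add: absolutely_integrable_on_def)
    qed
    have h2: "?h integrable_on {R..}"
    proof -
      have "?h absolutely_integrable_on {R..}" by (rule set_integrable_subset[OF ha]) (use R in auto)
      then show ?thesis by (simp add: absolutely_integrable_on_def)
    qed
    have hU: "integral {0<..} ?h = integral {0<..R} ?h + integral {R..} ?h"
    proof -
      have "negligible ({0<..R} \<inter> {R..})" by (rule negligible_subset[of "{R}"]) auto
      from has_integral_Un[OF integrable_integral[OF h1] integrable_integral[OF h2] this]
      have "(?h has_integral integral {0<..R} ?h + integral {R..} ?h) ({0<..R} \<union> {R..})" .
      moreover have "{0<..R} \<union> {R..} = {0<..}" using R by auto
      ultimately show ?thesis by (simp add: integral_unique)
    qed
    have "((\<lambda>t. t powr (x - 1)) has_integral R powr x / x) {0..R}"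
      using has_integral_powr_from_0[of "x - 1" R] x R by simp
    then have "((\<lambda>t. t powr (x - 1)) has_integral R powr x / x) {0<..R}"
      by (subst has_integral_spike_set_eq[where T = "{0..R}"]) (auto intro: negligible_subset[of "{0}"])
    from has_integral_linear[OF this bounded_linear_of_real[where 'a=complex]]
    have p: "((\<lambda>t. complex_of_real (t powr (x - 1))) has_integral of_real (R powr x / x)) {0<..R}" by (simp add: o_def)
    have "((\<lambda>t. complex_of_real (t powr (x - 1)) - w\<^sup>2 * ?h t) has_integral (of_real (R powr x / x) - w\<^sup>2 * integral {0<..R} ?h)) {0<..R}"
      by (intro has_integral_diff p has_integral_mult_right integrable_integral h1)
    then have "((\<lambda>t. of_real (t powr x) * (of_real t / ?D t)) has_integral (of_real (R powr x / x) - w\<^sup>2 * integral {0<..R} ?h)) {0<..R}"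
    proof (rule has_integral_eq[rotated])
      fix t assume "t \<in> {0<..R}"
      then have t: "t > 0" by simp
      have tx: "t powr x = t * t powr (x - 1)" using t by (simp add: powr_diff)
      have "P - W * (P / (W + T\<^sup>2)) = T * P * (T / (W + T\<^sup>2))" if "W + T\<^sup>2 \<noteq> 0" for P W T :: complex
        using that by (simp add: field_simps power2_eq_square)
      from this[OF nz[OF t]] show "complex_of_real (t powr (x - 1)) - w\<^sup>2 * ?h t = of_real (t powr x) * (of_real t / ?D t)"
        unfolding tx of_real_mult .
    qed
    then have 1: "integral {0<..R} (\<lambda>t. of_real (t powr x) * (of_real t / ?D t)) = of_real (R powr x / x) - w\<^sup>2 * integral {0<..R} ?h"
      by (rule integral_unique)
    have 2: "integral {R..} (\<lambda>t. of_real (t powr x) * (1 / (of_real t * ?D t))) = integral {R..} ?h"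
      by (rule integral_cong) (use R in \<open>auto simp: powr_diff\<close>)
    have "(\<lambda>m. A m / fact m * of_real x ^ m - w\<^sup>2 * (B m / fact m * of_real x ^ m)) sums
        (of_real (R powr x / x) - w\<^sup>2 * integral {0<..R} ?h - w\<^sup>2 * integral {R..} ?h)"
      unfolding 1[symmetric] 2[symmetric] A_def B_def using x
      by (intro sums_diff sums_mult gf1(2) gf2(2)) auto
    also have "of_real (R powr x / x) - w\<^sup>2 * integral {0<..R} ?h - w\<^sup>2 * integral {R..} ?h =
        of_real (R powr x / x) - w\<^sup>2 * integral {0<..} ?h"
      by (simp add: hU algebra_simps)
    also have "integral {0<..} ?h = w powr of_real (x - 1 - 1) * of_real ((pi / 2) / cos (pi / 2 * (x - 1)))"
      using integral_powr_over_sq_plus_sq[OF _ _ w, of "x - 1"] x by simp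
    finally have "(\<lambda>m. of_real x * (A m / fact m * of_real x ^ m - w\<^sup>2 * (B m / fact m * of_real x ^ m))) sums
        (of_real x * (of_real (R powr x / x) - w\<^sup>2 * (w powr of_real (x - 1 - 1) * of_real ((pi / 2) / cos (pi / 2 * (x - 1))))))"
      by (rule sums_mult)
    also have "(\<lambda>m. of_real x * (A m / fact m * of_real x ^ m - w\<^sup>2 * (B m / fact m * of_real x ^ m))) = (\<lambda>m. a (Suc m) * of_real x ^ Suc m)"
      by (simp add: a_def fun_eq_iff algebra_simps diff_divide_distrib)
    also have "of_real x * (of_real (R powr x / x) - w\<^sup>2 * (w powr of_real (x - 1 - 1) * of_real ((pi / 2) / cos (pi / 2 * (x - 1))))) = ?f (of_real x)"
    proof -
      have "w powr of_real (x - 1 - 1) = exp (Ln w * of_real x - Ln w - Ln w)"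
        using w0 by (simp add: powr_def algebra_simps)
      also have "\<dots> = exp (Ln w * of_real x) / w\<^sup>2"
        by (simp only: exp_diff exp_Ln[OF w0] power2_eq_square divide_divide_eq_left)
      finally have p1: "w\<^sup>2 * w powr of_real (x - 1 - 1) = exp (Ln w * of_real x)" using w0 by simp
      have "cos (pi / 2 * (x - 1)) = sin (pi / 2 * x)"
        by (simp add: right_diff_distrib cos_diff)
      then have p2: "complex_of_real ((pi / 2) / cos (pi / 2 * (x - 1))) = ?c / sin (?c * of_real x)"
        by (simp only: of_real_mult[symmetric] sin_of_real of_real_divide[symmetric])
      have p3: "complex_of_real (R powr x) = exp (of_real (ln R) * of_real x)"
        using R by (simp add: powr_def mult.commute flip: exp_of_real)
      have "of_real x * (of_real (R powr x / x) - w\<^sup>2 * (w powr of_real (x - 1 - 1) * of_real ((pi / 2) / cos (pi / 2 * (x - 1)))))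
          = of_real (R powr x) - (of_real x * (w\<^sup>2 * w powr of_real (x - 1 - 1)) * of_real ((pi / 2) / cos (pi / 2 * (x - 1))))"
        using x by (simp add: algebra_simps)
      then show ?thesis unfolding p1 p2 p3 using x by (simp add: mult_ac)
    qed
    finally have "(\<lambda>m. a (Suc m) * of_real x ^ Suc m) sums ?f (of_real x)" .
    then show ?thesis by (subst (asm) sums_Suc_iff) (simp add: a_def)
  qed
  have c: "?c \<noteq> 0" by simp
  have "?f has_fps_expansion fps_exp (of_real (ln R)) - inv_sinc_fps ?c * fps_exp (Ln w)"
    by (intro has_fps_expansion_diff has_fps_expansion_mult has_fps_expansion_exp has_fps_expansion_inv_sinc c)
  from has_fps_expansion_coeff_unique[where \<delta> = "1/2" and n = "Suc n", OF this _ s]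
  have "(A n - w\<^sup>2 * B n) / fact n = of_real (ln R) ^ Suc n / fact (Suc n) - fps_nth (inv_sinc_fps ?c * fps_exp (Ln w)) (Suc n)"
    by (simp add: a_def del: fact_Suc power_Suc of_nat_Suc)
  moreover have "A n - w\<^sup>2 * B n = fact n * ((A n - w\<^sup>2 * B n) / fact n)" by simp
  ultimately have "A n - w\<^sup>2 * B n = fact n * (of_real (ln R) ^ Suc n / fact (Suc n)) - fact n * fps_nth (inv_sinc_fps ?c * fps_exp (Ln w)) (Suc n)"
    by (simp only: right_diff_distrib)
  also have "fact n * (complex_of_real (ln R) ^ Suc n / fact (Suc n)) = of_real (ln R ^ Suc n / real (Suc n))"
    unfolding fact_Suc by (simp del: of_nat_Suc power_Suc)
  finally show "integral {0<..R} (\<lambda>t. of_real (ln t) ^ n * (of_real t / ?D t)) -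
      w\<^sup>2 * integral {R..} (\<lambda>t. of_real (ln t) ^ n * (1 / (of_real t * ?D t))) =
      of_real (ln R ^ Suc n / real (Suc n)) + w * Delta2 n w"
    using Delta2_eq_coeff[OF w0, of n] unfolding A_def B_def by simp
qed

subsection \<open>The expansion of the Stieltjes integral\<close>

lemma integrable_continuous_ln_power:
  fixes f :: "real \<Rightarrow> complex"
  assumes w: "Re w > 0" and R: "R \<ge> 0" and f: "continuous_on {0..R} f"
  shows "(\<lambda>t. f t * of_real (ln t) ^ n) integrable_on {0..R}"
    and "(\<lambda>t. f t * of_real (ln t) ^ n / (w\<^sup>2 + (of_real t)\<^sup>2)) integrable_on {0..R}"
proof -
  have *: "(\<lambda>t. g t * of_real (ln t) ^ n) integrable_on {0..R}" if g: "continuous_on {0..R} g" for g :: "real \<Rightarrow> complex"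
  proof -
    have "bounded (g ` {0..R})" by (intro compact_imp_bounded compact_continuous_image g) auto
    then obtain M where "\<And>t. t \<in> {0..R} \<Longrightarrow> norm (g t) \<le> M" unfolding bounded_iff by blast
    with integrable_continuous_times_ln_power(1)[OF R g] show ?thesis by blast
  qed
  show "(\<lambda>t. f t * of_real (ln t) ^ n) integrable_on {0..R}" by (rule *[OF f])
  have "continuous_on {0..R} (\<lambda>t. f t / (w\<^sup>2 + (of_real t)\<^sup>2))"
    using sq_plus_sq_nonzero[OF w] by (intro continuous_intros f) auto
  from *[OF this] show "(\<lambda>t. f t * of_real (ln t) ^ n / (w\<^sup>2 + (of_real t)\<^sup>2)) integrable_on {0..R}"
    by simp
qed

lemma integral_Ioc_eq_Icc:
  fixes f :: "real \<Rightarrow> complex"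
  shows "integral {0<..R} f = integral {0..R} f"
  by (rule integral_spike_set) (auto intro: negligible_subset[of "{0}"])

text \<open>\<open>Delta1\<close> is the integral over the whole half-line. Its part beyond R is
  expanded by \<open>tail_moments\<close> with a = \<infinity>, and the moments there are minus the
  primitives at R.\<close>

lemma fp_primitive_sums_Delta1:
  assumes w: "Re w > 0" and R: "norm w < R"
  shows "(\<lambda>s. (-1) ^ s * w ^ (2 * s) * of_real (fp_primitive (2 * s + 2) n R)) sums
    (integral {0..R} (\<lambda>t. of_real (ln t) ^ n / (w\<^sup>2 + (of_real t)\<^sup>2)) - Delta1 n w)"
proof -
  let ?f = "\<lambda>t. complex_of_real (ln t) ^ n / (w\<^sup>2 + (of_real t)\<^sup>2)"
  have R0: "R > 0" using R norm_ge_zero[of w] by linarith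
  have U: "upto_ereal R \<infinity> = {R..}" by (auto simp: upto_ereal_def)
  have i0: "?f integrable_on upto_ereal 0 \<infinity>"
  proof -
    have "?f integrable_on {0..}"
      by (rule integrable_spike_set[OF integral_ln_power_Delta1(1)[OF w, of n]]) (auto intro: negligible_subset[of "{0}"])
    moreover have "upto_ereal 0 \<infinity> = {0..}" by (auto simp: upto_ereal_def)
    ultimately show ?thesis by simp
  qed
  have "integral (upto_ereal 0 \<infinity>) ?f = Delta1 n w"
  proof -
    have "integral {0..} ?f = integral {0<..} ?f"
      by (rule integral_spike_set) (auto intro: negligible_subset[of "{0}"])
    then show ?thesis using integral_ln_power_Delta1(2)[OF w, of n] by (simp add: upto_ereal_def atLeast_def)
  qed
  with integrable_on_upto_ereal_tail[OF i0, of R] R0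
  have tail: "?f integrable_on upto_ereal R \<infinity>" "Delta1 n w = integral {0..R} ?f + integral (upto_ereal R \<infinity>) ?f"
    by auto
  have eq: "integral {R..} (\<lambda>t. complex_of_real (ln t) ^ n / of_real t ^ (2 * s + 2)) = - of_real (fp_primitive (2 * s + 2) n R)" for s
    by (rule integral_ln_power_over_power_at_top(2)[OF R0]) simp
  have "ereal R < \<infinity>" by simp
  from tail_moments(2)[OF this R tail(1)]
  have "(\<lambda>s. (-1) ^ s * w ^ (2 * s) * - of_real (fp_primitive (2 * s + 2) n R)) sums integral (upto_ereal R \<infinity>) ?f"
    unfolding U by (simp only: eq)
  from sums_minus[OF this] tail(2) show ?thesis by simp
qed

text \<open>The tail expansion is applied to ln^n t / t, whose moments have the exponents 2(s+1) +
  1; this produces the series from index 1 on. Index 0 has exponent 1, for which no convergent tail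
  exists, and its term is exactly the power of ln R in
  \<open>integral_ln_power_Delta2\<close>.\<close>

lemma fp_primitive_sums_Delta2:
  assumes w: "Re w > 0" and R: "norm w < R"
  shows "(\<lambda>s. (-1) ^ s * w ^ (2 * s) * of_real (fp_primitive (2 * s + 1) n R)) sums
    (integral {0..R} (\<lambda>t. of_real t * of_real (ln t) ^ n / (w\<^sup>2 + (of_real t)\<^sup>2)) - w * Delta2 n w)"
proof -
  have R0: "R > 0" using R norm_ge_zero[of w] by linarith
  have U: "upto_ereal R \<infinity> = {R..}" by (auto simp: upto_ereal_def)
  let ?g = "\<lambda>t. complex_of_real (ln t) ^ n * (1 / (of_real t * (w\<^sup>2 + (of_real t)\<^sup>2)))"
  define B where "B = integral {R..} ?g"
  note D = integral_ln_power_Delta2[OF w R0, of n]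
  have geq: "?g = (\<lambda>t. (of_real (ln t) ^ n / of_real t) / (w\<^sup>2 + (of_real t)\<^sup>2))" by (simp add: fun_eq_iff)
  have "(\<lambda>s. (-1) ^ s * w ^ (2 * s) * integral {R..} (\<lambda>t. of_real (ln t) ^ n / of_real t / of_real t ^ (2 * s + 2))) sums B"
    using tail_moments(2)[OF _ R, of \<infinity> "\<lambda>t. of_real (ln t) ^ n / of_real t"] D(2) unfolding U B_def geq by simp
  moreover have "integral {R..} (\<lambda>t. complex_of_real (ln t) ^ n / of_real t / of_real t ^ (2 * s + 2)) = - of_real (fp_primitive (2 * Suc s + 1) n R)" for s
  proof -
    have "(\<lambda>t. complex_of_real (ln t) ^ n / of_real t / of_real t ^ (2 * s + 2)) = (\<lambda>t. of_real (ln t) ^ n / of_real t ^ (2 * Suc s + 1))"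
      by (simp add: fun_eq_iff mult_ac)
    then show ?thesis using integral_ln_power_over_power_at_top(2)[OF R0, of "2 * Suc s + 1" n] by simp
  qed
  ultimately have "(\<lambda>s. (-1) ^ s * w ^ (2 * s) * - of_real (fp_primitive (2 * Suc s + 1) n R)) sums B" by simp
  from sums_mult[OF this, of "w\<^sup>2"]
  have "(\<lambda>s. (-1) ^ Suc s * w ^ (2 * Suc s) * of_real (fp_primitive (2 * Suc s + 1) n R)) sums (w\<^sup>2 * B)"
    by (simp add: power2_eq_square mult_ac)
  then have "(\<lambda>s. (-1) ^ s * w ^ (2 * s) * of_real (fp_primitive (2 * s + 1) n R)) sums
      (w\<^sup>2 * B + of_real (fp_primitive 1 n R))"
    by (subst (asm) sums_Suc_iff) simp
  moreover have "w\<^sup>2 * B + of_real (fp_primitive 1 n R) =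
      integral {0..R} (\<lambda>t. of_real t * of_real (ln t) ^ n / (w\<^sup>2 + (of_real t)\<^sup>2)) - w * Delta2 n w"
    using D(3) unfolding B_def[symmetric] integral_Ioc_eq_Icc
    by (simp add: fp_primitive_def algebra_simps)
  ultimately show ?thesis by simp
qed

text \<open>Subtracting the interpolant of \<open>k\<close> at \<open>\<plusminus>\<i> w\<close> makes the quotient by \<open>z\<^sup>2 + w\<^sup>2\<close> holomorphic.\<close>

lemma interpolation_quotient_holomorphic:
  assumes k: "k holomorphic_on ball 0 \<rho>" and w: "w \<noteq> 0" "norm w < \<rho>"
  obtains h where "h holomorphic_on ball 0 \<rho>"
    "\<And>z. z \<in> ball 0 \<rho> \<Longrightarrow> k z = (k (\<i> * w) + k (- \<i> * w)) / 2 + (k (\<i> * w) - k (- \<i> * w)) / (2 * \<i> * w) * z + (w\<^sup>2 + z\<^sup>2) * h z"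
proof -
  \<comment> \<open>Two successive divided differences, at iw and at -iw. Taking the derivative as
    the value at the node removes the singularity.\<close>
  define k1 where "k1 z = (if z = \<i> * w then deriv k (\<i> * w) else (k z - k (\<i> * w)) / (z - \<i> * w))" for z
  have k1: "k1 holomorphic_on ball 0 \<rho>" unfolding k1_def by (rule pole_lemma_open[OF k]) auto
  define h where "h z = (if z = - \<i> * w then deriv k1 (- \<i> * w) else (k1 z - k1 (- \<i> * w)) / (z - (- \<i> * w)))" for z
  have h: "h holomorphic_on ball 0 \<rho>" unfolding h_def by (rule pole_lemma_open[OF k1]) auto
  have ne: "- \<i> * w \<noteq> \<i> * w" using w by (simp add: neg_eq_iff_add_eq_0 flip: mult_2)
  have 1: "k z = k (\<i> * w) + (z - \<i> * w) * k1 z" for z by (simp add: k1_def)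
  have 2: "k1 z = k1 (- \<i> * w) + (z - (- \<i> * w)) * h z" for z
    by (cases "z = - \<i> * w") (auto simp: h_def add_eq_0_iff2)
  have 3: "k1 (- \<i> * w) = (k (\<i> * w) - k (- \<i> * w)) / (2 * \<i> * w)"
    using ne w by (simp add: k1_def field_simps)
  show thesis
  proof (rule that[OF h])
    fix z
    have "k z = k (\<i> * w) + (z - \<i> * w) * (k1 (- \<i> * w) + (z - (- \<i> * w)) * h z)"
      using 1[of z] 2[of z] by simp
    also have "\<dots> = (k (\<i> * w) - \<i> * w * k1 (- \<i> * w)) + k1 (- \<i> * w) * z + (w\<^sup>2 + z\<^sup>2) * h z"
      by (simp add: power2_eq_square algebra_simps)
    also have "k (\<i> * w) - \<i> * w * k1 (- \<i> * w) = (k (\<i> * w) + k (- \<i> * w)) / 2"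
      unfolding 3 using w by (simp add: field_simps)
    finally show "k z = (k (\<i> * w) + k (- \<i> * w)) / 2 + (k (\<i> * w) - k (- \<i> * w)) / (2 * \<i> * w) * z + (w\<^sup>2 + z\<^sup>2) * h z"
      unfolding 3 .
  qed
qed

text \<open>The radius R exceeds |w|, so the bounds O(R^(-2s)) beat w^(2s); it stays below \<rho>,
  so the quotient \<open>h\<close> is holomorphic beyond R; and it stays below a, so a tail
  remains.\<close>

lemma stieltjes_expansion:
  assumes k: "k holomorphic_on ball 0 \<rho>" and w: "Re w > 0"
    and R: "norm w < R" "R < \<rho>" "ereal R < a"
    and int: "stieltjes_integrand k n w integrable_on upto_ereal 0 a"
  obtains M where "\<And>s. has_fp_integral (moment_integrand k n s) a (M s)"
    "(\<lambda>s. (-1) ^ s * w ^ (2 * s) * M s) sums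
      (stieltjes k a n w - (k (\<i> * w) + k (- \<i> * w)) / 2 * Delta1 n w
        + \<i> * ((k (\<i> * w) - k (- \<i> * w)) / 2) * Delta2 n w)"
proof -
  have R0: "R > 0" using R(1) norm_ge_zero[of w] by linarith
  have w0: "w \<noteq> 0" using w by auto
  define A where "A = (k (\<i> * w) + k (- \<i> * w)) / 2"
  define B where "B = (k (\<i> * w) - k (- \<i> * w)) / (2 * \<i> * w)"
  obtain h where h: "h holomorphic_on ball 0 \<rho>"
    and kh: "\<And>z. z \<in> ball 0 \<rho> \<Longrightarrow> k z = A + B * z + (w\<^sup>2 + z\<^sup>2) * h z"
    using interpolation_quotient_holomorphic[OF k w0] R unfolding A_def B_def by auto
  obtain J C where J: "\<And>p. has_fp_integral (\<lambda>t. h (of_real t) * of_real (ln t) ^ n / of_real t ^ p) (ereal R) (J p)"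
      "\<And>p. norm (J p) \<le> C / R ^ p"
    using has_fp_integral_holomorphic_times_ln_power[OF h R0 R(2), of n] by blast
  define f where "f t = k (of_real t) * of_real (ln t) ^ n" for t
  have st: "stieltjes_integrand k n w = (\<lambda>t. f t / (w\<^sup>2 + (of_real t)\<^sup>2))"
    by (simp add: f_def fun_eq_iff stieltjes_integrand_def)
  have mo: "moment_integrand k n s = (\<lambda>t. f t / of_real t ^ (2 * s + 2))" for s
    by (simp add: f_def fun_eq_iff moment_integrand_def)
  let ?\<phi> = "\<lambda>t. f t / (w\<^sup>2 + (of_real t)\<^sup>2)"
  note tl = integrable_on_upto_ereal_tail[OF int[unfolded st] less_imp_le[OF R0] R(3)]
  note tm = tail_moments[OF R(3) R(1) tl(1)]
  define T where "T s = integral (upto_ereal R a) (\<lambda>t. f t / of_real t ^ (2 * s + 2))" for s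
  \<comment> \<open>The quotient part has the telescoping shape because (w^2 + t^2) h / t^(2s+2) = h
    / t^(2s) + w^2 h / t^(2s+2).\<close>
  define H where "H s = A * of_real (fp_primitive (2 * s + 2) n R) + B * of_real (fp_primitive (2 * s + 1) n R)
      + (J (2 * s) + w\<^sup>2 * J (2 * s + 2))" for s
  have head: "has_fp_integral (moment_integrand k n s) (ereal R) (H s)" for s
  proof -
    have "has_fp_integral (\<lambda>t. A * (of_real (ln t) ^ n / of_real t ^ (2 * s + 2)) + B * (of_real (ln t) ^ n / of_real t ^ (2 * s + 1))
        + (h (of_real t) * of_real (ln t) ^ n / of_real t ^ (2 * s) + w\<^sup>2 * (h (of_real t) * of_real (ln t) ^ n / of_real t ^ (2 * s + 2)))) (ereal R) (H s)"
      unfolding H_def using R0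
      by (intro has_fp_integral_add has_fp_integral_cmult has_fp_integral_ln_power_over_power J(1)) auto
    then show ?thesis
    proof (rule has_fp_integral_cong[THEN iffD1, rotated])
      fix t :: real assume t: "0 < t" "ereal t < ereal R"
      have kt: "k (of_real t) = A + B * of_real t + (w\<^sup>2 + (of_real t)\<^sup>2) * h (of_real t)"
        using kh[of "of_real t"] t R by simp
      have "A * (L / (Q * (x * x))) + B * (L / (Q * x)) + (V * L / Q + W * (V * L / (Q * (x * x)))) =
          (A + B * x + (W + x\<^sup>2) * V) * L / (Q * (x * x))" if "x \<noteq> 0" "Q \<noteq> 0" for L Q x V W :: complex
        using that by (simp add: field_simps power2_eq_square)
      note alg = this[where x = "of_real t" and Q = "of_real t ^ (2 * s)" and L = "of_real (ln t) ^ n"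
        and V = "h (of_real t)" and W = "w\<^sup>2"]
      have e: "complex_of_real t ^ (2 * s + 2) = of_real t ^ (2 * s) * (of_real t * of_real t)"
        "complex_of_real t ^ (2 * s + 1) = of_real t ^ (2 * s) * of_real t"
        by (simp_all add: power_add power2_eq_square)
      show "A * (of_real (ln t) ^ n / of_real t ^ (2 * s + 2)) + B * (of_real (ln t) ^ n / of_real t ^ (2 * s + 1))
        + (h (of_real t) * of_real (ln t) ^ n / of_real t ^ (2 * s) + w\<^sup>2 * (h (of_real t) * of_real (ln t) ^ n / of_real t ^ (2 * s + 2)))
        = moment_integrand k n s t"
        unfolding moment_integrand_def kt e using t by (intro alg) auto
    qed
  qed
  have fp: "has_fp_integral (moment_integrand k n s) a (H s + T s)" for s
    unfolding T_def using has_fp_integral_extend[OF head _ R0 R(3), of s] tm(1)[of s] by (simp add: mo)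
  let ?I1 = "integral {0..R} (\<lambda>t. of_real (ln t) ^ n / (w\<^sup>2 + (of_real t)\<^sup>2))"
  let ?I2 = "integral {0..R} (\<lambda>t. of_real t * of_real (ln t) ^ n / (w\<^sup>2 + (of_real t)\<^sup>2))"
  have hc: "continuous_on {0..R} (\<lambda>t. h (of_real t))"
    using holomorphic_on_imp_continuous_on[OF h] R
    by (intro continuous_on_compose2[of "ball 0 \<rho>" h "{0..R}" of_real] continuous_intros) auto
  have ih: "(\<lambda>t. h (of_real t) * of_real (ln t) ^ n) integrable_on {0..R}"
    using integrable_continuous_ln_power(1)[OF w _ hc] R0 by simp
  \<comment> \<open>The telescoped sum is a finite part at exponent 0. Uniqueness identifies it with
    the ordinary integral of h(t) ln^n t, which is what h contributes to the Stieltjes integral on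
    [0, R].\<close>
  have J0: "J 0 = integral {0..R} (\<lambda>t. h (of_real t) * of_real (ln t) ^ n)"
  proof (rule has_fp_integral_unique)
    show "has_fp_integral (\<lambda>t. h (of_real t) * of_real (ln t) ^ n) (ereal R) (J 0)" using J(1)[of 0] by simp
    show "has_fp_integral (\<lambda>t. h (of_real t) * of_real (ln t) ^ n) (ereal R) (integral {0..R} (\<lambda>t. h (of_real t) * of_real (ln t) ^ n))"
      by (rule has_fp_integral_integrable[OF ih R0])
  qed (use R0 in simp)
  have hsum: "(\<lambda>s. (-1) ^ s * w ^ (2 * s) * (J (2 * s) + w\<^sup>2 * J (2 * s + 2))) sums J 0"
    using alternating_telescoping_sums[of "\<lambda>s. J (2 * s)" C R w] J(2) R(1) by simp
  have i1: "(\<lambda>t. of_real (ln t) ^ n / (w\<^sup>2 + (of_real t)\<^sup>2)) integrable_on {0..R}"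
    using integrable_continuous_ln_power(2)[OF w, of R "\<lambda>_. 1" n] R0 by simp
  have i2: "(\<lambda>t. of_real t * of_real (ln t) ^ n / (w\<^sup>2 + (of_real t)\<^sup>2)) integrable_on {0..R}"
    using integrable_continuous_ln_power(2)[OF w, of R of_real n] R0 by (simp add: continuous_on_of_real_id)
  have "((\<lambda>t. A * (of_real (ln t) ^ n / (w\<^sup>2 + (of_real t)\<^sup>2)) + B * (of_real t * of_real (ln t) ^ n / (w\<^sup>2 + (of_real t)\<^sup>2))
      + h (of_real t) * of_real (ln t) ^ n) has_integral (A * ?I1 + B * ?I2 + J 0)) {0..R}"
    unfolding J0 by (intro has_integral_add has_integral_mult_right integrable_integral i1 i2 ih)
  then have "(?\<phi> has_integral (A * ?I1 + B * ?I2 + J 0)) {0..R}"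
  proof (rule has_integral_eq[rotated])
    fix t assume t: "t \<in> {0..R}"
    have kt: "k (of_real t) = A + B * of_real t + (w\<^sup>2 + (of_real t)\<^sup>2) * h (of_real t)"
      using kh[of "of_real t"] t R by simp
    have "A * (L / D) + B * (x * L / D) + V * L = (A + B * x + D * V) * L / D" if "D \<noteq> 0" for L D x V :: complex
      using that by (simp add: field_simps)
    from this[OF sq_plus_sq_nonzero[OF w]] t
    show "A * (of_real (ln t) ^ n / (w\<^sup>2 + (of_real t)\<^sup>2)) + B * (of_real t * of_real (ln t) ^ n / (w\<^sup>2 + (of_real t)\<^sup>2))
      + h (of_real t) * of_real (ln t) ^ n = ?\<phi> t"
      unfolding f_def kt by simp
  qed
  then have I: "integral {0..R} ?\<phi> = A * ?I1 + B * ?I2 + J 0" by (rule integral_unique)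
  have "(\<lambda>s. A * ((-1) ^ s * w ^ (2 * s) * of_real (fp_primitive (2 * s + 2) n R))
      + B * ((-1) ^ s * w ^ (2 * s) * of_real (fp_primitive (2 * s + 1) n R))
      + (-1) ^ s * w ^ (2 * s) * (J (2 * s) + w\<^sup>2 * J (2 * s + 2))
      + (-1) ^ s * w ^ (2 * s) * T s) sums
      (A * (?I1 - Delta1 n w) + B * (?I2 - w * Delta2 n w) + J 0 + integral (upto_ereal R a) ?\<phi>)"
    unfolding T_def
    by (intro sums_add sums_mult fp_primitive_sums_Delta1 fp_primitive_sums_Delta2 w R hsum tm(2))
  also have "(\<lambda>s. A * ((-1) ^ s * w ^ (2 * s) * of_real (fp_primitive (2 * s + 2) n R))
      + B * ((-1) ^ s * w ^ (2 * s) * of_real (fp_primitive (2 * s + 1) n R))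
      + (-1) ^ s * w ^ (2 * s) * (J (2 * s) + w\<^sup>2 * J (2 * s + 2))
      + (-1) ^ s * w ^ (2 * s) * T s) = (\<lambda>s. (-1) ^ s * w ^ (2 * s) * (H s + T s))"
    by (simp add: H_def fun_eq_iff algebra_simps)
  also have "A * (?I1 - Delta1 n w) + B * (?I2 - w * Delta2 n w) + J 0 + integral (upto_ereal R a) ?\<phi> =
      stieltjes k a n w - A * Delta1 n w - (B * w) * Delta2 n w"
    unfolding stieltjes_def st tl(3) I by (simp add: algebra_simps)
  \<comment> \<open>The interpolation slope contains 1/(2i) = -i/2, the origin of the factor -i in
    front of \<open>Delta2\<close>.\<close>
  also have "B * w = - \<i> * ((k (\<i> * w) - k (- \<i> * w)) / 2)"
    using w0 by (simp add: B_def field_simps)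
  finally show thesis using that[OF fp] by (simp add: A_def)
qed

section \<open>The disc of holomorphy and the right half-plane representative\<close>

lemma sing_dist_analytic:
  assumes "ereal (norm z) < sing_dist k"
  shows "k analytic_on {z}"
proof (rule ccontr)
  assume "\<not> k analytic_on {z}"
  then have "sing_dist k \<le> ereal (norm z)" unfolding sing_dist_def by (intro INF_lower) auto
  with assms show False by simp
qed

lemma sing_dist_holomorphic:
  assumes "ereal \<rho> \<le> sing_dist k"
  shows "k holomorphic_on ball 0 \<rho>"
proof -
  have "k analytic_on ball 0 \<rho>"
  proof (rule analytic_on_analytic_at[THEN iffD2], intro ballI)
    fix z :: complex assume "z \<in> ball 0 \<rho>"
    then have "ereal (norm z) < ereal \<rho>" by simp
    with assms have "ereal (norm z) < sing_dist k" by (rule order.strict_trans2[rotated])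
    then show "k analytic_on {z}" by (rule sing_dist_analytic)
  qed
  then show ?thesis by (rule analytic_imp_holomorphic)
qed

lemma sing_dist_pos:
  assumes "k analytic_on {0}"
  shows "0 < sing_dist k"
proof -
  obtain e where e: "e > 0" "k holomorphic_on ball 0 e" using assms by (auto simp: analytic_on_def)
  have "ereal e \<le> sing_dist k"
    unfolding sing_dist_def
  proof (rule INF_greatest)
    fix z assume "z \<in> {z. \<not> k analytic_on {z}}"
    then have "z \<notin> ball 0 e" using e(2) by (auto simp: analytic_on_open[symmetric] analytic_on_subset)
    then show "ereal e \<le> ereal (norm z)" by simp
  qed
  with e(1) show ?thesis by (metis ereal_less(2) less_le_trans)
qed

text \<open>Excluding the imaginary axis puts exactly one of \<plusminus>\<omega> into the open
  right half-plane, where w^2 + t^2 has no zero on the half-line of integration.\<close>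

lemma right_rep_Re_pos:
  assumes "\<omega> \<noteq> 0" "\<bar>Arg \<omega>\<bar> \<noteq> pi / 2"
  shows "Re (right_rep \<omega>) > 0"
proof (cases "\<bar>Arg \<omega>\<bar> < pi / 2")
  case True
  then show ?thesis using assms Arg_Re_pos[of \<omega>] by (simp add: right_rep_def)
next
  case False
  then have "\<not> \<bar>Arg \<omega>\<bar> \<le> pi / 2" using assms by linarith
  then have "Re \<omega> < 0" using Arg_Re_nonneg[of \<omega>] by simp
  then show ?thesis using False by (simp add: right_rep_def)
qed

lemma right_rep_simps [simp]:
  "(right_rep \<omega>)\<^sup>2 = \<omega>\<^sup>2" "right_rep \<omega> ^ (2 * s) = \<omega> ^ (2 * s)" "norm (right_rep \<omega>) = norm \<omega>"
  by (auto simp: right_rep_def power_mult)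

lemma stieltjes_right_rep: "stieltjes k a n (right_rep \<omega>) = stieltjes k a n \<omega>"
  by (simp add: stieltjes_def stieltjes_integrand_def[abs_def])

lemma stieltjes_integrand_right_rep: "stieltjes_integrand k n (right_rep \<omega>) = stieltjes_integrand k n \<omega>"
  by (simp add: stieltjes_integrand_def[abs_def])

subsection \<open>Behaviour at the origin\<close>

lemma filterlim_norm_at_right_0: "filterlim norm (at_right 0) (at (0::complex))"
  unfolding filterlim_at by (auto simp: eventually_at_filter intro!: tendsto_norm_zero tendsto_ident_at)

lemma inverse_Ln_tendsto_0: "((\<lambda>w. inverse (Ln w)) \<longlongrightarrow> 0) (at 0)"
proof (rule filterlim_compose[OF tendsto_inverse_0])
  show "filterlim Ln at_infinity (at 0)"
    unfolding filterlim_at_infinity_conv_norm_at_top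
  proof (rule filterlim_at_top_mono)
    have "filterlim (\<lambda>x::real. - ln x) at_top (at_right 0)" by real_asymp
    then show "filterlim (\<lambda>w::complex. - ln (norm w)) at_top (at 0)"
      by (rule filterlim_compose[OF _ filterlim_norm_at_right_0])
    show "eventually (\<lambda>w. - ln (norm w) \<le> norm (Ln w)) (at 0)"
      unfolding eventually_at_filter
    proof (intro always_eventually allI impI)
      fix w :: complex assume "w \<noteq> 0"
      then show "- ln (norm w) \<le> norm (Ln w)" using abs_Re_le_cmod[of "Ln w"] by simp
    qed
  qed
qed

lemma mult_Ln_tendsto_0: "((\<lambda>w. w * Ln w) \<longlongrightarrow> 0) (at 0)"
proof (rule Lim_null_comparison)
  show "eventually (\<lambda>w. norm (w * Ln w) \<le> norm w * (\<bar>ln (norm w)\<bar> + pi)) (at 0)"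
    unfolding eventually_at_filter
  proof (intro always_eventually allI impI)
    fix w :: complex assume "w \<noteq> 0"
    then have "norm (Ln w) \<le> \<bar>ln (norm w)\<bar> + pi"
      using cmod_le[of "Ln w"] mpi_less_Im_Ln[of w] Im_Ln_le_pi[of w] by simp
    then show "norm (w * Ln w) \<le> norm w * (\<bar>ln (norm w)\<bar> + pi)"
      by (simp add: norm_mult mult_left_mono)
  qed
  have "((\<lambda>x::real. x * (\<bar>ln x\<bar> + pi)) \<longlongrightarrow> 0) (at_right 0)" by real_asymp
  then show "((\<lambda>w::complex. norm w * (\<bar>ln (norm w)\<bar> + pi)) \<longlongrightarrow> 0) (at 0)"
    by (rule filterlim_compose[OF _ filterlim_norm_at_right_0])
qed

lemma Ln_eventually_nonzero: "eventually (\<lambda>w. Ln w \<noteq> 0) (at 0)"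
proof -
  have "eventually (\<lambda>x::real. x < 1) (at_right 0)" by real_asymp
  then have "eventually (\<lambda>w::complex. norm w < 1) (at 0)"
    by (rule eventually_compose_filterlim[OF _ filterlim_norm_at_right_0])
  moreover have "eventually (\<lambda>w::complex. w \<noteq> 0) (at 0)" by (simp add: eventually_at_filter)
  ultimately show ?thesis
  proof eventually_elim
    case (elim w)
    have "Ln w = 0 \<Longrightarrow> w = 1" using exp_Ln[OF elim(2)] by simp
    with elim show ?case by auto
  qed
qed

text \<open>After division the sum is a polynomial in 1 / \<open>Ln w\<close>, which tends to 0, so
  only the coefficient of the top power survives.\<close>

lemma polynomial_in_Ln_asymptotics:
  fixes b :: "nat \<Rightarrow> complex"
  shows "((\<lambda>w. (\<Sum>i=0..N. b i * Ln w ^ (N - i)) / Ln w ^ N) \<longlongrightarrow> b 0) (at 0)"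
proof (rule Lim_transform_eventually)
  have "((\<lambda>w. \<Sum>i=0..N. b i * inverse (Ln w) ^ i) \<longlongrightarrow> (\<Sum>i=0..N. b i * 0 ^ i)) (at 0)"
    by (intro tendsto_intros inverse_Ln_tendsto_0)
  also have "(\<Sum>i=0..N. b i * 0 ^ i) = b 0"
    by (subst sum.atLeast_Suc_atMost) (auto intro!: sum.neutral)
  finally show "((\<lambda>w. \<Sum>i=0..N. b i * inverse (Ln w) ^ i) \<longlongrightarrow> b 0) (at 0)" .
  show "eventually (\<lambda>w. (\<Sum>i=0..N. b i * inverse (Ln w) ^ i) = (\<Sum>i=0..N. b i * Ln w ^ (N - i)) / Ln w ^ N) (at 0)"
    using Ln_eventually_nonzero
  proof eventually_elim
    case (elim w)
    have "b i * inverse (Ln w) ^ i = b i * Ln w ^ (N - i) / Ln w ^ N" if "i \<le> N" for i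
      using elim that by (simp add: power_diff field_simps)
    then show ?case by (simp add: sum_divide_distrib)
  qed
qed

lemma Delta1_asymptotics: "((\<lambda>w. w * Delta1 n w / Ln w ^ n) \<longlongrightarrow> of_real (pi / 2)) (at 0)"
proof (rule Lim_transform_eventually)
  define b :: "nat \<Rightarrow> complex" where "b i = fact n * of_real (pi / 2) * (of_real (pi / 2) ^ i * of_real (sec_coeff i) / fact (n - i))" for i
  have "b 0 = of_real (pi / 2)" by (simp add: b_def sec_coeff_def)
  with polynomial_in_Ln_asymptotics[where N = n and b = b]
  show "((\<lambda>w. (\<Sum>i=0..n. b i * Ln w ^ (n - i)) / Ln w ^ n) \<longlongrightarrow> of_real (pi / 2)) (at 0)" by simp
  have "eventually (\<lambda>w::complex. w \<noteq> 0) (at 0)" by (simp add: eventually_at_filter)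
  then show "eventually (\<lambda>w. (\<Sum>i=0..n. b i * Ln w ^ (n - i)) / Ln w ^ n = w * Delta1 n w / Ln w ^ n) (at 0)"
  proof eventually_elim
    case (elim w)
    have "w * Delta1 n w = fact n * of_real (pi / 2) * fps_nth (inverse (fps_cos (of_real (pi / 2))) * fps_exp (Ln w)) n"
      unfolding Delta1_eq_coeff fps_mult_left_const_nth using elim by (simp del: of_real_divide)
    also have "\<dots> = (\<Sum>i=0..n. b i * Ln w ^ (n - i))"
      by (simp add: fps_mult_nth inverse_fps_cos sum_distrib_left b_def mult.assoc del: of_real_divide)
    finally show ?case by simp
  qed
qed

text \<open>The value of the limit is immaterial later: the factor k(iw) - k(-iw) is O(w) and makes
  this term negligible.\<close>

lemma Delta2_asymptotics: "\<exists>d. ((\<lambda>w. w * Delta2 n w / Ln w ^ Suc n) \<longlongrightarrow> d) (at 0)"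
proof -
  define b where "b i = - fact n * (fps_nth (inv_sinc_fps (of_real (pi / 2))) i / fact (Suc n - i))" for i
  have "((\<lambda>w. w * Delta2 n w / Ln w ^ Suc n) \<longlongrightarrow> b 0) (at 0)"
  proof (rule Lim_transform_eventually[OF polynomial_in_Ln_asymptotics[where N = "Suc n" and b = b]])
    have "eventually (\<lambda>w::complex. w \<noteq> 0) (at 0)" by (simp add: eventually_at_filter)
    then show "eventually (\<lambda>w. (\<Sum>i=0..Suc n. b i * Ln w ^ (Suc n - i)) / Ln w ^ Suc n = w * Delta2 n w / Ln w ^ Suc n) (at 0)"
    proof eventually_elim
      case (elim w)
      have "w * Delta2 n w = (\<Sum>i=0..Suc n. b i * Ln w ^ (Suc n - i))"
        unfolding Delta2_eq_coeff[OF elim] fps_mult_nth sum_distrib_left sum_negf[symmetric] fps_exp_nth b_def of_nat_fact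
        by (intro sum.cong refl) (simp del: fact_Suc power_Suc)
      then show ?case by simp
    qed
  qed
  then show ?thesis by blast
qed

lemma odd_part_asymptotics:
  assumes "k analytic_on {0}"
  shows "\<exists>d. ((\<lambda>w. (k (\<i> * w) - k (- \<i> * w)) / 2 / w) \<longlongrightarrow> d) (at 0)"
proof -
  have "k field_differentiable (at 0)" using assms by (auto simp: analytic_at_imp_isCont analytic_on_imp_differentiable_at)
  then have k: "(k has_field_derivative deriv k 0) (at 0)" by (simp add: DERIV_deriv_iff_field_differentiable)
  have "((\<lambda>w. (k (\<i> * w) - k (- \<i> * w)) / 2) has_field_derivative (deriv k 0 * \<i> - deriv k 0 * (- \<i>)) / 2) (at 0)"
    by (intro DERIV_cdivide DERIV_diff DERIV_chain2[where f = k]) (auto intro!: derivative_eq_intros k)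
  then show ?thesis unfolding DERIV_def by auto
qed

text \<open>As a power series in w^2 that converges at one nonzero point, the sum is continuous at
  0.\<close>

lemma even_power_series_tendsto:
  fixes M :: "nat \<Rightarrow> complex"
  assumes "summable (\<lambda>s. (-1) ^ s * r ^ (2 * s) * M s)" "r \<noteq> 0"
  shows "((\<lambda>w. \<Sum>s. (-1) ^ s * w ^ (2 * s) * M s) \<longlongrightarrow> M 0) (at 0)"
proof -
  define g where "g z = (\<Sum>s. ((-1) ^ s * M s) * z ^ s)" for z
  have "summable (\<lambda>s. ((-1) ^ s * M s) * (r\<^sup>2) ^ s)"
    using assms(1) unfolding power_mult by (simp only: mult_ac)
  then have "isCont g 0" unfolding g_def[abs_def] 
    by (rule isCont_powser[where K = "r\<^sup>2"]) (use assms(2) in simp)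
  moreover have "((\<lambda>w::complex. w\<^sup>2) \<longlongrightarrow> 0\<^sup>2) (at 0)" by (intro tendsto_intros)
  ultimately have "((\<lambda>w. g (w\<^sup>2)) \<longlongrightarrow> g 0) (at 0)" by (intro isCont_tendsto_compose[of 0 g]) auto
  moreover have "g 0 = M 0" using powser_zero[of "\<lambda>s. (-1) ^ s * M s"] by (simp add: g_def)
  moreover have "g (w\<^sup>2) = (\<Sum>s. (-1) ^ s * w ^ (2 * s) * M s)" for w
    unfolding g_def power_mult by (simp only: mult_ac)
  ultimately show ?thesis by simp
qed

text \<open>\<open>Delta1\<close> grows like (pi/2) Ln^n w / w. The series stays bounded and the
  \<open>Delta2\<close> term is O(Ln^(n+1) w), so relative to \<open>Delta1\<close> they are O(w /
  Ln^n w) and O(w Ln w).\<close>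

lemma expansion_asymptotics:
  fixes k :: "complex \<Rightarrow> complex"
  assumes k: "k analytic_on {0}" "k 0 \<noteq> 0"
    and M: "summable (\<lambda>s. (-1) ^ s * r ^ (2 * s) * M s)" "r \<noteq> 0"
  shows "((\<lambda>w. ((\<Sum>s. (-1) ^ s * w ^ (2 * s) * M s) + (k (\<i> * w) + k (- \<i> * w)) / 2 * Delta1 n w
      - \<i> * ((k (\<i> * w) - k (- \<i> * w)) / 2) * Delta2 n w) / (k 0 * Delta1 n w)) \<longlongrightarrow> 1) (at 0)"
proof (rule Lim_transform_eventually)
  define E1 where "E1 w = w * Delta1 n w / Ln w ^ n" for w
  define E2 where "E2 w = w * Delta2 n w / Ln w ^ Suc n" for w
  define S where "S w = (\<Sum>s. (-1) ^ s * w ^ (2 * s) * M s)" for w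
  define P where "P w = (k (\<i> * w) + k (- \<i> * w)) / 2" for w
  define Q where "Q w = (k (\<i> * w) - k (- \<i> * w)) / 2" for w
  have E1: "(E1 \<longlongrightarrow> of_real (pi / 2)) (at 0)" unfolding E1_def[abs_def] by (rule Delta1_asymptotics)
  obtain d where E2: "(E2 \<longlongrightarrow> d) (at 0)" using Delta2_asymptotics unfolding E2_def[abs_def] by blast
  obtain q where Q: "((\<lambda>w. Q w / w) \<longlongrightarrow> q) (at 0)" using odd_part_asymptotics[OF k(1)] unfolding Q_def by blast
  have S: "(S \<longlongrightarrow> M 0) (at 0)" unfolding S_def[abs_def] by (rule even_power_series_tendsto[OF M])
  have P: "(P \<longlongrightarrow> k 0) (at 0)"
  proof -
    have c: "isCont k 0" using k(1) by (simp add: analytic_at_imp_isCont)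
    have kb: "((\<lambda>w. k (b * w)) \<longlongrightarrow> k 0) (at 0)" for b
    proof -
      have "((\<lambda>w. b * w) \<longlongrightarrow> b * 0) (at 0)" by (intro tendsto_intros)
      with c show ?thesis using isCont_tendsto_compose[of 0 k "\<lambda>w. b * w" "at 0"] by simp
    qed
    have "(P \<longlongrightarrow> (k 0 + k 0) / 2) (at 0)" unfolding P_def[abs_def] by (intro tendsto_intros kb) auto
    then show ?thesis by simp
  qed
  have pi0: "complex_of_real (pi / 2) \<noteq> 0" by simp
  \<comment> \<open>The quotient rewritten in normalised factors each of which has a limit at 0; w
    and w \<open>Ln w\<close> tend to 0 and remove the outer terms.\<close>
  define X where "X w = S w * w * inverse (Ln w) ^ n / (k 0 * E1 w) + P w / k 0
      - \<i> * (Q w / w) * (w * Ln w) * E2 w / (k 0 * E1 w)" for w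
  have "(X \<longlongrightarrow> M 0 * 0 * 0 ^ n / (k 0 * of_real (pi / 2)) + k 0 / k 0 - \<i> * q * 0 * d / (k 0 * of_real (pi / 2))) (at 0)"
    unfolding X_def[abs_def]
    by (intro tendsto_intros S P Q E1 E2 inverse_Ln_tendsto_0 mult_Ln_tendsto_0) (use k(2) pi0 in auto)
  then show "(X \<longlongrightarrow> 1) (at 0)" using k(2) by simp
  have ev0: "eventually (\<lambda>w::complex. w \<noteq> 0) (at 0)" by (simp add: eventually_at_filter)
  have ev1: "eventually (\<lambda>w. E1 w \<noteq> 0) (at 0)" using tendsto_imp_eventually_ne[OF E1 pi0] .
  show "eventually (\<lambda>w. X w = ((\<Sum>s. (-1) ^ s * w ^ (2 * s) * M s) + (k (\<i> * w) + k (- \<i> * w)) / 2 * Delta1 n w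
      - \<i> * ((k (\<i> * w) - k (- \<i> * w)) / 2) * Delta2 n w) / (k 0 * Delta1 n w)) (at 0)"
    using ev0 ev1 Ln_eventually_nonzero
  proof eventually_elim
    case (elim w)
    have D1: "Delta1 n w = E1 w * Ln w ^ n / w" using elim by (simp add: E1_def)
    have D2: "Delta2 n w = E2 w * (Ln w * Ln w ^ n) / w" using elim by (simp add: E2_def)
    have "s * v * inverse L / (K * e) + p / K - \<i> * (q / v) * (v * l) * f / (K * e) =
        (s + p * (e * L / v) - \<i> * q * (f * (l * L) / v)) / (K * (e * L / v))"
      if "v \<noteq> 0" "L \<noteq> 0" "K \<noteq> 0" "e \<noteq> 0" for s v L K e p q l f :: complex
      using that by (simp add: field_simps)
    from this[of w "Ln w ^ n" "k 0" "E1 w" "S w" "P w" "Q w" "Ln w" "E2 w"] elim k(2)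
    show ?case
      unfolding X_def S_def[symmetric] P_def[symmetric] Q_def[symmetric] D1 D2 power_inverse by simp
  qed
qed

theorem theorem4p2:
  fixes k :: "complex \<Rightarrow> complex" and a :: ereal and n :: nat
  assumes "0 < a" and "n > 0"
    and analytic: "k analytic_on (of_real ` upto_ereal 0 a)"
    and nonzero: "k 0 \<noteq> 0"
    and stieltjes_exists:
      "\<And>\<omega>. \<omega> \<in> admissible k a \<Longrightarrow> stieltjes_integrand k n \<omega> integrable_on upto_ereal 0 a"
  shows "(\<forall>s. has_fp_integral (moment_integrand k n s) a (fp_integral (moment_integrand k n s) a)) \<and>
    (\<forall>\<omega> \<in> admissible k a. let w = right_rep \<omega> in
        summable (\<lambda>s. (-1) ^ s * \<omega> ^ (2 * s) * fp_integral (moment_integrand k n s) a) \<and>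
        stieltjes k a n \<omega> =
          (\<Sum>s. (-1) ^ s * \<omega> ^ (2 * s) * fp_integral (moment_integrand k n s) a)
          + (k (\<i> * w) + k (- \<i> * w)) / 2 * Delta1 n w
          - \<i> * ((k (\<i> * w) - k (- \<i> * w)) / 2) * Delta2 n w) \<and>
    (stieltjes k a n \<sim>[at 0 within admissible k a] (\<lambda>\<omega>. k 0 * Delta1 n (right_rep \<omega>)))"
proof -
  define M where "M s = fp_integral (moment_integrand k n s) a" for s
  have "(0::complex) \<in> of_real ` upto_ereal 0 a"
    using \<open>0 < a\<close> by (auto simp: upto_ereal_def zero_ereal_def intro!: image_eqI[of _ _ 0])
  then have k0: "k analytic_on {0}" using analytic analytic_on_subset by blast
  have expansion: "(\<forall>s. has_fp_integral (moment_integrand k n s) a (M s)) \<and>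
      (\<lambda>s. (-1) ^ s * \<omega> ^ (2 * s) * M s) sums
      (stieltjes k a n \<omega> - (k (\<i> * right_rep \<omega>) + k (- \<i> * right_rep \<omega>)) / 2 * Delta1 n (right_rep \<omega>)
        + \<i> * ((k (\<i> * right_rep \<omega>) - k (- \<i> * right_rep \<omega>)) / 2) * Delta2 n (right_rep \<omega>))"
    if \<omega>: "\<omega> \<in> admissible k a" for \<omega>
  proof -
    let ?w = "right_rep \<omega>"
    have \<omega>': "\<omega> \<noteq> 0" "\<bar>Arg \<omega>\<bar> \<noteq> pi / 2" "ereal (norm \<omega>) < min a (sing_dist k)"
      using \<omega> by (auto simp: admissible_def)
    \<comment> \<open>Two further radii above |\<omega>|: \<open>R\<close> cuts the integrals,
      \<rho> bounds the disc of holomorphy.\<close>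
    obtain R where R: "ereal (norm \<omega>) < ereal R" "ereal R < min a (sing_dist k)"
      using ereal_dense2[OF \<omega>'(3)] by blast
    obtain \<rho> where \<rho>: "ereal R < ereal \<rho>" "ereal \<rho> < min a (sing_dist k)"
      using ereal_dense2[OF R(2)] by blast
    have hol: "k holomorphic_on ball 0 \<rho>" using \<rho>(2) by (intro sing_dist_holomorphic) auto
    have int: "stieltjes_integrand k n ?w integrable_on upto_ereal 0 a"
      using stieltjes_exists[OF \<omega>] by (simp add: stieltjes_integrand_right_rep)
    obtain I where I: "\<And>s. has_fp_integral (moment_integrand k n s) a (I s)"
      "(\<lambda>s. (-1) ^ s * ?w ^ (2 * s) * I s) sums
      (stieltjes k a n ?w - (k (\<i> * ?w) + k (- \<i> * ?w)) / 2 * Delta1 n ?w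
        + \<i> * ((k (\<i> * ?w) - k (- \<i> * ?w)) / 2) * Delta2 n ?w)"
    proof (rule stieltjes_expansion[OF hol right_rep_Re_pos[OF \<omega>'(1,2)] _ _ _ int])
      show "norm ?w < R" "R < \<rho>" "ereal R < a" using R \<rho> by auto
    qed blast
    \<comment> \<open>Finite parts are unique, so the moments obtained for this \<omega> and this
      cut do not depend on either.\<close>
    have "I = M" using fp_integral_eqI[OF I(1) \<open>0 < a\<close>] by (auto simp: M_def)
    with I show ?thesis by (simp add: stieltjes_right_rep)
  qed
  \<comment> \<open>A small positive real is admissible. This one point yields the existence of all
    finite parts and the convergence needed for continuity of the series at 0.\<close>
  have "0 < min a (sing_dist k)" using \<open>0 < a\<close> sing_dist_pos[OF k0] by simp
  then obtain r where r: "0 < ereal r" "ereal r < min a (sing_dist k)"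
    using ereal_dense2 by blast
  then have "complex_of_real r \<in> admissible k a" by (auto simp: admissible_def Arg_of_real)
  note r_exp = expansion[OF this]
  have part2: "summable (\<lambda>s. (-1) ^ s * \<omega> ^ (2 * s) * M s) \<and> stieltjes k a n \<omega> =
          (\<Sum>s. (-1) ^ s * \<omega> ^ (2 * s) * M s)
          + (k (\<i> * right_rep \<omega>) + k (- \<i> * right_rep \<omega>)) / 2 * Delta1 n (right_rep \<omega>)
          - \<i> * ((k (\<i> * right_rep \<omega>) - k (- \<i> * right_rep \<omega>)) / 2) * Delta2 n (right_rep \<omega>)"
    if "\<omega> \<in> admissible k a" for \<omega>
    using expansion[OF that] by (auto simp: sums_iff)
  let ?F = "at 0 within admissible k a"
  \<comment> \<open>The limit above holds in the full punctured neighbourhood of 0; composing with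
    \<open>right_rep\<close> carries it to the admissible \<omega>.\<close>
  have W: "filterlim right_rep (at 0) ?F"
    unfolding filterlim_at
  proof
    show "(right_rep \<longlongrightarrow> 0) ?F"
      by (rule tendsto_norm_zero_cancel) (simp add: tendsto_norm_zero tendsto_ident_at)
    show "eventually (\<lambda>\<omega>. right_rep \<omega> \<in> UNIV \<and> right_rep \<omega> \<noteq> 0) ?F"
      unfolding eventually_at_filter by (auto simp: right_rep_def)
  qed
  have asymp: "stieltjes k a n \<sim>[?F] (\<lambda>\<omega>. k 0 * Delta1 n (right_rep \<omega>))"
  proof (rule asymp_equivI')
    have "summable (\<lambda>s. (-1) ^ s * complex_of_real r ^ (2 * s) * M s)" "complex_of_real r \<noteq> 0"
      using r_exp r by (auto simp: sums_iff)
    from filterlim_compose[OF expansion_asymptotics[OF k0 nonzero this] W]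
    show "((\<lambda>\<omega>. stieltjes k a n \<omega> / (k 0 * Delta1 n (right_rep \<omega>))) \<longlongrightarrow> 1) ?F"
    proof (rule Lim_transform_eventually)
      show "eventually (\<lambda>\<omega>. ((\<Sum>s. (-1) ^ s * right_rep \<omega> ^ (2 * s) * M s)
          + (k (\<i> * right_rep \<omega>) + k (- \<i> * right_rep \<omega>)) / 2 * Delta1 n (right_rep \<omega>)
          - \<i> * ((k (\<i> * right_rep \<omega>) - k (- \<i> * right_rep \<omega>)) / 2) * Delta2 n (right_rep \<omega>)) / (k 0 * Delta1 n (right_rep \<omega>))
        = stieltjes k a n \<omega> / (k 0 * Delta1 n (right_rep \<omega>))) ?F"
        unfolding eventually_at_filter using part2 by (auto intro!: always_eventually)
    qed
  qed
  have fp: "\<forall>s. has_fp_integral (moment_integrand k n s) a (M s)" using r_exp by blast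
  show ?thesis
    unfolding Let_def M_def[symmetric]
    by (intro conjI ballI fp asymp part2[THEN conjunct1] part2[THEN conjunct2])
qed

end
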